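(* Let $k$ be a field, let $Q$ be a strongly locally finite quiver, and let $M\in\overline{\mathrm{rep}}(Q)$ with support $\Sigma$. There exist full subquivers $\Sigma_P$ and $\Sigma_I$ of $\Sigma$ such that: (1) $\Sigma_P$ is top-finite and successor-closed in $\Sigma$ such that $M_{\Sigma_P}$ is projective; (2) $\Sigma_I$ is socle-finite and predecessor-closed in $\Sigma\setminus\Sigma_P$ such that $M_{\Sigma_I}$ is injective; (3) $\Omega:=\Sigma\setminus(\Sigma_P\cup\Sigma_I)$ is finite and non-empty; (4) $M_\Omega$ is indecomposable whenever $M$ is indecomposable; and $M$ is indecomposable up to projectives and injectives whenever $M_\Omega$ is indecomposable. Moreover, if $\Sigma_P'$ is co-finite and successor-closed in $\Sigma_P$ and $\Sigma_I'$ is co-finite and predecessor-closed in $\Sigma_I$, then $\Sigma_I'$ and $\Sigma_P'$ also satisfy properties (1) to (4).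
   Context: A quiver $Q=(Q_0,Q_1)$ is strongly locally finite if it is locally finite (each vertex is attached to finitely many arrows) and interval-finite (for all vertices $x,y$ the set $Q(x,y)$ of paths from $x$ to $y$, including trivial paths, is finite). $\mathrm{rep}(Q)$ is the abelian category of locally finite dimensional representations $M$ of $Q$ over $k$ ($M(x)$ is finite dimensional for every $x\in Q_0$). For $a\in Q_0$: $P_a$ is the representation with $P_a(x)$ the vector space with basis $Q(a,x)$, arrows acting by extending paths; $I_a$ is the representation with $I_a(x)$ the vector space with basis $Q(x,a)$, an arrow $\alpha:x\to y$ acting by the transpose of the map $kQ(y,a)\to kQ(x,a)$ given by multiplication by $\alpha$. $\mathrm{rep}^+(Q)$ is the full subcategory of $\mathrm{rep}(Q)$ of finitely presented representations: those $M$ with an exact sequence $0\to P'\to P\to M\to 0$ where $P,P'$ are finite direct sums of representations $P_x$. $\mathrm{rep}^-(Q)$ is the full subcategory of finitely co-presented representations: those $M$ with an exact sequence $0\to M\to I\to I'\to 0$ where $I,I'$ are finite direct sums of representations $I_x$. The indecomposable projectives of $\mathrm{rep}^+(Q)$ are, up to isomorphism, the $P_x$, and the indecomposable injectives of $\mathrm{rep}^-(Q)$ are, up to isomorphism, the $I_x$. An arrow $\alpha$ supports $M$ if $M(\alpha)\neq 0$. A short exact sequence $0\to L\to M\to N\to 0$ in $\mathrm{rep}(Q)$ is called a finite extension of $N$ by $L$ (and $M$ a finite extension-representation of $N$ by $L$) if all but finitely many arrows supporting $M$ support $L\oplus N$. $\overline{\mathrm{rep}}(Q)$ is the full subcategory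 of $\mathrm{rep}(Q)$ of those $M$ which are finite extension-representations of $N$ by $L$ for some $L\in\mathrm{rep}^+(Q)$ and $N\in\mathrm{rep}^-(Q)$. The support of $M$ is the full subquiver of $Q$ on the vertices $x$ with $M(x)\ne 0$. For a full subquiver $\Omega$, $M_\Omega$ is the restriction of $M$ to $\Omega$, regarded as a representation of $Q$ by zero outside $\Omega$ (vertices and arrows). $\Sigma\setminus\Omega$ denotes the full subquiver on $\Sigma_0\setminus\Omega_0$. A full subquiver $\Omega$ of $\Sigma$ is successor-closed (resp. predecessor-closed) in $\Sigma$ if for every path in $\Sigma$ from $x$ to $y$ with $x\in\Omega$ (resp. $y\in\Omega$) we have $y\in\Omega$ (resp. $x\in\Omega$); it is co-finite in $\Sigma$ if $\Sigma_0\setminus\Omega_0$ is finite. A quiver is top-finite if it has finitely many source vertices and every vertex is a successor of one of them; socle-finite if it has finitely many sink vertices and every vertex is a predecessor of one of them. $M$ is indecomposable up to projectives and injectives if $M=M_1\oplus M_2$ implies that one of $M_1,M_2$ is projective in $\mathrm{rep}^+(Q)$ or injective in $\mathrm{rep}^-(Q)$.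
   Formalization: M is assumed non-zero (for M = 0 the support is empty, so Ω cannot be non-empty); L, N and the test objects for projectivity and injectivity are representations on subspaces of a k-space with underlying set k^ℕ, which give all of rep(Q) up to isomorphism. *)

theory Defs
  imports
    Complex_Main
    "HOL-Library.Function_Algebras"
    "HOL-Library.Product_Plus"
    "Graph_Theory.Digraph_Component"
begin

section \<open>Quivers\<close>

text \<open>
  A quiver is a \<^locale>\<open>wf_digraph\<close> (loops and parallel arrows are allowed, nothing is finite).
  A path from \<open>x\<close> to \<open>y\<close> is the list \<open>p\<close> of its arrows in the order in which they are traversed,
  \<open>pre_digraph.awalk Q x p y\<close>; the trivial path at \<open>x\<close> is the empty list.
\<close>

definition paths :: "('a, 'b) pre_digraph \<Rightarrow> 'a \<Rightarrow> 'a \<Rightarrow> 'b list set" where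
  "paths Q x y = {p. pre_digraph.awalk Q x p y}"

definition locally_finite :: "('a, 'b) pre_digraph \<Rightarrow> bool" where
  "locally_finite Q \<longleftrightarrow> (\<forall>x\<in>verts Q. finite (in_arcs Q x) \<and> finite (out_arcs Q x))"

definition interval_finite :: "('a, 'b) pre_digraph \<Rightarrow> bool" where
  "interval_finite Q \<longleftrightarrow> (\<forall>x\<in>verts Q. \<forall>y\<in>verts Q. finite (paths Q x y))"

definition strongly_locally_finite :: "('a, 'b) pre_digraph \<Rightarrow> bool" where
  "strongly_locally_finite Q \<longleftrightarrow> wf_digraph Q \<and> locally_finite Q \<and> interval_finite Q"

text \<open>Full subquivers are the library's induced subgraphs.\<close>

definition quiver_diff :: "('a, 'b) pre_digraph \<Rightarrow> ('a, 'b) pre_digraph \<Rightarrow> ('a, 'b) pre_digraph" where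
  "quiver_diff S T = S \<restriction> (verts S - verts T)"

definition successor_closed_in :: "('a, 'b) pre_digraph \<Rightarrow> ('a, 'b) pre_digraph \<Rightarrow> bool" where
  "successor_closed_in T S \<longleftrightarrow> induced_subgraph T S \<and>
     (\<forall>x y p. p \<in> paths S x y \<longrightarrow> x \<in> verts T \<longrightarrow> y \<in> verts T)"

definition predecessor_closed_in :: "('a, 'b) pre_digraph \<Rightarrow> ('a, 'b) pre_digraph \<Rightarrow> bool" where
  "predecessor_closed_in T S \<longleftrightarrow> induced_subgraph T S \<and>
     (\<forall>x y p. p \<in> paths S x y \<longrightarrow> y \<in> verts T \<longrightarrow> x \<in> verts T)"

definition cofinite_in :: "('a, 'b) pre_digraph \<Rightarrow> ('a, 'b) pre_digraph \<Rightarrow> bool" where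
  "cofinite_in T S \<longleftrightarrow> induced_subgraph T S \<and> finite (verts S - verts T)"

definition sources :: "('a, 'b) pre_digraph \<Rightarrow> 'a set" where
  "sources S = {x \<in> verts S. in_arcs S x = {}}"

definition sinks :: "('a, 'b) pre_digraph \<Rightarrow> 'a set" where
  "sinks S = {x \<in> verts S. out_arcs S x = {}}"

definition top_finite :: "('a, 'b) pre_digraph \<Rightarrow> bool" where
  "top_finite S \<longleftrightarrow> finite (sources S) \<and> (\<forall>y\<in>verts S. \<exists>x\<in>sources S. paths S x y \<noteq> {})"

definition socle_finite :: "('a, 'b) pre_digraph \<Rightarrow> bool" where
  "socle_finite S \<longleftrightarrow> finite (sinks S) \<and> (\<forall>x\<in>verts S. \<exists>y\<in>sinks S. paths S x y \<noteq> {})"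


section \<open>Locally finite dimensional representations\<close>

text \<open>
  A representation carries the scalar multiplication \<open>scl M\<close> of an ambient \<open>'k\<close>-vector space \<open>'v\<close>,
  a subspace \<open>sp M x\<close> of it for every vertex \<open>x\<close>, and a map \<open>mp M \<alpha>\<close> for every arrow \<open>\<alpha>\<close>. Only the
  values of \<open>mp M \<alpha>\<close> on \<open>sp M (tail Q \<alpha>)\<close> matter. Every family of vector spaces is of this form up
  to isomorphism, since it embeds into its direct sum.
\<close>

record ('k, 'a, 'b, 'v) qrep =
  scl :: "'k \<Rightarrow> 'v \<Rightarrow> 'v"
  sp :: "'a \<Rightarrow> 'v set"
  mp :: "'b \<Rightarrow> 'v \<Rightarrow> 'v"

definition linear_between ::
  "('k::field \<Rightarrow> 'v::ab_group_add \<Rightarrow> 'v) \<Rightarrow> ('k \<Rightarrow> 'w::ab_group_add \<Rightarrow> 'w) \<Rightarrow>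
   'v set \<Rightarrow> 'w set \<Rightarrow> ('v \<Rightarrow> 'w) \<Rightarrow> bool" where
  "linear_between s t V W f \<longleftrightarrow>
     (\<forall>v\<in>V. f v \<in> W) \<and>
     (\<forall>u\<in>V. \<forall>v\<in>V. f (u + v) = f u + f v) \<and>
     (\<forall>c. \<forall>v\<in>V. f (s c v) = t c (f v))"

definition lfd_rep ::
  "('a, 'b) pre_digraph \<Rightarrow> ('k::field, 'a, 'b, 'v::ab_group_add) qrep \<Rightarrow> bool" where
  "lfd_rep Q M \<longleftrightarrow>
     vector_space (scl M) \<and>
     (\<forall>x\<in>verts Q. module.subspace (scl M) (sp M x) \<and>
        (\<exists>B. finite B \<and> module.span (scl M) B = sp M x)) \<and>
     (\<forall>\<alpha>\<in>arcs Q.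
        linear_between (scl M) (scl M) (sp M (tail Q \<alpha>)) (sp M (head Q \<alpha>)) (mp M \<alpha>))"

text \<open>
  Quantification over all objects of \<open>rep(Q)\<close> is quantification over the representations with
  ambient space \<open>nat \<Rightarrow> 'k\<close>: this space contains a copy of every finite dimensional vector space,
  so every locally finite dimensional representation is isomorphic to one of these.
\<close>

type_synonym ('k, 'a, 'b) std_rep = "('k, 'a, 'b, nat \<Rightarrow> 'k) qrep"

definition zero_rep ::
  "('a, 'b) pre_digraph \<Rightarrow> ('k::field, 'a, 'b, 'v::ab_group_add) qrep \<Rightarrow> bool" where
  "zero_rep Q M \<longleftrightarrow> (\<forall>x\<in>verts Q. sp M x = {0})"

definition rep_hom ::
  "('a, 'b) pre_digraph \<Rightarrow> ('k::field, 'a, 'b, 'v::ab_group_add) qrep \<Rightarrow>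
   ('k, 'a, 'b, 'w::ab_group_add) qrep \<Rightarrow> ('a \<Rightarrow> 'v \<Rightarrow> 'w) \<Rightarrow> bool" where
  "rep_hom Q M N f \<longleftrightarrow>
     (\<forall>x\<in>verts Q. linear_between (scl M) (scl N) (sp M x) (sp N x) (f x)) \<and>
     (\<forall>\<alpha>\<in>arcs Q. \<forall>v\<in>sp M (tail Q \<alpha>). f (head Q \<alpha>) (mp M \<alpha> v) = mp N \<alpha> (f (tail Q \<alpha>) v))"

text \<open>Kernels and cokernels in \<open>rep(Q)\<close> are computed vertexwise, so monomorphisms, epimorphisms
and exactness are vertexwise conditions.\<close>

definition rep_mono ::
  "('a, 'b) pre_digraph \<Rightarrow> ('k::field, 'a, 'b, 'v::ab_group_add) qrep \<Rightarrow>
   ('k, 'a, 'b, 'w::ab_group_add) qrep \<Rightarrow> ('a \<Rightarrow> 'v \<Rightarrow> 'w) \<Rightarrow> bool" where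
  "rep_mono Q M N f \<longleftrightarrow> rep_hom Q M N f \<and> (\<forall>x\<in>verts Q. inj_on (f x) (sp M x))"

definition rep_epi ::
  "('a, 'b) pre_digraph \<Rightarrow> ('k::field, 'a, 'b, 'v::ab_group_add) qrep \<Rightarrow>
   ('k, 'a, 'b, 'w::ab_group_add) qrep \<Rightarrow> ('a \<Rightarrow> 'v \<Rightarrow> 'w) \<Rightarrow> bool" where
  "rep_epi Q M N f \<longleftrightarrow> rep_hom Q M N f \<and> (\<forall>x\<in>verts Q. f x ` sp M x = sp N x)"

definition short_exact ::
  "('a, 'b) pre_digraph \<Rightarrow> ('k::field, 'a, 'b, 'u::ab_group_add) qrep \<Rightarrow>
   ('k, 'a, 'b, 'v::ab_group_add) qrep \<Rightarrow> ('k, 'a, 'b, 'w::ab_group_add) qrep \<Rightarrow>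
   ('a \<Rightarrow> 'u \<Rightarrow> 'v) \<Rightarrow> ('a \<Rightarrow> 'v \<Rightarrow> 'w) \<Rightarrow> bool" where
  "short_exact Q L M N f g \<longleftrightarrow>
     rep_mono Q L M f \<and> rep_epi Q M N g \<and>
     (\<forall>x\<in>verts Q. f x ` sp L x = {v \<in> sp M x. g x v = 0})"

definition dsum ::
  "('k, 'a, 'b, 'v) qrep \<Rightarrow> ('k, 'a, 'b, 'w) qrep \<Rightarrow> ('k, 'a, 'b, 'v \<times> 'w) qrep" where
  "dsum L N =
     \<lparr> scl = (\<lambda>c (v, w). (scl L c v, scl N c w)),
       sp = (\<lambda>x. sp L x \<times> sp N x),
       mp = (\<lambda>\<alpha> (v, w). (mp L \<alpha> v, mp N \<alpha> w)) \<rparr>"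

text \<open>The direct sum of \<open>M 0, \<dots>, M (n - 1)\<close>.\<close>

definition dsum_fin ::
  "nat \<Rightarrow> (nat \<Rightarrow> ('k, 'a, 'b, 'v::ab_group_add) qrep) \<Rightarrow> ('k, 'a, 'b, nat \<Rightarrow> 'v) qrep" where
  "dsum_fin n M =
     \<lparr> scl = (\<lambda>c v i. scl (M i) c (v i)),
       sp = (\<lambda>x. {v. (\<forall>i<n. v i \<in> sp (M i) x) \<and> (\<forall>i\<ge>n. v i = 0)}),
       mp = (\<lambda>\<alpha> v i. if i < n then mp (M i) \<alpha> (v i) else 0) \<rparr>"


section \<open>The representations \<open>P\<^sub>a\<close> and \<open>I\<^sub>a\<close>\<close>

text \<open>
  The vector space with basis a set \<open>X\<close> of paths consists of the finitely supported coefficient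
  functions vanishing outside \<open>X\<close>.
\<close>

definition free_space :: "'p set \<Rightarrow> ('p \<Rightarrow> 'k::field) set" where
  "free_space X = {f. finite {p. f p \<noteq> 0} \<and> {p. f p \<noteq> 0} \<subseteq> X}"

text \<open>
  The arrow \<open>\<alpha>\<close> sends the basis vector \<open>p\<close> of \<open>P\<^sub>a\<close> to the basis vector \<open>p @ [\<alpha>]\<close>.
\<close>

definition proj_rep :: "('a, 'b) pre_digraph \<Rightarrow> 'a \<Rightarrow> ('k::field, 'a, 'b, 'b list \<Rightarrow> 'k) qrep" where
  "proj_rep Q a =
     \<lparr> scl = (\<lambda>c f p. c * f p),
       sp = (\<lambda>x. free_space (paths Q a x)),
       mp = (\<lambda>\<alpha> f q. if q \<noteq> [] \<and> last q = \<alpha> then f (butlast q) else 0) \<rparr>"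

text \<open>
  For \<open>\<alpha> : x \<rightarrow> y\<close>, the transpose of the map \<open>p \<mapsto> \<alpha> # p\<close> from the span of \<open>paths Q y a\<close> to the span
  of \<open>paths Q x a\<close> has at \<open>p\<close> the coefficient of its argument at \<open>\<alpha> # p\<close>.
\<close>

definition inj_rep :: "('a, 'b) pre_digraph \<Rightarrow> 'a \<Rightarrow> ('k::field, 'a, 'b, 'b list \<Rightarrow> 'k) qrep" where
  "inj_rep Q a =
     \<lparr> scl = (\<lambda>c f p. c * f p),
       sp = (\<lambda>x. free_space (paths Q x a)),
       mp = (\<lambda>\<alpha> f p. f (\<alpha> # p)) \<rparr>"


section \<open>The categories \<open>rep\<^sup>+(Q)\<close>, \<open>rep\<^sup>-(Q)\<close> and the finite extensions\<close>

definition rep_plus ::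
  "('a, 'b) pre_digraph \<Rightarrow> ('k::field, 'a, 'b, 'v::ab_group_add) qrep \<Rightarrow> bool" where
  "rep_plus Q M \<longleftrightarrow> lfd_rep Q M \<and>
     (\<exists>m n a b f g. (\<forall>i<m. a i \<in> verts Q) \<and> (\<forall>i<n. b i \<in> verts Q) \<and>
        short_exact Q (dsum_fin m (\<lambda>i. proj_rep Q (a i))) (dsum_fin n (\<lambda>i. proj_rep Q (b i))) M f g)"

definition rep_minus ::
  "('a, 'b) pre_digraph \<Rightarrow> ('k::field, 'a, 'b, 'v::ab_group_add) qrep \<Rightarrow> bool" where
  "rep_minus Q M \<longleftrightarrow> lfd_rep Q M \<and>
     (\<exists>m n a b f g. (\<forall>i<m. a i \<in> verts Q) \<and> (\<forall>i<n. b i \<in> verts Q) \<and>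
        short_exact Q M (dsum_fin m (\<lambda>i. inj_rep Q (a i))) (dsum_fin n (\<lambda>i. inj_rep Q (b i))) f g)"

text \<open>
  The lifting properties are tested on \<open>rep\<^sup>+(Q)\<close>, respectively \<open>rep\<^sup>-(Q)\<close>, only.
\<close>

definition projective_plus ::
  "('a, 'b) pre_digraph \<Rightarrow> ('k::field, 'a, 'b, 'v::ab_group_add) qrep \<Rightarrow> bool" where
  "projective_plus Q M \<longleftrightarrow> rep_plus Q M \<and>
     (\<forall>(X :: ('k, 'a, 'b) std_rep) (Y :: ('k, 'a, 'b) std_rep) g f.
        rep_plus Q X \<longrightarrow> rep_plus Q Y \<longrightarrow> rep_epi Q X Y g \<longrightarrow> rep_hom Q M Y f \<longrightarrow>
        (\<exists>h. rep_hom Q M X h \<and> (\<forall>x\<in>verts Q. \<forall>v\<in>sp M x. g x (h x v) = f x v)))"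

definition injective_minus ::
  "('a, 'b) pre_digraph \<Rightarrow> ('k::field, 'a, 'b, 'v::ab_group_add) qrep \<Rightarrow> bool" where
  "injective_minus Q M \<longleftrightarrow> rep_minus Q M \<and>
     (\<forall>(X :: ('k, 'a, 'b) std_rep) (Y :: ('k, 'a, 'b) std_rep) g f.
        rep_minus Q X \<longrightarrow> rep_minus Q Y \<longrightarrow> rep_mono Q X Y g \<longrightarrow> rep_hom Q X M f \<longrightarrow>
        (\<exists>h. rep_hom Q Y M h \<and> (\<forall>x\<in>verts Q. \<forall>v\<in>sp X x. h x (g x v) = f x v)))"

definition supports_rep ::
  "('a, 'b) pre_digraph \<Rightarrow> 'b \<Rightarrow> ('k::field, 'a, 'b, 'v::ab_group_add) qrep \<Rightarrow> bool" where
  "supports_rep Q \<alpha> M \<longleftrightarrow> (\<exists>v\<in>sp M (tail Q \<alpha>). mp M \<alpha> v \<noteq> 0)"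

definition finite_extension_rep ::
  "('a, 'b) pre_digraph \<Rightarrow> ('k::field, 'a, 'b, 'v::ab_group_add) qrep \<Rightarrow>
   ('k, 'a, 'b, 'w::ab_group_add) qrep \<Rightarrow> ('k, 'a, 'b, 'u::ab_group_add) qrep \<Rightarrow> bool" where
  "finite_extension_rep Q M N L \<longleftrightarrow>
     lfd_rep Q L \<and> lfd_rep Q M \<and> lfd_rep Q N \<and> (\<exists>f g. short_exact Q L M N f g) \<and>
     finite {\<alpha> \<in> arcs Q. supports_rep Q \<alpha> M \<and> \<not> supports_rep Q \<alpha> (dsum L N)}"

definition rep_bar ::
  "('a, 'b) pre_digraph \<Rightarrow> ('k::field, 'a, 'b, 'v::ab_group_add) qrep \<Rightarrow> bool" where
  "rep_bar Q M \<longleftrightarrow> lfd_rep Q M \<and>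
     (\<exists>(L :: ('k, 'a, 'b) std_rep) (N :: ('k, 'a, 'b) std_rep).
        rep_plus Q L \<and> rep_minus Q N \<and> finite_extension_rep Q M N L)"


section \<open>Support, restriction and decompositions\<close>

definition supp ::
  "('a, 'b) pre_digraph \<Rightarrow> ('k::field, 'a, 'b, 'v::ab_group_add) qrep \<Rightarrow> ('a, 'b) pre_digraph" where
  "supp Q M = Q \<restriction> {x \<in> verts Q. sp M x \<noteq> {0}}"

definition restrict_rep ::
  "('k::field, 'a, 'b, 'v::ab_group_add) qrep \<Rightarrow> ('a, 'b) pre_digraph \<Rightarrow> ('k, 'a, 'b, 'v) qrep" where
  "restrict_rep M S =
     \<lparr> scl = scl M,
       sp = (\<lambda>x. if x \<in> verts S then sp M x else {0}),
       mp = (\<lambda>\<alpha>. if \<alpha> \<in> arcs S then mp M \<alpha> else (\<lambda>_. 0)) \<rparr>"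

definition subrep ::
  "('a, 'b) pre_digraph \<Rightarrow> ('k::field, 'a, 'b, 'v::ab_group_add) qrep \<Rightarrow>
   ('k, 'a, 'b, 'v) qrep \<Rightarrow> bool" where
  "subrep Q L M \<longleftrightarrow> lfd_rep Q L \<and> scl L = scl M \<and> (\<forall>x\<in>verts Q. sp L x \<subseteq> sp M x) \<and>
     (\<forall>\<alpha>\<in>arcs Q. \<forall>v\<in>sp L (tail Q \<alpha>). mp L \<alpha> v = mp M \<alpha> v)"

definition internal_dsum ::
  "('a, 'b) pre_digraph \<Rightarrow> ('k::field, 'a, 'b, 'v::ab_group_add) qrep \<Rightarrow>
   ('k, 'a, 'b, 'v) qrep \<Rightarrow> ('k, 'a, 'b, 'v) qrep \<Rightarrow> bool" where
  "internal_dsum Q M M1 M2 \<longleftrightarrow> subrep Q M1 M \<and> subrep Q M2 M \<and>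
     (\<forall>x\<in>verts Q. sp M1 x \<inter> sp M2 x = {0} \<and> sp M x = {u + v | u v. u \<in> sp M1 x \<and> v \<in> sp M2 x})"

definition indecomposable ::
  "('a, 'b) pre_digraph \<Rightarrow> ('k::field, 'a, 'b, 'v::ab_group_add) qrep \<Rightarrow> bool" where
  "indecomposable Q M \<longleftrightarrow> \<not> zero_rep Q M \<and>
     (\<forall>M1 M2. internal_dsum Q M M1 M2 \<longrightarrow> zero_rep Q M1 \<or> zero_rep Q M2)"

definition indecomposable_upto_proj_inj ::
  "('a, 'b) pre_digraph \<Rightarrow> ('k::field, 'a, 'b, 'v::ab_group_add) qrep \<Rightarrow> bool" where
  "indecomposable_upto_proj_inj Q M \<longleftrightarrow>
     (\<forall>M1 M2. internal_dsum Q M M1 M2 \<longrightarrow>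
        projective_plus Q M1 \<or> injective_minus Q M1 \<or>
        projective_plus Q M2 \<or> injective_minus Q M2)"

definition properties_1_to_4 ::
  "('a, 'b) pre_digraph \<Rightarrow> ('k::field, 'a, 'b, 'v::ab_group_add) qrep \<Rightarrow>
   ('a, 'b) pre_digraph \<Rightarrow> ('a, 'b) pre_digraph \<Rightarrow> bool" where
  "properties_1_to_4 Q M SP SI \<longleftrightarrow>
     (let S = supp Q M; W = S \<restriction> (verts S - (verts SP \<union> verts SI)) in
        (top_finite SP \<and> successor_closed_in SP S \<and> projective_plus Q (restrict_rep M SP)) \<and>
        (socle_finite SI \<and> predecessor_closed_in SI (quiver_diff S SP) \<and>
           injective_minus Q (restrict_rep M SI)) \<and>
        (fin_digraph W \<and> verts W \<noteq> {}) \<and>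
        ((indecomposable Q M \<longrightarrow> indecomposable Q (restrict_rep M W)) \<and>
         (indecomposable Q (restrict_rep M W) \<longrightarrow> indecomposable_upto_proj_inj Q M)))"

end

theory Submission
  imports Defs
begin

text \<open>
  A finite presentation of \<open>L \<in> rep\<^sup>+(Q)\<close> shows, by the snake lemma, that for all but finitely many
  vertices \<open>y\<close> the map from the direct sum of the spaces \<open>L(x)\<close>, over all arrows \<open>x \<rightarrow> y\<close>, to \<open>L(y)\<close>
  is bijective. Conversely, injectivity of these maps everywhere and bijectivity almost everywhere,
  on a support without infinite backward paths, make a representation a finite direct sum of
  representations \<open>P\<^sub>a\<close>. The dual statements hold for \<open>N \<in> rep\<^sup>-(Q)\<close> and the representations \<open>I\<^sub>a\<close>.

  For a finite extension \<open>M\<close> of \<open>N\<close> by \<open>L\<close> the supports of \<open>L\<close> and \<open>N\<close> meet in a finite set. Let \<open>F\<close> be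
  finite and contain this set and its neighbours, the exceptional vertices of \<open>L\<close> and \<open>N\<close>, the ends
  of the exceptional arrows of the extension, and one vertex of the support of \<open>M\<close>. Then \<open>\<Sigma>\<^sub>P\<close> is the
  part of the support of \<open>L\<close> from which \<open>F\<close> cannot be reached, and \<open>\<Sigma>\<^sub>I\<close> is the part of the support of
  \<open>N\<close> that cannot be reached from \<open>F\<close>. There \<open>M\<close> is locally \<open>L\<close>, respectively \<open>N\<close>, so a direct sum
  decomposition of \<open>M\<^sub>\<Omega>\<close> extends uniquely to \<open>M\<close>: in fact \<open>M\<close> is indecomposable if and only if \<open>M\<^sub>\<Omega>\<close>
  is. All local conditions used pass to cofinite closed subquivers of \<open>\<Sigma>\<^sub>P\<close> and \<open>\<Sigma>\<^sub>I\<close>.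
\<close>

section \<open>Paths in strongly locally finite quivers\<close>

text \<open>The obstacle is that \<open>M\<close> need not be the direct sum of \<open>L\<close> and
  \<open>N\<close>, and that infinitely many arrows may join the two supports. The extension
  condition helps as follows: an arrow that has neither both ends in the support of \<open>L\<close>
  nor both in that of \<open>N\<close> acts as zero on \<open>L\<close> and on \<open>N\<close>,
  hence on \<open>M\<close> unless it is exceptional. So at a vertex of \<Sigma>-P only arrows from
  the support of \<open>L\<close> matter. The neighbours of the common support belong to
  \<open>F\<close> in order to keep the tails of these arrows out of the support of
  \<open>N\<close>, where \<open>M\<close> would differ from \<open>L\<close>.

  Bijectivity at a vertex says that its space is a copy of the direct sum of the spaces at the
  tails. Backward paths in the support of \<open>L\<close> end: only finitely many vertices lie
  between a finite set and a given vertex, and there are no oriented cycles. Hence everything on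
  \<Sigma>-P is determined by what lies on \<Omega>.

  The half for the \<open>I\<^sub>a\<close> mirrors the other: last arrows become first arrows,
  generators become linear functionals, and spanning becomes separation.\<close>

abbreviation pred_rel :: "('a, 'b) pre_digraph \<Rightarrow> ('a \<Rightarrow> bool) \<Rightarrow> ('a \<times> 'a) set" where
  "pred_rel Q P \<equiv> {(tail Q a, head Q a) | a. a \<in> arcs Q \<and> P (tail Q a) \<and> P (head Q a)}"

text \<open>In \<open>pred_rel\<close> the tail is the smaller vertex, so well-foundedness says that
  backward paths through \<open>P\<close> end; in \<open>succ_rel\<close> the head is smaller and
  forward paths end.\<close>

abbreviation succ_rel :: "('a, 'b) pre_digraph \<Rightarrow> ('a \<Rightarrow> bool) \<Rightarrow> ('a \<times> 'a) set" where
  "succ_rel Q P \<equiv> {(head Q a, tail Q a) | a. a \<in> arcs Q \<and> P (tail Q a) \<and> P (head Q a)}"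

locale slf_quiver =
  fixes Q :: "('a, 'b) pre_digraph"
  assumes slf: "strongly_locally_finite Q"

sublocale slf_quiver \<subseteq> wf_digraph Q
  using slf by (simp add: strongly_locally_finite_def)

context slf_quiver
begin

lemma finite_in_arcs: "finite (in_arcs Q x)"
  and finite_out_arcs: "finite (out_arcs Q x)"
proof -
  have "in_arcs Q x = {} \<and> out_arcs Q x = {}" if "x \<notin> verts Q"
    using that by (auto simp: in_arcs_def out_arcs_def)
  then show "finite (in_arcs Q x)" "finite (out_arcs Q x)"
    using slf by (cases "x \<in> verts Q"; simp add: strongly_locally_finite_def locally_finite_def)+
qed

end

context wf_digraph
begin

lemma paths_verts:
  assumes "p \<in> paths G x y" shows "x \<in> verts G" "y \<in> verts G"
  using assms by (auto simp: paths_def)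

lemma Nil_in_paths_iff: "[] \<in> paths G x y \<longleftrightarrow> x = y \<and> x \<in> verts G"
  by (auto simp: paths_def awalk_Nil_iff)

lemma Cons_in_paths_iff:
  "a # p \<in> paths G x y \<longleftrightarrow> a \<in> out_arcs G x \<and> p \<in> paths G (head G a) y"
  by (auto simp: paths_def awalk_Cons_iff)

lemma append_in_paths:
  "p \<in> paths G x y \<Longrightarrow> q \<in> paths G y z \<Longrightarrow> p @ q \<in> paths G x z"
  by (auto simp: paths_def)

lemma snoc_in_paths_iff:
  "p @ [a] \<in> paths G x y \<longleftrightarrow> a \<in> in_arcs G y \<and> p \<in> paths G x (tail G a)"
  by (auto simp: paths_def awalk_Cons_iff awalk_Nil_iff)

lemma arc_in_paths: "a \<in> arcs G \<Longrightarrow> [a] \<in> paths G (tail G a) (head G a)"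
  by (auto simp: paths_def arc_implies_awalk)

lemma closed_under_paths:
  assumes "p \<in> paths G x y" "x \<in> S"
    and "\<And>a. a \<in> arcs G \<Longrightarrow> tail G a \<in> S \<Longrightarrow> head G a \<in> S"
  shows "y \<in> S"
  using assms(1,2)
proof (induction p arbitrary: x)
  case Nil
  then show ?case by (simp add: Nil_in_paths_iff)
next
  case (Cons a p)
  then show ?case using assms(3) by (fastforce simp: Cons_in_paths_iff)
qed

lemma closed_under_paths_back:
  assumes "p \<in> paths G x y" "y \<in> S"
    and "\<And>a. a \<in> arcs G \<Longrightarrow> head G a \<in> S \<Longrightarrow> tail G a \<in> S"
  shows "x \<in> S"
  using closed_under_paths[of p x y "- S"] assms by auto

end

section \<open>Acyclicity and the vertices between two finite sets\<close>

context slf_quiver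
begin

lemma finite_paths: "finite (paths Q x y)"
proof (cases "x \<in> verts Q \<and> y \<in> verts Q")
  case True
  then show ?thesis using slf by (simp add: strongly_locally_finite_def interval_finite_def)
next
  case False
  then have "paths Q x y = {}" using paths_verts by blast
  then show ?thesis by simp
qed

text \<open>A nontrivial closed path could be repeated arbitrarily often, giving infinitely many
  paths from \<open>x\<close> to itself. So interval-finiteness rules out oriented cycles.\<close>

lemma closed_path_trivial:
  assumes "p \<in> paths Q x x" shows "p = []"
proof (rule ccontr)
  assume "p \<noteq> []"
  have "concat (replicate n p) \<in> paths Q x x" for n
    using assms by (induction n) (auto simp: Nil_in_paths_iff paths_verts intro: append_in_paths)
  moreover have "inj (\<lambda>n. concat (replicate n p))"
  proof (rule injI)
    fix m n :: nat
    assume "concat (replicate m p) = concat (replicate n p)"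
    then have "length (concat (replicate m p)) = length (concat (replicate n p))" by simp
    then have "m * length p = n * length p" by (simp add: length_concat sum_list_replicate)
    then show "m = n" using \<open>p \<noteq> []\<close> by simp
  qed
  ultimately have "infinite (paths Q x x)"
    by (meson finite_subset image_subsetI infinite_UNIV_nat finite_imageD)
  then show False by (simp add: finite_paths)
qed

definition between :: "'a set \<Rightarrow> 'a set \<Rightarrow> 'a set" where
  "between G H = {z. (\<exists>x\<in>G. paths Q x z \<noteq> {}) \<and> (\<exists>y\<in>H. paths Q z y \<noteq> {})}"

text \<open>Joining the two paths puts such a vertex on a path from \<open>G\<close> to
  \<open>H\<close>. There are finitely many of these, each visiting finitely many vertices.\<close>

lemma finite_between:
  assumes "finite G" "finite H" shows "finite (between G H)"
proof -
  have "between G H \<subseteq> (\<Union>x\<in>G. \<Union>y\<in>H. \<Union>r\<in>paths Q x y. set (awalk_verts x r))"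
  proof
    fix z assume "z \<in> between G H"
    then obtain x y p q where *: "x \<in> G" "y \<in> H" "p \<in> paths Q x z" "q \<in> paths Q z y"
      by (auto simp: between_def)
    then have pq: "p @ q \<in> paths Q x y" by (auto intro: append_in_paths)
    then have "awalk x (p @ q) y" "awalk x p z" "awalk z q y" using * by (auto simp: paths_def)
    then have "set (awalk_verts x (p @ q)) = set (awalk_verts x p) \<union> set (awalk_verts z q)"
      by (subst set_awalk_verts_append) auto
    moreover have "z \<in> set (awalk_verts z q)"
      using \<open>awalk z q y\<close> hd_in_awalk_verts(1) by blast
    ultimately show "z \<in> (\<Union>x\<in>G. \<Union>y\<in>H. \<Union>r\<in>paths Q x y. set (awalk_verts x r))"
      using * pq by blast
  qed
  moreover have "finite (\<Union>x\<in>G. \<Union>y\<in>H. \<Union>r\<in>paths Q x y. set (awalk_verts x r))"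
    using assms by (intro finite_UN_I finite_paths finite_set)
  ultimately show ?thesis by (rule finite_subset)
qed

text \<open>The measure counts the vertices between \<open>G\<close> and \<open>x\<close>. It grows
  along an arrow: what lies before the tail also lies before the head, and the head itself is new
  because a path from it back to the tail would close a cycle.\<close>

lemma wf_arcs_from:
  assumes "finite G" and S: "\<And>x. x \<in> S \<Longrightarrow> \<exists>g\<in>G. paths Q g x \<noteq> {}"
  shows "wf (pred_rel Q (\<lambda>x. x \<in> S))"
proof (rule wf_subset[OF wf_measure[of "\<lambda>x. card (between G {x})"]], clarsimp)
  fix a assume a: "a \<in> arcs Q" "tail Q a \<in> S" "head Q a \<in> S"
  have "between G {tail Q a} \<subseteq> between G {head Q a}"
    using append_in_paths[OF _ arc_in_paths[OF a(1)]] by (fastforce simp: between_def)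
  moreover have "head Q a \<in> between G {head Q a}"
    using S[OF a(3)] paths_verts Nil_in_paths_iff by (fastforce simp: between_def)
  moreover have "head Q a \<notin> between G {tail Q a}"
    using append_in_paths[OF arc_in_paths[OF a(1)]] closed_path_trivial
    by (fastforce simp: between_def)
  ultimately have "between G {tail Q a} \<subset> between G {head Q a}" by blast
  then show "card (between G {tail Q a}) < card (between G {head Q a})"
    using finite_between[OF assms(1)] by (simp add: psubset_card_mono)
qed

lemma wf_arcs_to:
  assumes "finite G" and S: "\<And>x. x \<in> S \<Longrightarrow> \<exists>g\<in>G. paths Q x g \<noteq> {}"
  shows "wf (succ_rel Q (\<lambda>x. x \<in> S))"
proof (rule wf_subset[OF wf_measure[of "\<lambda>x. card (between {x} G)"]], clarsimp)
  fix a assume a: "a \<in> arcs Q" "tail Q a \<in> S" "head Q a \<in> S"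
  have "between {head Q a} G \<subseteq> between {tail Q a} G"
    using append_in_paths[OF arc_in_paths[OF a(1)]] by (fastforce simp: between_def)
  moreover have "tail Q a \<in> between {tail Q a} G"
    using S[OF a(2)] paths_verts Nil_in_paths_iff by (fastforce simp: between_def)
  moreover have "tail Q a \<notin> between {head Q a} G"
    using append_in_paths[OF arc_in_paths[OF a(1)]] closed_path_trivial
    by (fastforce simp: between_def)
  ultimately have "between {head Q a} G \<subset> between {tail Q a} G" by blast
  then show "card (between {head Q a} G) < card (between {tail Q a} G)"
    using finite_between[OF _ assms(1)] by (simp add: psubset_card_mono)
qed

end

section \<open>Linear maps between subspaces\<close>

lemma linear_betweenD:
  assumes "linear_between s t V W f"
  shows "v \<in> V \<Longrightarrow> f v \<in> W" "u \<in> V \<Longrightarrow> v \<in> V \<Longrightarrow> f (u + v) = f u + f v"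
    "v \<in> V \<Longrightarrow> f (s c v) = t c (f v)"
  using assms by (auto simp: linear_between_def)

lemma linear_between_zero:
  assumes "linear_between s t V W f" "0 \<in> V"
  shows "f 0 = 0"
  using linear_betweenD(2)[OF assms(1,2,2)] by simp

context vector_space
begin

lemma linear_between_sum:
  assumes "linear_between scale t V W f" "subspace V" "\<And>i. i \<in> A \<Longrightarrow> v i \<in> V"
  shows "f (\<Sum>i\<in>A. v i) = (\<Sum>i\<in>A. f (v i))"
  using assms(3)
proof (induction A rule: infinite_finite_induct)
  case (insert x A)
  then have "(\<Sum>i\<in>A. v i) \<in> V" by (intro subspace_sum[OF assms(2)]) auto
  with insert show ?case using linear_betweenD(2)[OF assms(1)] by simp
qed (use linear_between_zero[OF assms(1)] subspace_0[OF assms(2)] in auto)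

lemma linear_between_diff:
  assumes "linear_between scale t V W f" "subspace V" "u \<in> V" "v \<in> V"
  shows "f (u - v) = f u - f v"
proof -
  have "f ((u - v) + v) = f (u - v) + f v"
    using assms(3,4) by (intro linear_betweenD(2)[OF assms(1)] subspace_diff[OF assms(2)])
  then show ?thesis by (simp add: algebra_simps)
qed

lemma linear_between_inj_on:
  assumes lin: "linear_between scale t V W f" and V: "subspace V"
    and ker: "\<And>v. v \<in> V \<Longrightarrow> f v = 0 \<Longrightarrow> v = 0"
  shows "inj_on f V"
proof (rule inj_onI)
  fix u v assume uv: "u \<in> V" "v \<in> V" "f u = f v"
  then have "f (u - v) = 0" using linear_between_diff[OF lin V] by simp
  then show "u = v" using ker[OF subspace_diff[OF V uv(1,2)]] by simp
qed

lemma extend_basis_finite: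
  assumes "subspace U" "U \<subseteq> V" "finite S" "span S = V"
  obtains B C where "finite C" "B \<subseteq> C" "independent C" "B \<subseteq> U" "U = span B" "V = span C"
proof -
  obtain B where B: "B \<subseteq> U" "independent B" "U \<subseteq> span B"
    using basis_exists[of U] by metis
  obtain C where C: "B \<subseteq> C" "C \<subseteq> V" "independent C" "V \<subseteq> span C"
    using maximal_independent_subset_extend[of B V] B(1,2) assms(2) by (metis subset_trans)
  have "C \<subseteq> span S" using C(2) assms(4) by simp
  then have "finite C" using independent_span_bound[OF assms(3) C(3)] by simp
  moreover have "U = span B" using B(1,3) assms(1) by (metis span_minimal subset_antisym)
  moreover have "V = span C"
    using C(2,4) assms(4) by (metis span_minimal subspace_span subset_antisym)
  ultimately show ?thesis using that[OF _ C(1) C(3) B(1)] by metis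
qed

lemma finitely_spanned_subspace:
  assumes "subspace U" "U \<subseteq> V" "finite S" "span S = V"
  shows "\<exists>B. finite B \<and> span B = U"
proof -
  obtain B C where "finite C" "B \<subseteq> C" "U = span B" using extend_basis_finite[OF assms] .
  then show ?thesis using finite_subset[of B C] by auto
qed

text \<open>\<open>D\<close> is a basis of a complement of \<open>U\<close> in \<open>V\<close>,
  expressed through coefficients. With \<open>U\<close> spanned by the images of the incoming
  arrows, \<open>D\<close> will be the set of generators to be added at a vertex.\<close>

lemma complement_basis:
  assumes "subspace U" "U \<subseteq> V" "finite S" "span S = V"
  obtains D where "finite D" "D \<subseteq> V"
    "\<And>v. v \<in> V \<Longrightarrow> \<exists>u\<in>U. \<exists>c. v = u + (\<Sum>d\<in>D. c d *s d)"
    "\<And>u c. u \<in> U \<Longrightarrow> u + (\<Sum>d\<in>D. c d *s d) = 0 \<Longrightarrow> u = 0 \<and> (\<forall>d\<in>D. c d = 0)"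
proof -
  obtain B C where C: "finite C" "B \<subseteq> C" "independent C" "B \<subseteq> U" "U = span B" "V = span C"
    using extend_basis_finite[OF assms] .
  have fB: "finite B" using C finite_subset by blast
  have split: "(\<Sum>d\<in>C. c d *s d) = (\<Sum>d\<in>B. c d *s d) + (\<Sum>d\<in>C - B. c d *s d)" for c
    using C by (metis (no_types, lifting) add.commute sum.subset_diff)
  show ?thesis
  proof (rule that[of "C - B"])
    show "finite (C - B)" "C - B \<subseteq> V" using C by (auto intro: span_base)
  next
    fix v assume "v \<in> V"
    then obtain c where "v = (\<Sum>d\<in>C. c d *s d)" using C by (auto simp: span_finite)
    then have "v = (\<Sum>d\<in>B. c d *s d) + (\<Sum>d\<in>C - B. c d *s d)" by (simp add: split)
    moreover have "(\<Sum>d\<in>B. c d *s d) \<in> U"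
      using C(4) by (auto intro!: subspace_sum[OF assms(1)] subspace_scale[OF assms(1)])
    ultimately show "\<exists>u\<in>U. \<exists>c. v = u + (\<Sum>d\<in>C - B. c d *s d)" by blast
  next
    fix u c assume "u \<in> U" and 0: "u + (\<Sum>d\<in>C - B. c d *s d) = 0"
    then obtain r where r: "u = (\<Sum>d\<in>B. r d *s d)" using C fB by (auto simp: span_finite)
    \<comment> \<open>One coefficient family on all of \<open>C\<close>, to which the independence
      of \<open>C\<close> applies.\<close>
    define e where "e d = (if d \<in> B then r d else c d)" for d
    have "(\<Sum>d\<in>C. e d *s d) = (\<Sum>d\<in>B. r d *s d) + (\<Sum>d\<in>C - B. c d *s d)"
      unfolding split by (simp add: e_def)
    then have "(\<Sum>d\<in>C. e d *s d) = 0" using 0 r by simp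
    then have "e d = 0" if "d \<in> C" for d
      using independentD[OF C(3) C(1) subset_refl _ that] by blast
    note e0 = this
    have "r d = 0" if "d \<in> B" for d using e0[of d] that C(2) by (auto simp: e_def)
    moreover have "c d = 0" if "d \<in> C - B" for d using e0[of d] that by (simp add: e_def)
    ultimately show "u = 0 \<and> (\<forall>d\<in>C - B. c d = 0)" by (simp add: r)
  qed
qed

lemma linear_between_representation:
  assumes "independent C"
  shows "linear_between scale (*) (span C) UNIV (\<lambda>v. representation C v d)"
  using assms by (auto simp: linear_between_def representation_add representation_scale)

text \<open>Dual to \<open>complement_basis\<close>: the functionals restrict to a basis of the dual
  of \<open>U\<close>. They are coordinates with respect to a basis of \<open>V\<close> that extends
  one of \<open>U\<close>.\<close>

lemma dual_basis_functionals:
  assumes "subspace U" "U \<subseteq> V" "finite S" "span S = V"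
  obtains D :: "'b set" and lam where "finite D"
    "\<And>d. d \<in> D \<Longrightarrow> linear_between scale (*) V UNIV (lam d)"
    "\<And>v. v \<in> U \<Longrightarrow> (\<And>d. d \<in> D \<Longrightarrow> lam d v = 0) \<Longrightarrow> v = 0"
    "\<And>t. \<exists>v\<in>U. \<forall>d\<in>D. lam d v = t d"
proof -
  obtain B C where C: "finite C" "B \<subseteq> C" "independent C" "B \<subseteq> U" "U = span B" "V = span C"
    using extend_basis_finite[OF assms] .
  have fB: "finite B" and iB: "independent B" using C finite_subset independent_mono by blast+
  have rep: "representation C v = representation B v" if "v \<in> U" for v
    using C that by (intro representation_extend) auto
  show ?thesis
  proof (rule that[of B "\<lambda>d v. representation C v d"])
    show "linear_between scale (*) V UNIV (\<lambda>v. representation C v d)" for d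
      using linear_between_representation C by simp
  next
    fix v assume v: "v \<in> U" "\<And>d. d \<in> B \<Longrightarrow> representation C v d = 0"
    have "v = (\<Sum>b\<in>B. representation B v b *s b)"
      using v C fB iB by (subst sum_representation_eq) auto
    also have "\<dots> = 0" using v rep by simp
    finally show "v = 0" .
  next
    fix t
    let ?v = "\<Sum>b\<in>B. t b *s b"
    have v: "?v \<in> U"
      using C(4) by (auto intro!: subspace_sum[OF assms(1)] subspace_scale[OF assms(1)])
    have "representation B ?v d = t d" if "d \<in> B" for d
    proof -
      have "representation B ?v d = (\<Sum>b\<in>B. t b * representation B b d)"
        using iB by (subst representation_sum)
          (auto intro: span_scale span_base intro!: sum.cong simp: representation_scale span_base)
      also have "\<dots> = (\<Sum>b\<in>B. if b = d then t b else 0)"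
        using iB by (intro sum.cong) (auto simp: representation_basis)
      finally show ?thesis using that fB by simp
    qed
    then show "\<exists>v\<in>U. \<forall>d\<in>B. representation C v d = t d" using v rep by auto
  qed (fact fB)
qed

text \<open>The extension kills the basis vectors outside \<open>U\<close>. This is the source of
  the injectivity of the representations \<open>I\<^sub>a\<close>.\<close>

lemma extend_functional:
  assumes "subspace U" "U \<subseteq> V" "finite S" "span S = V"
    and mu: "linear_between scale (*) U UNIV mu"
  obtains nu where "linear_between scale (*) V UNIV nu" "\<And>u. u \<in> U \<Longrightarrow> nu u = mu u"
proof -
  obtain B C where C: "finite C" "B \<subseteq> C" "independent C" "B \<subseteq> U" "U = span B" "V = span C"
    using extend_basis_finite[OF assms(1-4)] .
  have fB: "finite B" and iB: "independent B" using C finite_subset independent_mono by blast+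
  define nu where "nu v = (\<Sum>b\<in>B. representation C v b * mu b)" for v
  have "linear_between scale (*) V UNIV nu"
    using C(3,6) by (simp add: linear_between_def nu_def representation_add representation_scale
      distrib_right sum.distrib sum_distrib_left mult.assoc)
  moreover have "nu u = mu u" if "u \<in> U" for u
  proof -
    have "representation C u = representation B u"
      using C(2,3,5) that by (intro representation_extend) auto
    then have "nu u = (\<Sum>b\<in>B. representation B u b * mu b)" by (simp add: nu_def)
    also have "\<dots> = (\<Sum>b\<in>B. mu (representation B u b *s b))"
      using C(4) linear_betweenD(3)[OF mu] by (intro sum.cong) auto
    also have "\<dots> = mu (\<Sum>b\<in>B. representation B u b *s b)"
      using C(4) subspace_scale[OF assms(1)]
      by (intro linear_between_sum[OF mu assms(1), symmetric]) auto
    also have "(\<Sum>b\<in>B. representation B u b *s b) = u"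
      using that C(5) by (intro sum_representation_eq[OF iB _ fB]) auto
    finally show ?thesis .
  qed
  ultimately show ?thesis using that by blast
qed

end

section \<open>Maps out of sums of the representations \<open>P\<^sub>a\<close>\<close>

lemma lfd_repD:
  assumes "lfd_rep Q M"
  shows "vector_space (scl M)"
    and "x \<in> verts Q \<Longrightarrow> module.subspace (scl M) (sp M x)"
    and "x \<in> verts Q \<Longrightarrow> \<exists>B. finite B \<and> module.span (scl M) B = sp M x"
    and "a \<in> arcs Q \<Longrightarrow>
      linear_between (scl M) (scl M) (sp M (tail Q a)) (sp M (head Q a)) (mp M a)"
  using assms by (auto simp: lfd_rep_def)

lemma lfd_rep_mp:
  "lfd_rep Q M \<Longrightarrow> a \<in> arcs Q \<Longrightarrow> v \<in> sp M (tail Q a) \<Longrightarrow> mp M a v \<in> sp M (head Q a)"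
  by (rule linear_betweenD(1)[OF lfd_repD(4)])

lemma rep_homD:
  assumes "rep_hom Q M N f"
  shows "x \<in> verts Q \<Longrightarrow> linear_between (scl M) (scl N) (sp M x) (sp N x) (f x)"
    and "a \<in> arcs Q \<Longrightarrow> v \<in> sp M (tail Q a) \<Longrightarrow>
      f (head Q a) (mp M a v) = mp N a (f (tail Q a) v)"
  using assms by (auto simp: rep_hom_def)

lemma lfd_rep_sum_closed:
  assumes "lfd_rep Q M" "x \<in> verts Q" "\<And>i. i \<in> A \<Longrightarrow> v i \<in> sp M x"
  shows "(\<Sum>i\<in>A. v i) \<in> sp M x"
proof -
  interpret vector_space "scl M" using assms(1) by (rule lfd_repD)
  show ?thesis using subspace_sum[OF lfd_repD(2)[OF assms(1,2)]] assms(3) by blast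
qed

lemma lfd_rep_zero: "lfd_rep Q M \<Longrightarrow> x \<in> verts Q \<Longrightarrow> 0 \<in> sp M x"
  using lfd_rep_sum_closed[of Q M x "{}"] by simp

lemma lfd_rep_nonzero:
  assumes "lfd_rep Q M" "x \<in> verts Q" "sp M x \<noteq> {0}" obtains v where "v \<in> sp M x" "v \<noteq> 0"
  using lfd_rep_zero[OF assms(1,2)] assms(3) by auto

lemma
  assumes M: "lfd_rep Q M" and x: "x \<in> verts Q"
  shows lfd_rep_scale: "v \<in> sp M x \<Longrightarrow> scl M c v \<in> sp M x"
    and lfd_rep_add: "u \<in> sp M x \<Longrightarrow> v \<in> sp M x \<Longrightarrow> u + v \<in> sp M x"
    and lfd_rep_diff: "u \<in> sp M x \<Longrightarrow> v \<in> sp M x \<Longrightarrow> u - v \<in> sp M x"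
proof -
  interpret vector_space "scl M" using M by (rule lfd_repD)
  note sub = lfd_repD(2)[OF M x]
  show "v \<in> sp M x \<Longrightarrow> scl M c v \<in> sp M x" by (rule subspace_scale[OF sub])
  show "u \<in> sp M x \<Longrightarrow> v \<in> sp M x \<Longrightarrow> u + v \<in> sp M x" by (rule subspace_add[OF sub])
  show "u \<in> sp M x \<Longrightarrow> v \<in> sp M x \<Longrightarrow> u - v \<in> sp M x" by (rule subspace_diff[OF sub])
qed

section \<open>The maps attached to the arrows at a vertex\<close>

abbreviation arc_sum :: "('k, 'a, 'b, 'v::comm_monoid_add) qrep \<Rightarrow> 'b set \<Rightarrow> ('b \<Rightarrow> 'v) \<Rightarrow> 'v" where
  "arc_sum M S w \<equiv> \<Sum>a\<in>S. mp M a (w a)"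

text \<open>An element of the direct sum over the tails is encoded as a family \<open>w\<close>,
  whose values off \<open>S\<close> are immaterial. \<open>S\<close> is a parameter because for
  \<open>L\<close> all incoming arrows are taken, but for \<open>M\<close> only those from the
  support of \<open>L\<close>.\<close>

definition sum_injective ::
  "('a, 'b) pre_digraph \<Rightarrow> ('k::field, 'a, 'b, 'v::ab_group_add) qrep \<Rightarrow> 'b set \<Rightarrow> bool" where
  "sum_injective Q M S \<longleftrightarrow> (\<forall>w. (\<forall>a\<in>S. w a \<in> sp M (tail Q a)) \<longrightarrow>
     (arc_sum M S w) = 0 \<longrightarrow> (\<forall>a\<in>S. w a = 0))"

lemma sum_injectiveD:
  assumes "sum_injective Q M S" "\<And>a. a \<in> S \<Longrightarrow> w a \<in> sp M (tail Q a)"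
    and "arc_sum M S w = 0" "a \<in> S"
  shows "w a = 0"
  using assms(1)[unfolded sum_injective_def, rule_format, of w] assms(2-) by simp

definition sum_surjective ::
  "('a, 'b) pre_digraph \<Rightarrow> ('k::field, 'a, 'b, 'v::ab_group_add) qrep \<Rightarrow> 'b set \<Rightarrow> 'a \<Rightarrow> bool" where
  "sum_surjective Q M S x \<longleftrightarrow>
     (\<forall>v\<in>sp M x. \<exists>w. (\<forall>a\<in>S. w a \<in> sp M (tail Q a)) \<and> v = arc_sum M S w)"

definition prod_injective ::
  "('a, 'b) pre_digraph \<Rightarrow> ('k::field, 'a, 'b, 'v::ab_group_add) qrep \<Rightarrow> 'b set \<Rightarrow> 'a \<Rightarrow> bool" where
  "prod_injective Q M S x \<longleftrightarrow> (\<forall>v\<in>sp M x. (\<forall>r\<in>S. mp M r v = 0) \<longrightarrow> v = 0)"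

definition prod_surjective ::
  "('a, 'b) pre_digraph \<Rightarrow> ('k::field, 'a, 'b, 'v::ab_group_add) qrep \<Rightarrow> 'b set \<Rightarrow> 'a \<Rightarrow> bool" where
  "prod_surjective Q M S x \<longleftrightarrow> (\<forall>w. (\<forall>r\<in>S. w r \<in> sp M (head Q r)) \<longrightarrow>
     (\<exists>v\<in>sp M x. \<forall>r\<in>S. mp M r v = w r))"

lemma mp_zero:
  assumes "wf_digraph Q" "lfd_rep Q M" "a \<in> arcs Q" shows "mp M a 0 = 0"
  using linear_between_zero[OF lfd_repD(4)[OF assms(2,3)]]
    lfd_rep_zero[OF assms(2)] wf_digraph.tail_in_verts[OF assms(1,3)] by blast

lemma linear_between_comp:
  "linear_between s t V W f \<Longrightarrow> linear_between t r W Z g \<Longrightarrow> linear_between s r V Z (\<lambda>v. g (f v))"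
  by (simp add: linear_between_def)

lemma rep_hom_comp:
  assumes "wf_digraph Q" "rep_hom Q L M f" "rep_hom Q M N g"
  shows "rep_hom Q L N (\<lambda>x v. g x (f x v))"
  unfolding rep_hom_def
proof (intro conjI ballI)
  fix x assume "x \<in> verts Q"
  then show "linear_between (scl L) (scl N) (sp L x) (sp N x) (\<lambda>v. g x (f x v))"
    using rep_homD(1)[OF assms(2)] rep_homD(1)[OF assms(3)] by (blast intro: linear_between_comp)
next
  fix a v assume a: "a \<in> arcs Q" and v: "v \<in> sp L (tail Q a)"
  have "f (tail Q a) v \<in> sp M (tail Q a)"
    using linear_betweenD(1)[OF rep_homD(1)[OF assms(2)] v] wf_digraph.tail_in_verts[OF assms(1) a] .
  then show "g (head Q a) (f (head Q a) (mp L a v)) = mp N a (g (tail Q a) (f (tail Q a) v))"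
    using rep_homD(2)[OF assms(2) a v] rep_homD(2)[OF assms(3) a] by simp
qed

lemma linear_between_inv_into:
  assumes "linear_between s t V W f" "bij_betw f V W"
    and "\<And>u v. u \<in> V \<Longrightarrow> v \<in> V \<Longrightarrow> u + v \<in> V" "\<And>c v. v \<in> V \<Longrightarrow> s c v \<in> V"
  shows "linear_between t s W V (inv_into V f)"
proof -
  have i: "inv_into V f w \<in> V \<and> f (inv_into V f w) = w" if "w \<in> W" for w
    using that assms(2) by (metis bij_betw_def f_inv_into_f inv_into_into)
  have e: "inv_into V f w = v" if "v \<in> V" "f v = w" for v w
    using that assms(2) by (metis bij_betw_def inv_into_f_f)
  show ?thesis
    unfolding linear_between_def
    using i assms(3,4) linear_betweenD[OF assms(1)]
    by (intro conjI ballI allI) (auto intro!: e)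
qed

text \<open>Closure of \<open>M\<close> is assumed clause by clause instead of as
  \<open>lfd_rep\<close>, so that the lemma also applies to \<open>proj_sum\<close>, for which just
  these clauses are established.\<close>

lemma rep_hom_inv_into:
  assumes "wf_digraph Q" "rep_hom Q M N f" "\<And>x. x \<in> verts Q \<Longrightarrow> bij_betw (f x) (sp M x) (sp N x)"
    and "\<And>x u v. x \<in> verts Q \<Longrightarrow> u \<in> sp M x \<Longrightarrow> v \<in> sp M x \<Longrightarrow> u + v \<in> sp M x"
    and "\<And>x c v. x \<in> verts Q \<Longrightarrow> v \<in> sp M x \<Longrightarrow> scl M c v \<in> sp M x"
    and "\<And>a v. a \<in> arcs Q \<Longrightarrow> v \<in> sp M (tail Q a) \<Longrightarrow> mp M a v \<in> sp M (head Q a)"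
  shows "rep_hom Q N M (\<lambda>x. inv_into (sp M x) (f x))"
  unfolding rep_hom_def
proof (intro conjI ballI)
  fix x assume "x \<in> verts Q"
  then show "linear_between (scl N) (scl M) (sp N x) (sp M x) (inv_into (sp M x) (f x))"
    using assms rep_homD(1)[OF assms(2)] by (intro linear_between_inv_into) auto
next
  fix a v assume a: "a \<in> arcs Q" and v: "v \<in> sp N (tail Q a)"
  then have x: "tail Q a \<in> verts Q" "head Q a \<in> verts Q"
    using assms(1) by (auto simp: wf_digraph_def)
  let ?u = "inv_into (sp M (tail Q a)) (f (tail Q a)) v"
  have u: "?u \<in> sp M (tail Q a)" "f (tail Q a) ?u = v"
    using v assms(3)[OF x(1)] by (metis bij_betw_def inv_into_into, metis bij_betw_def f_inv_into_f)
  then have "f (head Q a) (mp M a ?u) = mp N a v"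
    using rep_homD(2)[OF assms(2) a] by simp
  then show "inv_into (sp M (head Q a)) (f (head Q a)) (mp N a v) = mp M a ?u"
    using assms(3)[OF x(2)] assms(6)[OF a u(1)] by (metis bij_betw_def inv_into_f_f)
qed

context slf_quiver
begin

lemmas mp_0 = mp_zero[OF wf_digraph_axioms]

lemma fold_linear_between:
  assumes "lfd_rep Q X" "p \<in> paths Q x y"
  shows "linear_between (scl X) (scl X) (sp X x) (sp X y) (fold (mp X) p)"
  using assms(2)
proof (induction p arbitrary: x)
  case Nil
  then show ?case by (simp add: Nil_in_paths_iff linear_between_def)
next
  case (Cons a p)
  then have a: "a \<in> arcs Q" "tail Q a = x" and p: "p \<in> paths Q (head Q a) y"
    by (auto simp: Cons_in_paths_iff)
  show ?case
    using linear_between_comp[OF lfd_repD(4)[OF assms(1) a(1)] Cons.IH[OF p]] a(2)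
    by (simp add: comp_def)
qed

lemma rep_hom_fold:
  assumes "lfd_rep Q X" "rep_hom Q X Y g" "p \<in> paths Q x y" "v \<in> sp X x"
  shows "g y (fold (mp X) p v) = fold (mp Y) p (g x v)"
  using assms(3,4)
proof (induction p arbitrary: x v)
  case Nil
  then show ?case by (simp add: Nil_in_paths_iff)
next
  case (Cons a p)
  then have a: "a \<in> arcs Q" "tail Q a = x" and p: "p \<in> paths Q (head Q a) y"
    by (auto simp: Cons_in_paths_iff)
  have "mp X a v \<in> sp X (head Q a)"
    using lfd_rep_mp[OF assms(1) a(1)] a Cons.prems by simp
  then show ?case
    using Cons.IH[OF p] rep_homD(2)[OF assms(2) a(1)] a Cons.prems by simp
qed

section \<open>Sums of the \<open>P\<^sub>a\<close> and the maps given by generators\<close>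

abbreviation proj_sum :: "nat \<Rightarrow> (nat \<Rightarrow> 'a) \<Rightarrow> ('k::field, 'a, 'b, nat \<Rightarrow> 'b list \<Rightarrow> 'k) qrep" where
  "proj_sum n b \<equiv> dsum_fin n (\<lambda>i. proj_rep Q (b i))"

text \<open>Interval-finiteness makes the finiteness of supports automatic.\<close>

lemma free_space_paths:
  "(f :: 'b list \<Rightarrow> 'k::field) \<in> free_space (paths Q x y) \<longleftrightarrow> (\<forall>p. f p \<noteq> 0 \<longrightarrow> p \<in> paths Q x y)"
  using finite_subset[OF _ finite_paths[of x y], of "{p. f p \<noteq> 0}"] by (auto simp: free_space_def)

lemma sp_proj_sum:
  "v \<in> sp (proj_sum n b) x \<longleftrightarrow>
     (\<forall>i p. v i p \<noteq> 0 \<longrightarrow> i < n \<and> p \<in> paths Q (b i) x)"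
  unfolding dsum_fin_def proj_rep_def
  by (auto simp: free_space_paths zero_fun_def fun_eq_iff) (meson linorder_not_less)+

lemma mp_proj_sum:
  "mp (proj_sum n b) a v i q =
     (if i < n \<and> q \<noteq> [] \<and> last q = a then v i (butlast q) else 0)"
  by (simp add: dsum_fin_def proj_rep_def)

lemma scl_proj_sum: "scl (proj_sum n b) c v i p = c * v i p"
  by (simp add: dsum_fin_def proj_rep_def)

lemma proj_sum_closed:
  fixes n b defines "P \<equiv> (proj_sum n b :: ('k::field, _, _, _) qrep)"
  shows "u \<in> sp P x \<Longrightarrow> v \<in> sp P x \<Longrightarrow> u + v \<in> sp P x"
    and "v \<in> sp P x \<Longrightarrow> scl P c v \<in> sp P x"
    and "a \<in> arcs Q \<Longrightarrow> v \<in> sp P (tail Q a) \<Longrightarrow> mp P a v \<in> sp P (head Q a)"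
    and "(\<lambda>i p. 0) \<in> sp P x"
proof -
  show "u \<in> sp P x \<Longrightarrow> v \<in> sp P x \<Longrightarrow> u + v \<in> sp P x"
    unfolding P_def sp_proj_sum by (metis add.right_neutral plus_fun_apply)
  show "v \<in> sp P x \<Longrightarrow> scl P c v \<in> sp P x"
    unfolding P_def sp_proj_sum by (auto simp: scl_proj_sum)
  show "(\<lambda>i p. 0) \<in> sp P x" by (simp add: P_def sp_proj_sum)
  assume a: "a \<in> arcs Q" and v: "v \<in> sp P (tail Q a)"
  show "mp P a v \<in> sp P (head Q a)"
    unfolding P_def sp_proj_sum
  proof (intro allI impI)
    fix i q assume "mp (proj_sum n b :: ('k::field, _, _, _) qrep) a v i q \<noteq> 0"
    then have q: "i < n" "q = butlast q @ [a]" "v i (butlast q) \<noteq> 0"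
      by (auto simp: mp_proj_sum append_butlast_last_id split: if_splits)
    then have "butlast q \<in> paths Q (b i) (tail Q a)"
      using v by (auto simp: P_def sp_proj_sum)
    then have "butlast q @ [a] \<in> paths Q (b i) (head Q a)"
      using a by (simp add: snoc_in_paths_iff)
    with q show "i < n \<and> q \<in> paths Q (b i) (head Q a)" by metis
  qed
qed

lemma proj_sum_space:
  fixes n b defines "P \<equiv> (proj_sum n b :: ('k::field, _, _, _) qrep)"
  shows "vector_space (scl P)" "module.subspace (scl P) (sp P x)"
proof -
  show v: "vector_space (scl P)"
    by unfold_locales (simp_all add: P_def fun_eq_iff scl_proj_sum algebra_simps)
  interpret vector_space "scl P" by (rule v)
  show "subspace (sp P x)"
    using proj_sum_closed[where n = n and b = b] by (intro subspaceI) (auto simp: P_def zero_fun_def)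
qed

text \<open>The Yoneda map: the trivial path of the \<open>i\<close>-th summand goes to
  \<open>xi i\<close>, hence a path \<open>p\<close> goes to the image of \<open>xi i\<close> under
  the composite of the arrows of \<open>p\<close>.\<close>

definition eval_rep ::
  "('k::field, 'a, 'b, 'v::ab_group_add) qrep \<Rightarrow> nat \<Rightarrow> (nat \<Rightarrow> 'a) \<Rightarrow> (nat \<Rightarrow> 'v) \<Rightarrow> 'a \<Rightarrow>
   (nat \<Rightarrow> 'b list \<Rightarrow> 'k) \<Rightarrow> 'v" where
  "eval_rep X n b xi y v = (\<Sum>i<n. \<Sum>p\<in>paths Q (b i) y. scl X (v i p) (fold (mp X) p (xi i)))"

lemma paths_last_arc:
  "x \<in> verts Q \<Longrightarrow>
   paths Q s x = (if s = x then {[]} else {}) \<union> (\<Union>a\<in>in_arcs Q x. (\<lambda>p. p @ [a]) ` paths Q s (tail Q a))"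
  (is "_ \<Longrightarrow> _ = ?R")
proof (intro set_eqI iffI)
  fix p assume "x \<in> verts Q" "p \<in> paths Q s x"
  then show "p \<in> ?R"
    by (cases p rule: rev_cases) (auto simp: Nil_in_paths_iff snoc_in_paths_iff)
next
  fix p assume "x \<in> verts Q" "p \<in> ?R"
  then show "p \<in> paths Q s x"
    by (auto simp: Nil_in_paths_iff snoc_in_paths_iff split: if_splits)
qed

text \<open>The sum over paths is split by the last arrow. Trivial paths contribute multiples of the
  generators placed at \<open>x\<close>; every other path ends in an incoming arrow, which linearity
  pulls out. This recursion over vertices yields both compatibility with the arrows and
  bijectivity.\<close>

lemma eval_rep_last_arc:
  assumes X: "lfd_rep Q X" "x \<in> verts Q" and xi: "\<And>i. i < n \<Longrightarrow> xi i \<in> sp X (b i)"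
  shows "eval_rep X n b xi x v = (\<Sum>i | i < n \<and> b i = x. scl X (v i []) (xi i)) +
    (\<Sum>a\<in>in_arcs Q x. mp X a (eval_rep X n b xi (tail Q a) (\<lambda>i p. v i (p @ [a]))))"
proof -
  interpret vector_space "scl X" using X(1) by (rule lfd_repD)
  let ?t = "\<lambda>i p. scl X (v i p) (fold (mp X) p (xi i))"
  have "(\<Sum>p\<in>paths Q (b i) x. ?t i p) =
     (if b i = x then scl X (v i []) (xi i) else 0) +
     (\<Sum>a\<in>in_arcs Q x. \<Sum>p\<in>paths Q (b i) (tail Q a). ?t i (p @ [a]))" for i
  proof -
    have "(\<Sum>p\<in>paths Q (b i) x. ?t i p) = (\<Sum>p\<in>(if b i = x then {[]} else {}). ?t i p) +
      (\<Sum>p\<in>(\<Union>a\<in>in_arcs Q x. (\<lambda>p. p @ [a]) ` paths Q (b i) (tail Q a)). ?t i p)"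
      unfolding paths_last_arc[OF X(2)]
      by (rule sum.union_disjoint) (auto simp: finite_in_arcs finite_paths)
    also have "(\<Sum>p\<in>(\<Union>a\<in>in_arcs Q x. (\<lambda>p. p @ [a]) ` paths Q (b i) (tail Q a)). ?t i p) =
      (\<Sum>a\<in>in_arcs Q x. \<Sum>p\<in>(\<lambda>p. p @ [a]) ` paths Q (b i) (tail Q a). ?t i p)"
      by (rule sum.UNION_disjoint) (auto simp: finite_in_arcs finite_paths)
    also have "\<dots> = (\<Sum>a\<in>in_arcs Q x. \<Sum>p\<in>paths Q (b i) (tail Q a). ?t i (p @ [a]))"
      by (rule sum.cong[OF refl], subst sum.reindex) (auto simp: inj_on_def)
    finally show ?thesis by simp
  qed
  then have "eval_rep X n b xi x v = (\<Sum>i<n. (if b i = x then scl X (v i []) (xi i) else 0)) +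
     (\<Sum>i<n. \<Sum>a\<in>in_arcs Q x. \<Sum>p\<in>paths Q (b i) (tail Q a). ?t i (p @ [a]))"
    by (simp add: eval_rep_def sum.distrib)
  also have "(\<Sum>i<n. (if b i = x then scl X (v i []) (xi i) else 0)) =
    (\<Sum>i | i < n \<and> b i = x. scl X (v i []) (xi i))"
    by (subst sum.inter_filter[symmetric]) (auto intro!: sum.cong)
  also have "(\<Sum>i<n. \<Sum>a\<in>in_arcs Q x. \<Sum>p\<in>paths Q (b i) (tail Q a). ?t i (p @ [a])) =
    (\<Sum>a\<in>in_arcs Q x. \<Sum>i<n. \<Sum>p\<in>paths Q (b i) (tail Q a). ?t i (p @ [a]))"
    by (rule sum.swap)
  also have "\<dots> =
    (\<Sum>a\<in>in_arcs Q x. mp X a (eval_rep X n b xi (tail Q a) (\<lambda>i p. v i (p @ [a]))))"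
  proof (rule sum.cong[OF refl])
    fix a assume a: "a \<in> in_arcs Q x"
    then have arc: "a \<in> arcs Q" and y: "tail Q a \<in> verts Q" by auto
    note lin = lfd_repD(4)[OF X(1) arc] and sub = lfd_repD(2)[OF X(1) y]
    have mem: "fold (mp X) p (xi i) \<in> sp X (tail Q a)"
      if "i < n" "p \<in> paths Q (b i) (tail Q a)" for i p
      using linear_betweenD(1)[OF fold_linear_between[OF X(1) that(2)] xi[OF that(1)]] .
    have "mp X a (\<Sum>i<n. \<Sum>p\<in>paths Q (b i) (tail Q a). scl X (v i (p @ [a])) (fold (mp X) p (xi i)))
      = (\<Sum>i<n. mp X a (\<Sum>p\<in>paths Q (b i) (tail Q a). scl X (v i (p @ [a])) (fold (mp X) p (xi i))))"
      using mem by (intro linear_between_sum[OF lin sub] subspace_sum[OF sub] subspace_scale[OF sub]) auto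
    also have "\<dots> = (\<Sum>i<n. \<Sum>p\<in>paths Q (b i) (tail Q a). ?t i (p @ [a]))"
    proof (rule sum.cong[OF refl])
      fix i assume "i \<in> {..<n}"
      then have mem': "fold (mp X) p (xi i) \<in> sp X (tail Q a)"
        if "p \<in> paths Q (b i) (tail Q a)" for p using mem that by blast
      have "mp X a (\<Sum>p\<in>paths Q (b i) (tail Q a). scl X (v i (p @ [a])) (fold (mp X) p (xi i))) =
        (\<Sum>p\<in>paths Q (b i) (tail Q a). mp X a (scl X (v i (p @ [a])) (fold (mp X) p (xi i))))"
        using mem' by (intro linear_between_sum[OF lin sub] subspace_scale[OF sub]) auto
      also have "\<dots> = (\<Sum>p\<in>paths Q (b i) (tail Q a). ?t i (p @ [a]))"
        using mem' by (intro sum.cong refl) (simp add: linear_betweenD(3)[OF lin])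
      finally show "mp X a (\<Sum>p\<in>paths Q (b i) (tail Q a).
          scl X (v i (p @ [a])) (fold (mp X) p (xi i))) =
        (\<Sum>p\<in>paths Q (b i) (tail Q a). ?t i (p @ [a]))" .
    qed
    finally show "(\<Sum>i<n. \<Sum>p\<in>paths Q (b i) (tail Q a). ?t i (p @ [a])) =
      mp X a (eval_rep X n b xi (tail Q a) (\<lambda>i p. v i (p @ [a])))"
      by (simp add: eval_rep_def)
  qed
  finally show ?thesis .
qed

lemma eval_rep_hom:
  fixes X :: "('k::field, 'a, 'b, 'v::ab_group_add) qrep"
  assumes X: "lfd_rep Q X" and xi: "\<And>i. i < n \<Longrightarrow> xi i \<in> sp X (b i)"
  shows "rep_hom Q (proj_sum n b) X (eval_rep X n b xi)"
proof -
  let ?P = "proj_sum n b :: ('k, _, _, _) qrep"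
  interpret vector_space "scl X" using X(1) by (rule lfd_repD)
  have zero: "eval_rep X n b xi y (\<lambda>i p. 0) = 0" for y by (simp add: eval_rep_def)
  show ?thesis
    unfolding rep_hom_def
  proof (intro conjI ballI)
    fix x assume x: "x \<in> verts Q"
    have "eval_rep X n b xi x v \<in> sp X x" for v
      unfolding eval_rep_def
      using linear_betweenD(1)[OF fold_linear_between[OF X] xi]
      by (intro lfd_rep_sum_closed[OF X x] lfd_rep_scale[OF X x]) blast
    then show "linear_between (scl ?P) (scl X) (sp ?P x) (sp X x)
      (eval_rep X n b xi x)"
      by (auto simp: linear_between_def eval_rep_def scl_proj_sum scale_left_distrib sum.distrib
        scale_sum_right)
  next
    fix a v assume a: "a \<in> arcs Q" and v: "v \<in> sp ?P (tail Q a)"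
    have vn: "v i p = 0" if "\<not> i < n" for i p using v that by (auto simp: sp_proj_sum)
    have h: "head Q a \<in> verts Q" using a by simp
    \<comment> \<open>After applying \<open>a\<close> all paths end in \<open>a\<close>, so of the
      recursion at the head only the summand with \<open>r = a\<close> remains.\<close>
    have "(\<lambda>i p. mp ?P a v i (p @ [r])) = (if r = a then v else (\<lambda>i p. 0))" for r
      using vn by (auto simp: mp_proj_sum fun_eq_iff)
    then have "mp X r (eval_rep X n b xi (tail Q r) (\<lambda>i p. mp ?P a v i (p @ [r]))) =
      (if r = a then mp X a (eval_rep X n b xi (tail Q a) v) else 0)"
      if "r \<in> in_arcs Q (head Q a)" for r
      using that by (simp add: zero mp_0[OF X])
    then show "eval_rep X n b xi (head Q a) (mp ?P a v) =
      mp X a (eval_rep X n b xi (tail Q a) v)"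
      using a finite_in_arcs by (subst eval_rep_last_arc[OF X h xi]) (simp_all add: mp_proj_sum)
  qed
qed

text \<open>Naturality of the Yoneda map. It reduces lifting a map on a sum of
  \<open>P\<^sub>a\<close> along an epimorphism to lifting the finitely many generators.\<close>

lemma hom_eval_rep:
  assumes X: "lfd_rep Q X" and xi: "\<And>i. i < n \<Longrightarrow> xi i \<in> sp X (b i)"
    and g: "rep_hom Q X Y g" and y: "y \<in> verts Q"
  shows "g y (eval_rep X n b xi y v) = eval_rep Y n b (\<lambda>i. g (b i) (xi i)) y v"
proof -
  interpret vector_space "scl X" using X(1) by (rule lfd_repD)
  note lin = rep_homD(1)[OF g y] and sub = lfd_repD(2)[OF X y]
  have mem: "fold (mp X) p (xi i) \<in> sp X y" if "i < n" "p \<in> paths Q (b i) y" for i p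
    using linear_betweenD(1)[OF fold_linear_between[OF X(1) that(2)] xi[OF that(1)]] .
  have "g y (eval_rep X n b xi y v) =
    (\<Sum>i<n. g y (\<Sum>p\<in>paths Q (b i) y. scl X (v i p) (fold (mp X) p (xi i))))"
    unfolding eval_rep_def
    using mem by (intro linear_between_sum[OF lin sub] subspace_sum[OF sub] subspace_scale[OF sub]) auto
  also have "\<dots> = eval_rep Y n b (\<lambda>i. g (b i) (xi i)) y v"
    unfolding eval_rep_def
  proof (intro sum.cong refl)
    fix i assume "i \<in> {..<n}"
    then have i: "i < n" by simp
    have "g y (\<Sum>p\<in>paths Q (b i) y. scl X (v i p) (fold (mp X) p (xi i))) =
      (\<Sum>p\<in>paths Q (b i) y. g y (scl X (v i p) (fold (mp X) p (xi i))))"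
      using mem[OF i] by (intro linear_between_sum[OF lin sub] subspace_scale[OF sub]) auto
    also have "\<dots> = (\<Sum>p\<in>paths Q (b i) y. scl Y (v i p) (fold (mp Y) p (g (b i) (xi i))))"
      using mem[OF i] by (intro sum.cong refl)
        (simp add: linear_betweenD(3)[OF lin] rep_hom_fold[OF X g _ xi[OF i]])
    finally show "g y (\<Sum>p\<in>paths Q (b i) y. scl X (v i p) (fold (mp X) p (xi i))) =
      (\<Sum>p\<in>paths Q (b i) y. scl Y (v i p) (fold (mp Y) p (g (b i) (xi i))))" .
  qed
  finally show ?thesis .
qed

end

section \<open>Recognising finite sums of the \<open>P\<^sub>a\<close>\<close>

definition arc_sums ::
  "('a, 'b) pre_digraph \<Rightarrow> ('k::field, 'a, 'b, 'v::ab_group_add) qrep \<Rightarrow> 'b set \<Rightarrow> 'v set" where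
  "arc_sums Q M S = {arc_sum M S w | w. \<forall>a\<in>S. w a \<in> sp M (tail Q a)}"

lemma subspace_arc_sums:
  assumes "vector_space (scl M)"
    and sub: "\<And>a. a \<in> S \<Longrightarrow> module.subspace (scl M) (sp M (tail Q a))"
    and lin: "\<And>a. a \<in> S \<Longrightarrow> linear_between (scl M) (scl M) (sp M (tail Q a)) V (mp M a)"
    and V: "module.subspace (scl M) V"
  shows "module.subspace (scl M) (arc_sums Q M S)" "arc_sums Q M S \<subseteq> V"
proof -
  interpret vector_space "scl M" by fact
  show "arc_sums Q M S \<subseteq> V"
    using linear_betweenD(1)[OF lin] by (auto simp: arc_sums_def intro!: subspace_sum[OF V])
  show "subspace (arc_sums Q M S)"
  proof (rule subspaceI)
    show "0 \<in> arc_sums Q M S"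
      using linear_between_zero[OF lin subspace_0[OF sub]] subspace_0[OF sub]
      by (auto simp: arc_sums_def intro!: exI[of _ "\<lambda>_. 0"])
  next
    fix u v assume "u \<in> arc_sums Q M S" "v \<in> arc_sums Q M S"
    then obtain w z where *: "u = arc_sum M S w" "v = arc_sum M S z"
      "\<forall>a\<in>S. w a \<in> sp M (tail Q a)" "\<forall>a\<in>S. z a \<in> sp M (tail Q a)"
      by (auto simp: arc_sums_def)
    then have "u + v = (\<Sum>a\<in>S. mp M a (w a + z a))"
      by (auto simp: sum.distrib[symmetric] linear_betweenD(2)[OF lin] intro!: sum.cong)
    then show "u + v \<in> arc_sums Q M S"
      using * subspace_add[OF sub] by (auto simp: arc_sums_def intro!: exI[of _ "\<lambda>a. w a + z a"])
  next
    fix c v assume "v \<in> arc_sums Q M S"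
    then obtain w where *: "v = arc_sum M S w" "\<forall>a\<in>S. w a \<in> sp M (tail Q a)"
      by (auto simp: arc_sums_def)
    then have "scl M c v = (\<Sum>a\<in>S. mp M a (scl M c (w a)))"
      by (auto simp: scale_sum_right linear_betweenD(3)[OF lin] intro!: sum.cong)
    then show "scl M c v \<in> arc_sums Q M S"
      using * subspace_scale[OF sub] by (auto simp: arc_sums_def intro!: exI[of _ "\<lambda>a. scl M c (w a)"])
  qed
qed

context slf_quiver
begin

lemma arc_sums_subspace:
  assumes M: "lfd_rep Q M" and x: "x \<in> verts Q"
  shows "module.subspace (scl M) (arc_sums Q M (in_arcs Q x))" "arc_sums Q M (in_arcs Q x) \<subseteq> sp M x"
proof -
  have "linear_between (scl M) (scl M) (sp M (tail Q a)) (sp M x) (mp M a)" if "a \<in> in_arcs Q x" for a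
    using lfd_repD(4)[OF M, of a] that by auto
  then show "module.subspace (scl M) (arc_sums Q M (in_arcs Q x))" "arc_sums Q M (in_arcs Q x) \<subseteq> sp M x"
    using lfd_repD(1,2)[OF M] x by (intro subspace_arc_sums; auto)+
qed

lemma sum_injective_mp:
  assumes M: "lfd_rep Q M" and inj: "sum_injective Q M (in_arcs Q x)"
    and a: "a \<in> in_arcs Q x" and v: "v \<in> sp M (tail Q a)" "v \<noteq> 0"
  shows "mp M a v \<noteq> 0"
proof
  assume 0: "mp M a v = 0"
  let ?w = "\<lambda>r. if r = a then v else 0"
  have "\<forall>r\<in>in_arcs Q x. ?w r \<in> sp M (tail Q r)"
    using v lfd_rep_zero[OF M] by auto
  moreover have "(\<Sum>r\<in>in_arcs Q x. mp M r (?w r)) = 0"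
    using 0 mp_0[OF M] by (intro sum.neutral) auto
  ultimately have "?w a = 0" using a by (intro sum_injectiveD[OF inj, of ?w]) auto
  then show False using v by simp
qed

lemma proj_sum_eq_0I:
  assumes v: "v \<in> sp (proj_sum n b) x" and x: "x \<in> verts Q"
    and Nil: "\<And>i. i < n \<Longrightarrow> b i = x \<Longrightarrow> v i [] = 0"
    and snoc: "\<And>a. a \<in> in_arcs Q x \<Longrightarrow> (\<lambda>i p. v i (p @ [a])) = (\<lambda>i p. 0)"
  shows "v = (\<lambda>i p. 0)"
proof (intro ext, rule ccontr)
  fix i p assume nz: "v i p \<noteq> 0"
  then have p: "i < n" "p \<in> paths Q (b i) x" using v by (auto simp: sp_proj_sum)
  then show False
    using nz Nil[OF p(1)] snoc
    by (cases p rule: rev_cases) (auto simp: Nil_in_paths_iff snoc_in_paths_iff fun_eq_iff)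
qed

lemma proj_sum_snoc:
  assumes v: "v \<in> sp (proj_sum n b) x" and "a \<in> in_arcs Q x"
  shows "(\<lambda>i p. v i (p @ [a])) \<in> sp (proj_sum n b) (tail Q a)"
  unfolding sp_proj_sum
proof (intro allI impI)
  fix i p assume "v i (p @ [a]) \<noteq> 0"
  then have "i < n \<and> p @ [a] \<in> paths Q (b i) x" using v by (simp add: sp_proj_sum)
  then show "i < n \<and> p \<in> paths Q (b i) (tail Q a)" by (simp add: snoc_in_paths_iff)
qed

text \<open>Well-founded induction over the support, from tails to heads. The last-arrow recursion
  splits the value at \<open>x\<close> into a part from the incoming arrows and a combination of the
  generators at \<open>x\<close>. By \<open>gen\<close> and \<open>indep\<close> the two parts can
  be treated separately, and the first reduces to the tails by \<open>inj\<close> and the induction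
  hypothesis.\<close>

lemma proj_sum_bijective:
  fixes R :: "('k::field, 'a, 'b, 'v::ab_group_add) qrep"
  assumes R: "lfd_rep Q R"
    and inj: "\<And>x. x \<in> verts Q \<Longrightarrow> sum_injective Q R (in_arcs Q x)"
    and wf: "wf (pred_rel Q (\<lambda>x. sp R x \<noteq> {0}))"
    and xi: "\<And>i. i < n \<Longrightarrow> b i \<in> verts Q \<and> xi i \<in> sp R (b i) \<and> xi i \<noteq> 0"
    and gen: "\<And>x v. x \<in> verts Q \<Longrightarrow> v \<in> sp R x \<Longrightarrow> \<exists>u\<in>arc_sums Q R (in_arcs Q x). \<exists>c.
      v = u + (\<Sum>i | i < n \<and> b i = x. scl R (c i) (xi i))"
    and indep: "\<And>x u c. x \<in> verts Q \<Longrightarrow> u \<in> arc_sums Q R (in_arcs Q x) \<Longrightarrow>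
      u + (\<Sum>i | i < n \<and> b i = x. scl R (c i) (xi i)) = 0 \<Longrightarrow> u = 0 \<and> (\<forall>i<n. b i = x \<longrightarrow> c i = 0)"
    and x: "x \<in> verts Q"
  shows "bij_betw (eval_rep R n b xi x) (sp (proj_sum n b) x) (sp R x)"
proof -
  let ?P = "proj_sum n b :: ('k, _, _, _) qrep"
  let ?e = "eval_rep R n b xi"
  have hom: "rep_hom Q ?P R ?e" using xi by (intro eval_rep_hom R) auto
  have zero: "?e y (\<lambda>i p. 0) = 0" for y
  proof -
    interpret vector_space "scl R" using R by (rule lfd_repD)
    show ?thesis by (simp add: eval_rep_def)
  qed
  have mem: "?e y v \<in> sp R y" if "y \<in> verts Q" "v \<in> sp ?P y" for y v
    using linear_betweenD(1)[OF rep_homD(1)[OF hom that(1)] that(2)] .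
  \<comment> \<open>The support is closed under successors because every arrow is injective, so no
    path from a generator leaves it. Hence the sum of the \<open>P\<^sub>a\<close> also vanishes
    wherever \<open>R\<close> does.\<close>
  have supp: "sp R y \<noteq> {0}" if p: "p \<in> paths Q (b i) y" "i < n" for p i y
  proof -
    have "y \<in> {z. sp R z \<noteq> {0}}"
    proof (rule closed_under_paths[OF p(1)])
      show "b i \<in> {z. sp R z \<noteq> {0}}" using xi[OF p(2)] by auto
    next
      fix a assume a: "a \<in> arcs Q" and "tail Q a \<in> {z. sp R z \<noteq> {0}}"
      then obtain v where v: "v \<in> sp R (tail Q a)" "v \<noteq> 0"
        using lfd_rep_nonzero[OF R, of "tail Q a"] by auto
      then have "mp R a v \<noteq> 0" using a by (intro sum_injective_mp[OF R inj]) auto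
      moreover have "mp R a v \<in> sp R (head Q a)"
        using lfd_rep_mp[OF R a v(1)] .
      ultimately show "head Q a \<in> {z. sp R z \<noteq> {0}}" by auto
    qed
    then show ?thesis by simp
  qed
  have P0: "(\<lambda>i p. 0) \<in> sp ?P y" for y by (rule proj_sum_closed(4))
  have Pzero: "v = (\<lambda>i p. 0)" if "v \<in> sp ?P y" "sp R y = {0}" for v y
    unfolding fun_eq_iff
  proof (intro allI, rule ccontr)
    fix i p assume "v i p \<noteq> 0"
    then show False using supp[of p i y] that by (simp add: sp_proj_sum)
  qed
  have eval: "?e y v = (\<Sum>a\<in>in_arcs Q y. mp R a (?e (tail Q a) (\<lambda>i p. v i (p @ [a]))))
      + (\<Sum>i | i < n \<and> b i = y. scl R (v i []) (xi i))" if "y \<in> verts Q" for y v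
    using xi by (subst eval_rep_last_arc[OF R that]) auto
  have sums: "(\<Sum>a\<in>in_arcs Q y. mp R a (?e (tail Q a) (\<lambda>i p. v i (p @ [a])))) \<in> arc_sums Q R (in_arcs Q y)"
    if "v \<in> sp ?P y" for y v
    unfolding arc_sums_def
    by (intro CollectI exI[of _ "\<lambda>a. ?e (tail Q a) (\<lambda>i p. v i (p @ [a]))"] conjI refl ballI
      mem proj_sum_snoc[OF that]) auto
  have "x \<in> verts Q \<longrightarrow> (\<forall>v\<in>sp ?P x. ?e x v = 0 \<longrightarrow> v = (\<lambda>i p. 0)) \<and> (\<forall>u\<in>sp R x. \<exists>v\<in>sp ?P x. ?e x v = u)"
    using wf
  proof (induction x rule: wf_induct_rule)
    case (less x)
    \<comment> \<open>The order relates only vertices of the support; at a tail outside it both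
      spaces are zero.\<close>
    have IH: "(\<forall>v\<in>sp ?P (tail Q a). ?e (tail Q a) v = 0 \<longrightarrow> v = (\<lambda>i p. 0)) \<and>
        (\<forall>u\<in>sp R (tail Q a). \<exists>v\<in>sp ?P (tail Q a). ?e (tail Q a) v = u)"
      if a: "a \<in> in_arcs Q x" and "sp R x \<noteq> {0}" for a
    proof (cases "sp R (tail Q a) = {0}")
      case True
      then show ?thesis
        using Pzero[OF _ True] zero P0 by (intro conjI ballI impI bexI[of _ "\<lambda>i p. 0"]) auto
    next
      case False
      then show ?thesis using less[of "tail Q a"] that by auto
    qed
    show ?case
    proof (intro impI conjI ballI)
      fix v assume x: "x \<in> verts Q" and v: "v \<in> sp ?P x" and 0: "?e x v = 0"
      show "v = (\<lambda>i p. 0)"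
      proof (cases "sp R x = {0}")
        case True
        show ?thesis by (rule Pzero[OF v True])
      next
        case False
        have "(\<Sum>a\<in>in_arcs Q x. mp R a (?e (tail Q a) (\<lambda>i p. v i (p @ [a])))) = 0 \<and>
            (\<forall>i<n. b i = x \<longrightarrow> v i [] = 0)"
          by (rule indep[OF x sums[OF v]]) (use eval[OF x, of v] 0 in simp)
        moreover have "?e (tail Q a) (\<lambda>i p. v i (p @ [a])) = 0" if "a \<in> in_arcs Q x" for a
          by (rule sum_injectiveD[OF inj[OF x], of "\<lambda>a. ?e (tail Q a) (\<lambda>i p. v i (p @ [a]))" a])
            (use calculation that mem proj_sum_snoc[OF v] in auto)
        ultimately show ?thesis
          using IH[OF _ False] proj_sum_snoc[OF v] by (intro proj_sum_eq_0I[OF v x]) simp_all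
      qed
    next
      fix u assume x: "x \<in> verts Q" and u: "u \<in> sp R x"
      show "\<exists>v\<in>sp ?P x. ?e x v = u"
      proof (cases "sp R x = {0}")
        case True
        then show ?thesis using u zero P0 by (intro bexI[of _ "\<lambda>i p. 0"]) auto
      next
        case False
        obtain w c where w: "\<forall>a\<in>in_arcs Q x. w a \<in> sp R (tail Q a)"
          and u': "u = (arc_sum R (in_arcs Q x) w) + (\<Sum>i | i < n \<and> b i = x. scl R (c i) (xi i))"
          using gen[OF x u] by (auto simp: arc_sums_def)
        have "\<forall>a\<in>in_arcs Q x. \<exists>g. g \<in> sp ?P (tail Q a) \<and> ?e (tail Q a) g = w a"
          using IH[OF _ False] w by (simp add: Bex_def)
        then obtain g where g: "\<And>a. a \<in> in_arcs Q x \<Longrightarrow> g a \<in> sp ?P (tail Q a) \<and> ?e (tail Q a) (g a) = w a"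
          by metis
        \<comment> \<open>The preimage is assembled by last arrows: \<open>c\<close> on the trivial
          paths, the chosen preimage \<open>g a\<close> on the paths ending in
          \<open>a\<close>.\<close>
        define v where "v i q = (if q = [] then if i < n \<and> b i = x then c i else 0
          else if last q \<in> in_arcs Q x then g (last q) i (butlast q) else 0)" for i q
        have "v \<in> sp ?P x"
          unfolding sp_proj_sum
        proof (intro allI impI)
          fix i q assume "v i q \<noteq> 0"
          then show "i < n \<and> q \<in> paths Q (b i) x"
            using g x by (cases q rule: rev_cases)
              (auto simp: v_def Nil_in_paths_iff snoc_in_paths_iff sp_proj_sum split: if_splits)
        qed
        moreover have "(\<lambda>i p. v i (p @ [a])) = g a" if "a \<in> in_arcs Q x" for a
          using that by (simp add: v_def)
        then have "?e x v = u"
          unfolding eval[OF x] u'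
          by (intro arg_cong2[where f = "(+)"] sum.cong refl) (use g in \<open>auto simp: v_def\<close>)
        ultimately show ?thesis by blast
      qed
    qed
  qed
  then have ker: "\<forall>v\<in>sp ?P x. ?e x v = 0 \<longrightarrow> v = (\<lambda>i p. 0)" and sur: "\<forall>u\<in>sp R x. \<exists>v\<in>sp ?P x. ?e x v = u"
    using x by auto
  have "inj_on (?e x) (sp ?P x)"
    using ker by (intro vector_space.linear_between_inj_on[OF proj_sum_space(1) rep_homD(1)[OF hom x] proj_sum_space(2)])
      (simp add: zero_fun_def)
  moreover have "?e x ` sp ?P x = sp R x" using sur mem[OF x] by fastforce
  ultimately show ?thesis by (simp add: bij_betw_def)
qed

text \<open>At every vertex a basis of a complement to the images of the incoming arrows is chosen.
  It is empty where the incoming map is surjective, so only finitely many generators arise in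
  total.\<close>

lemma proj_sum_iso:
  fixes R :: "('k::field, 'a, 'b, 'v::ab_group_add) qrep"
  assumes R: "lfd_rep Q R"
    and inj: "\<And>x. x \<in> verts Q \<Longrightarrow> sum_injective Q R (in_arcs Q x)"
    and fin: "finite {x \<in> verts Q. \<not> sum_surjective Q R (in_arcs Q x) x}"
    and wf: "wf (pred_rel Q (\<lambda>x. sp R x \<noteq> {0}))"
  obtains n :: nat and b :: "nat \<Rightarrow> 'a" and xi :: "nat \<Rightarrow> 'v"
  where "\<And>i. i < n \<Longrightarrow> b i \<in> verts Q" "\<And>i. i < n \<Longrightarrow> xi i \<in> sp R (b i)"
    "\<And>x. x \<in> verts Q \<Longrightarrow> bij_betw (eval_rep R n b xi x) (sp (proj_sum n b) x) (sp R x)"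
proof -
  interpret vector_space "scl R" using R by (rule lfd_repD)
  let ?U = "\<lambda>x. arc_sums Q R (in_arcs Q x)"
  define compl where "compl x D \<longleftrightarrow> finite D \<and> D \<subseteq> sp R x \<and>
      (\<forall>v\<in>sp R x. \<exists>u\<in>?U x. \<exists>c. v = u + (\<Sum>d\<in>D. scl R (c d) d)) \<and>
      (\<forall>u\<in>?U x. \<forall>c. u + (\<Sum>d\<in>D. scl R (c d) d) = 0 \<longrightarrow> u = 0 \<and> (\<forall>d\<in>D. c d = 0))" for x D
  have "\<exists>D. compl x D"
    if x: "x \<in> verts Q" for x
  proof -
    obtain S where S: "finite S" "span S = sp R x" using lfd_repD(3)[OF R x] by blast
    show ?thesis
    proof (rule complement_basis[OF arc_sums_subspace[OF R x] S])
      fix E assume "finite E" "E \<subseteq> sp R x"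
      "\<And>v. v \<in> sp R x \<Longrightarrow> \<exists>u\<in>?U x. \<exists>c. v = u + (\<Sum>d\<in>E. scl R (c d) d)"
      "\<And>u c. u \<in> ?U x \<Longrightarrow> u + (\<Sum>d\<in>E. scl R (c d) d) = 0 \<Longrightarrow> u = 0 \<and> (\<forall>d\<in>E. c d = 0)"
      then show ?thesis by (intro exI[of _ E]) (simp add: compl_def)
    qed
  qed
  then obtain D where compl: "\<And>x. x \<in> verts Q \<Longrightarrow> compl x (D x)" by metis
  have D: "finite (D x)" "D x \<subseteq> sp R x"
    "\<And>v. v \<in> sp R x \<Longrightarrow> \<exists>u\<in>?U x. \<exists>c. v = u + (\<Sum>d\<in>D x. scl R (c d) d)"
    "\<And>u c. u \<in> ?U x \<Longrightarrow> u + (\<Sum>d\<in>D x. scl R (c d) d) = 0 \<Longrightarrow> u = 0 \<and> (\<forall>d\<in>D x. c d = 0)"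
    if "x \<in> verts Q" for x
    using compl[OF that] unfolding compl_def by simp_all
  \<comment> \<open>A basis element \<open>d\<close> in the subspace would give the forbidden
    relation \<open>- d + d = 0\<close>.\<close>
  have notin: "d \<notin> ?U x" if x: "x \<in> verts Q" and d: "d \<in> D x" for x d
  proof
    assume "d \<in> ?U x"
    then have "- d \<in> ?U x" using subspace_neg arc_sums_subspace(1)[OF R x] by blast
    moreover have "(\<Sum>e\<in>D x. scl R (if e = d then 1 else 0) e) = d"
      using D(1)[OF x] d by (subst sum.cong[OF refl, of _ _ "\<lambda>e. if e = d then e else 0"]) auto
    ultimately show False using D(4)[OF x, of "- d" "\<lambda>e. if e = d then 1 else 0"] d by auto
  qed
  have good: "D x = {}" if "x \<in> verts Q" "sum_surjective Q R (in_arcs Q x) x" for x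
    using that notin D(2) by (fastforce simp: sum_surjective_def arc_sums_def)
  \<comment> \<open>Pairs of a vertex and a basis element there; numbering them turns the
    complements into the data \<open>b\<close> and \<open>xi\<close>.\<close>
  define Z where "Z = Sigma {x \<in> verts Q. \<not> sum_surjective Q R (in_arcs Q x) x} D"
  have "finite Z" unfolding Z_def using fin D(1) by (intro finite_SigmaI) auto
  then obtain e where e: "bij_betw e {0..<card Z} Z" using ex_bij_betw_nat_finite by blast
  let ?n = "card Z" and ?b = "\<lambda>i. fst (e i)" and ?xi = "\<lambda>i. snd (e i)"
  have eZ: "e i \<in> Z" if "i < ?n" for i using bij_betwE[OF e] that by auto
  have bij: "bij_betw ?xi {i. i < ?n \<and> ?b i = x} (D x)" if x: "x \<in> verts Q" for x
    unfolding bij_betw_def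
  proof
    show "inj_on ?xi {i. i < ?n \<and> ?b i = x}"
      using bij_betw_imp_inj_on[OF e] by (auto simp: inj_on_def prod_eq_iff)
    show "?xi ` {i. i < ?n \<and> ?b i = x} = D x"
    proof (intro set_eqI iffI)
      fix d assume "d \<in> ?xi ` {i. i < ?n \<and> ?b i = x}"
      then obtain i where "i < ?n" "?b i = x" "d = ?xi i" by auto
      then show "d \<in> D x" using eZ[of i] by (cases "e i") (simp add: Z_def)
    next
      fix d assume "d \<in> D x"
      then have "(x, d) \<in> Z" using good[OF x] x by (auto simp: Z_def)
      then obtain i where "i < ?n" "e i = (x, d)" using e by (auto simp: bij_betw_def) (metis atLeastLessThan_iff imageE)
      then show "d \<in> ?xi ` {i. i < ?n \<and> ?b i = x}" by force
    qed
  qed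
  have reindex: "(\<Sum>i | i < ?n \<and> ?b i = x. scl R (c (?xi i)) (?xi i)) = (\<Sum>d\<in>D x. scl R (c d) d)"
    if "x \<in> verts Q" for c x
    using sum.reindex_bij_betw[OF bij[OF that], of "\<lambda>d. scl R (c d) d"] .
  show ?thesis
  proof (rule that[of ?n ?b ?xi])
    fix i assume "i < ?n"
    then show "?b i \<in> verts Q" "?xi i \<in> sp R (?b i)" using eZ D(2) by (fastforce simp: Z_def)+
  next
    fix x assume x: "x \<in> verts Q"
    show "bij_betw (eval_rep R ?n ?b ?xi x) (sp (proj_sum ?n ?b) x) (sp R x)"
    proof (rule proj_sum_bijective[OF R inj wf _ _ _ x])
      fix i assume i: "i < ?n"
      have "?b i \<in> verts Q" "?xi i \<in> D (?b i)" using eZ[OF i] by (cases "e i"; simp add: Z_def)+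
      then show "?b i \<in> verts Q \<and> ?xi i \<in> sp R (?b i) \<and> ?xi i \<noteq> 0"
        using D(2)[of "?b i"] notin[of "?b i" "?xi i"]
          subspace_0[OF arc_sums_subspace(1)[OF R, of "?b i"]] by auto
    next
      fix y v assume y: "y \<in> verts Q" "v \<in> sp R y"
      obtain u c where u: "u \<in> ?U y" "v = u + (\<Sum>d\<in>D y. scl R (c d) d)"
        using D(3)[OF y] by blast
      then have "v = u + (\<Sum>i | i < ?n \<and> ?b i = y. scl R (c (?xi i)) (?xi i))"
        using reindex[OF y(1)] by simp
      then show "\<exists>u\<in>?U y. \<exists>c. v = u + (\<Sum>i | i < ?n \<and> ?b i = y. scl R (c i) (?xi i))"
        using u(1) by (intro bexI[of _ u] exI[of _ "\<lambda>i. c (?xi i)"])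
    next
      fix y u c assume y: "y \<in> verts Q" "u \<in> ?U y"
        and 0: "u + (\<Sum>i | i < ?n \<and> ?b i = y. scl R (c i) (?xi i)) = 0"
      \<comment> \<open>The coefficients are indexed by numbers here but by basis elements in
        \<open>D\<close>; the numbering is a bijection onto \<open>D y\<close> at each vertex
        \<open>y\<close>.\<close>
      let ?inv = "inv_into {i. i < ?n \<and> ?b i = y} ?xi"
      have inv: "?inv (?xi i) = i" if "i < ?n" "?b i = y" for i
        using inv_into_f_f[OF bij_betw_imp_inj_on[OF bij[OF y(1)]], of i] that by simp
      have "(\<Sum>i | i < ?n \<and> ?b i = y. scl R (c i) (?xi i)) = (\<Sum>d\<in>D y. scl R (c (?inv d)) d)"
        unfolding reindex[OF y(1), symmetric] by (intro sum.cong) (auto simp: inv)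
      then have "u = 0 \<and> (\<forall>d\<in>D y. c (?inv d) = 0)" by (intro D(4)[OF y]) (use 0 in simp)
      then show "u = 0 \<and> (\<forall>i<?n. ?b i = y \<longrightarrow> c i = 0)"
        using bij_betwE[OF bij[OF y(1)]] inv by (metis (mono_tags, lifting) mem_Collect_eq)
    qed
  qed
qed

text \<open>Being a finite sum of \<open>P\<^sub>a\<close>, \<open>R\<close> is presented with zero
  kernel, and a map from it lifts by choosing preimages of the images of the generators.\<close>

lemma projective_plusI:
  fixes R :: "('k::field, 'a, 'b, 'v::ab_group_add) qrep"
  assumes R: "lfd_rep Q R"
    and inj: "\<And>x. x \<in> verts Q \<Longrightarrow> sum_injective Q R (in_arcs Q x)"
    and fin: "finite {x \<in> verts Q. \<not> sum_surjective Q R (in_arcs Q x) x}"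
    and wf: "wf (pred_rel Q (\<lambda>x. sp R x \<noteq> {0}))"
  shows "projective_plus Q R"
proof -
  obtain n b xi where b: "\<And>i. i < n \<Longrightarrow> b i \<in> verts Q" and xi: "\<And>i. i < n \<Longrightarrow> xi i \<in> sp R (b i)"
    and bij: "\<And>x. x \<in> verts Q \<Longrightarrow> bij_betw (eval_rep R n b xi x) (sp (proj_sum n b) x) (sp R x)"
    by (rule proj_sum_iso[OF assms]) auto
  let ?P = "proj_sum n b :: ('k, _, _, _) qrep" and ?e = "eval_rep R n b xi"
  let ?Z = "proj_sum 0 b :: ('k, _, _, _) qrep"
  have hom: "rep_hom Q ?P R ?e" using R xi by (rule eval_rep_hom)
  have Z: "sp ?Z x = {0}" for x by (auto simp: sp_proj_sum zero_fun_def fun_eq_iff)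
  have P0: "0 \<in> sp ?P x" for x by (simp add: sp_proj_sum)
  have e0: "?e x 0 = 0" if "x \<in> verts Q" for x
    using linear_between_zero[OF rep_homD(1)[OF hom that] P0] .
  have "short_exact Q ?Z ?P R (\<lambda>x v. 0) ?e"
    unfolding short_exact_def rep_mono_def rep_epi_def
  proof (intro conjI ballI)
    have P00: "mp ?P a 0 = 0" "scl ?P c 0 = 0" for a c
      by (auto simp: mp_proj_sum scl_proj_sum fun_eq_iff)
    show "rep_hom Q ?Z ?P (\<lambda>x v. 0)"
      unfolding rep_hom_def linear_between_def Z using P0 P00 by auto
    show "rep_hom Q ?P R ?e" by (fact hom)
    fix x assume x: "x \<in> verts Q"
    show "inj_on (\<lambda>v. 0) (sp ?Z x)" by (simp add: Z)
    show "?e x ` sp ?P x = sp R x" using bij[OF x] by (simp add: bij_betw_def)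
    show "(\<lambda>v. 0) ` sp ?Z x = {v \<in> sp ?P x. ?e x v = 0}"
      using bij[OF x] P0[of x] e0[OF x] by (auto simp: Z bij_betw_def inj_on_def)
  qed
  then have plus: "rep_plus Q R"
    unfolding rep_plus_def using R b
    by (intro conjI exI[of _ "0::nat"] exI[of _ n] exI[of _ b] exI[of _ "\<lambda>x v. 0"] exI[of _ ?e]) auto
  show ?thesis
    unfolding projective_plus_def
  proof (intro conjI plus allI impI)
    fix X Y :: "('k, 'a, 'b) std_rep" and g f
    assume X: "rep_plus Q X" and Y: "rep_plus Q Y" and g: "rep_epi Q X Y g" and f: "rep_hom Q R Y f"
    have X': "lfd_rep Q X" and Y': "lfd_rep Q Y" using X Y by (auto simp: rep_plus_def)
    have g': "rep_hom Q X Y g" using g by (simp add: rep_epi_def)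
    have "\<exists>z\<in>sp X (b i). g (b i) z = f (b i) (xi i)" if "i < n" for i
    proof -
      have "f (b i) (xi i) \<in> sp Y (b i)"
        using linear_betweenD(1)[OF rep_homD(1)[OF f b[OF that]] xi[OF that]] .
      then show ?thesis using g b[OF that] by (force simp: rep_epi_def)
    qed
    then obtain z where z: "\<And>i. i < n \<Longrightarrow> z i \<in> sp X (b i)" "\<And>i. i < n \<Longrightarrow> g (b i) (z i) = f (b i) (xi i)"
      by metis
    let ?h = "\<lambda>x v. eval_rep X n b z x (inv_into (sp ?P x) (?e x) v)"
    have inv: "rep_hom Q R ?P (\<lambda>x. inv_into (sp ?P x) (?e x))"
      using bij proj_sum_closed by (intro rep_hom_inv_into[OF wf_digraph_axioms hom]) auto
    have "rep_hom Q R X ?h"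
      using rep_hom_comp[OF wf_digraph_axioms inv eval_rep_hom[OF X' z(1)]] .
    moreover have "g x (?h x v) = f x v" if x: "x \<in> verts Q" and v: "v \<in> sp R x" for x v
    proof -
      have "g x (?h x v) = eval_rep Y n b (\<lambda>i. g (b i) (z i)) x (inv_into (sp ?P x) (?e x) v)"
        by (rule hom_eval_rep[OF X' z(1) g' x])
      also have "\<dots> = eval_rep Y n b (\<lambda>i. f (b i) (xi i)) x (inv_into (sp ?P x) (?e x) v)"
        using z(2) by (simp add: eval_rep_def)
      also have "\<dots> = f x (?e x (inv_into (sp ?P x) (?e x) v))"
        using hom_eval_rep[OF R xi f x] by simp
      also have "?e x (inv_into (sp ?P x) (?e x) v) = v"
        using bij[OF x] v by (metis bij_betw_def f_inv_into_f)
      finally show ?thesis .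
    qed
    ultimately show "\<exists>h. rep_hom Q R X h \<and> (\<forall>x\<in>verts Q. \<forall>v\<in>sp R x. g x (h x v) = f x v)"
      by blast
  qed
qed

text \<open>Needed for (4), where the summand in question turns out to be zero.\<close>

lemma zero_rep_projective:
  assumes R: "lfd_rep Q R" and z: "zero_rep Q R"
  shows "projective_plus Q R"
proof (rule projective_plusI[OF R])
  have z': "sp R x = {0}" if "x \<in> verts Q" for x using z that by (simp add: zero_rep_def)
  show "sum_injective Q R (in_arcs Q x)" for x
    using z' by (auto simp: sum_injective_def)
  have "sum_surjective Q R (in_arcs Q x) x" if "x \<in> verts Q" for x
    unfolding sum_surjective_def
    using z' that mp_0[OF R] by (auto intro!: exI[of _ "\<lambda>_. 0"])
  then have "{x \<in> verts Q. \<not> sum_surjective Q R (in_arcs Q x) x} = {}" by blast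
  then show "finite {x \<in> verts Q. \<not> sum_surjective Q R (in_arcs Q x) x}" by (simp only: finite.emptyI)
  have e: "pred_rel Q (\<lambda>x. sp R x \<noteq> {0}) = {}"
    using z' by auto
  show "wf (pred_rel Q (\<lambda>x. sp R x \<noteq> {0}))"
    unfolding e by (rule wf_subset[OF wf_measure[of "\<lambda>_. 0"]]) simp
qed

end

section \<open>Maps into sums of the representations \<open>I\<^sub>a\<close>\<close>

lemma linear_between_image_subspace:
  assumes "vector_space s" "vector_space t" "linear_between s t V W f" "module.subspace s V"
  shows "module.subspace t (f ` V)"
proof -
  interpret S: vector_space s by fact
  interpret T: vector_space t by fact
  note lin = linear_betweenD[OF assms(3)]
  show ?thesis
  proof (rule T.subspaceI)
    show "0 \<in> f ` V"
      using linear_between_zero[OF assms(3)] S.subspace_0[OF assms(4)] by (metis imageI)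
    fix u v c assume "u \<in> f ` V"
    then obtain u' where u: "u' \<in> V" "u = f u'" by blast
    show "t c u \<in> f ` V"
      using u lin(3)[OF u(1)] S.subspace_scale[OF assms(4) u(1)] by (metis imageI)
    assume "v \<in> f ` V"
    then obtain v' where v: "v' \<in> V" "v = f v'" by blast
    show "u + v \<in> f ` V"
      using u v lin(2)[OF u(1) v(1)] S.subspace_add[OF assms(4) u(1) v(1)] by (metis imageI)
  qed
qed

lemma prod_surjectiveD:
  assumes "prod_surjective Q M S x" "\<And>r. r \<in> S \<Longrightarrow> w r \<in> sp M (head Q r)"
  obtains v where "v \<in> sp M x" "\<And>r. r \<in> S \<Longrightarrow> mp M r v = w r"
  using assms(1)[unfolded prod_surjective_def, rule_format, of w] assms(2) by auto

text \<open>Dual to \<open>arc_sums\<close>: when \<open>S\<close> consists of all outgoing arrows,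
  this is the socle of \<open>M\<close> at \<open>x\<close>. Functionals that separate its elements
  take the place of generators.\<close>

definition arc_kernel ::
  "('a, 'b) pre_digraph \<Rightarrow> ('k::field, 'a, 'b, 'v::ab_group_add) qrep \<Rightarrow> 'b set \<Rightarrow> 'a \<Rightarrow> 'v set" where
  "arc_kernel Q M S x = {v \<in> sp M x. \<forall>r\<in>S. mp M r v = 0}"

section \<open>Sums of the \<open>I\<^sub>a\<close> and the maps given by functionals\<close>

context slf_quiver
begin

abbreviation inj_sum :: "nat \<Rightarrow> (nat \<Rightarrow> 'a) \<Rightarrow> ('k::field, 'a, 'b, nat \<Rightarrow> 'b list \<Rightarrow> 'k) qrep" where
  "inj_sum n b \<equiv> dsum_fin n (\<lambda>i. inj_rep Q (b i))"

lemma sp_inj_sum: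
  "v \<in> sp (inj_sum n b) x \<longleftrightarrow>
     (\<forall>i p. v i p \<noteq> 0 \<longrightarrow> i < n \<and> p \<in> paths Q x (b i))"
  unfolding dsum_fin_def inj_rep_def
  by (auto simp: free_space_paths zero_fun_def fun_eq_iff) (meson linorder_not_less)+

lemma mp_inj_sum:
  "mp (inj_sum n b) a v i p = (if i < n then v i (a # p) else 0)"
  by (simp add: dsum_fin_def inj_rep_def)

lemma scl_inj_sum: "scl (inj_sum n b) c v i p = c * v i p"
  by (simp add: dsum_fin_def inj_rep_def)

lemma inj_sum_Cons:
  assumes v: "v \<in> sp (inj_sum n b) x" and "r \<in> out_arcs Q x"
  shows "(\<lambda>i p. v i (r # p)) \<in> sp (inj_sum n b) (head Q r)"
  unfolding sp_inj_sum
proof (intro allI impI)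
  fix i p assume "v i (r # p) \<noteq> 0"
  then have "i < n \<and> r # p \<in> paths Q x (b i)" using v by (simp add: sp_inj_sum)
  then show "i < n \<and> p \<in> paths Q (head Q r) (b i)" by (simp add: Cons_in_paths_iff)
qed

text \<open>The dual Yoneda map: a functional on the space at \<open>b i\<close> determines a map
  into the representation \<open>I\<^sub>a\<close> with \<open>a = b i\<close>, whose coefficient at
  a path \<open>p\<close> is the functional after transport along \<open>p\<close>.\<close>

definition coeval_rep ::
  "('k::field, 'a, 'b, 'v::ab_group_add) qrep \<Rightarrow> nat \<Rightarrow> (nat \<Rightarrow> 'a) \<Rightarrow> (nat \<Rightarrow> 'v \<Rightarrow> 'k) \<Rightarrow> 'a \<Rightarrow> 'v \<Rightarrow>
   nat \<Rightarrow> 'b list \<Rightarrow> 'k" where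
  "coeval_rep X n b lam x v i p =
     (if i < n \<and> p \<in> paths Q x (b i) then lam i (fold (mp X) p v) else 0)"

lemma coeval_rep_hom:
  fixes X :: "('k::field, 'a, 'b, 'v::ab_group_add) qrep"
  assumes X: "lfd_rep Q X"
    and lam: "\<And>i. i < n \<Longrightarrow> linear_between (scl X) (*) (sp X (b i)) UNIV (lam i)"
  shows "rep_hom Q X (inj_sum n b) (coeval_rep X n b lam)"
  unfolding rep_hom_def
proof (intro conjI ballI)
  let ?I = "inj_sum n b :: ('k, _, _, _) qrep"
  fix x assume x: "x \<in> verts Q"
  have lin: "linear_between (scl X) (*) (sp X x) UNIV (\<lambda>v. lam i (fold (mp X) p v))"
    if "i < n" "p \<in> paths Q x (b i)" for i p
    using linear_between_comp[OF fold_linear_between[OF X that(2)] lam[OF that(1)]] .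
  show "linear_between (scl X) (scl ?I) (sp X x) (sp ?I x) (coeval_rep X n b lam x)"
    unfolding linear_between_def
  proof (intro conjI ballI allI)
    fix u v c assume u: "u \<in> sp X x"
    show "coeval_rep X n b lam x u \<in> sp ?I x" by (auto simp: sp_inj_sum coeval_rep_def)
    show "coeval_rep X n b lam x (scl X c u) = scl ?I c (coeval_rep X n b lam x u)"
      using linear_betweenD(3)[OF lin u] by (auto simp: fun_eq_iff coeval_rep_def scl_inj_sum)
    assume v: "v \<in> sp X x"
    show "coeval_rep X n b lam x (u + v) = coeval_rep X n b lam x u + coeval_rep X n b lam x v"
      using linear_betweenD(2)[OF lin u v] by (auto simp: fun_eq_iff coeval_rep_def)
  qed
next
  fix a v assume "a \<in> arcs Q" "v \<in> sp X (tail Q a)"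
  then show "coeval_rep X n b lam (head Q a) (mp X a v) =
      mp (inj_sum n b) a (coeval_rep X n b lam (tail Q a) v)"
    by (auto simp: fun_eq_iff coeval_rep_def mp_inj_sum Cons_in_paths_iff)
qed

lemma arc_kernel_subspace:
  assumes M: "lfd_rep Q M" and x: "x \<in> verts Q"
  shows "module.subspace (scl M) (arc_kernel Q M (out_arcs Q x) x)"
proof -
  interpret vector_space "scl M" using M by (rule lfd_repD)
  have lin: "linear_between (scl M) (scl M) (sp M x) (sp M (head Q r)) (mp M r)"
    if "r \<in> out_arcs Q x" for r
    using lfd_repD(4)[OF M, of r] that by auto
  show ?thesis
    unfolding arc_kernel_def
    using lfd_rep_zero[OF M x] linear_between_zero[OF lin] linear_betweenD(2,3)[OF lin]
      lfd_rep_add[OF M x] lfd_rep_scale[OF M x]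
    by (intro subspaceI) simp_all
qed

text \<open>Dual to \<open>proj_sum_bijective\<close>, by induction from heads to tails. A vector is
  recovered from its images under the outgoing arrows, to which the induction hypothesis applies,
  and from the functionals placed at \<open>x\<close>, which separate the common kernel of these
  arrows and account for the trivial paths.\<close>

lemma inj_sum_bijective:
  fixes R :: "('k::field, 'a, 'b, 'v::ab_group_add) qrep"
  assumes R: "lfd_rep Q R"
    and surj: "\<And>x. x \<in> verts Q \<Longrightarrow> prod_surjective Q R (out_arcs Q x) x"
    and wf: "wf (succ_rel Q (\<lambda>x. sp R x \<noteq> {0}))"
    and lam: "\<And>i. i < n \<Longrightarrow> linear_between (scl R) (*) (sp R (b i)) UNIV (lam i)"
    and b: "\<And>i. i < n \<Longrightarrow> sp R (b i) \<noteq> {0}"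
    and sep: "\<And>x v. x \<in> verts Q \<Longrightarrow> v \<in> arc_kernel Q R (out_arcs Q x) x \<Longrightarrow>
      (\<And>i. i < n \<Longrightarrow> b i = x \<Longrightarrow> lam i v = 0) \<Longrightarrow> v = 0"
    and hit: "\<And>x t. x \<in> verts Q \<Longrightarrow>
      \<exists>k\<in>arc_kernel Q R (out_arcs Q x) x. \<forall>i<n. b i = x \<longrightarrow> lam i k = t i"
    and x: "x \<in> verts Q"
  shows "bij_betw (coeval_rep R n b lam x) (sp R x) (sp (inj_sum n b) x)"
proof -
  let ?I = "inj_sum n b :: ('k, _, _, _) qrep"
  let ?c = "coeval_rep R n b lam"
  interpret vector_space "scl R" using R by (rule lfd_repD)
  have hom: "rep_hom Q R ?I ?c" using R lam by (rule coeval_rep_hom)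
  have mem: "?c y v \<in> sp ?I y" if "y \<in> verts Q" "v \<in> sp R y" for y v
    using linear_betweenD(1)[OF rep_homD(1)[OF hom that(1)] that(2)] .
  have c0: "?c y 0 = (\<lambda>i p. 0)" if "y \<in> verts Q" for y
    using linear_between_zero[OF rep_homD(1)[OF hom that] lfd_rep_zero[OF R that]]
    by (simp add: zero_fun_def)
  \<comment> \<open>Here the support is closed under predecessors: by \<open>surj\<close> a nonzero
    vector at the head of an arrow is hit from its tail.\<close>
  have supp: "sp R y \<noteq> {0}" if p: "p \<in> paths Q y (b i)" "i < n" for p i y
  proof -
    have "y \<in> {z. sp R z \<noteq> {0}}"
    proof (rule closed_under_paths_back[OF p(1)])
      show "b i \<in> {z. sp R z \<noteq> {0}}" using b[OF p(2)] by simp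
    next
      fix a assume a: "a \<in> arcs Q" and "head Q a \<in> {z. sp R z \<noteq> {0}}"
      then obtain v where v: "v \<in> sp R (head Q a)" "v \<noteq> 0"
        using lfd_rep_nonzero[OF R, of "head Q a"] by auto
      have "prod_surjective Q R (out_arcs Q (tail Q a)) (tail Q a)" using surj a by simp
      then obtain u where u: "u \<in> sp R (tail Q a)"
        "\<And>r. r \<in> out_arcs Q (tail Q a) \<Longrightarrow> mp R r u = (if r = a then v else 0)"
        by (rule prod_surjectiveD[of _ _ _ _ "\<lambda>r. if r = a then v else 0"])
          (use v lfd_rep_zero[OF R] in auto)
      have "mp R a u = v" using u(2)[of a] a by simp
      then have "u \<noteq> 0" using v mp_0[OF R a] by auto
      then show "tail Q a \<in> {z. sp R z \<noteq> {0}}" using u(1) by auto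
    qed
    then show ?thesis by simp
  qed
  have Izero: "v = (\<lambda>i p. 0)" if "v \<in> sp ?I y" "sp R y = {0}" for v y
    unfolding fun_eq_iff
  proof (intro allI, rule ccontr)
    fix i p assume "v i p \<noteq> 0"
    then show False using supp[of p y i] that by (simp add: sp_inj_sum)
  qed
  have Cons: "?c (head Q r) (mp R r v) i p = ?c y v i (r # p)" if "r \<in> out_arcs Q y" for y v i p r
    using that by (auto simp: coeval_rep_def Cons_in_paths_iff)
  have "x \<in> verts Q \<longrightarrow> (\<forall>v\<in>sp R x. ?c x v = (\<lambda>i p. 0) \<longrightarrow> v = 0) \<and> (\<forall>f\<in>sp ?I x. \<exists>v\<in>sp R x. ?c x v = f)"
    using wf
  proof (induction x rule: wf_induct_rule)
    case (less x)
    have IH: "(\<forall>v\<in>sp R (head Q r). ?c (head Q r) v = (\<lambda>i p. 0) \<longrightarrow> v = 0) \<and>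
        (\<forall>f\<in>sp ?I (head Q r). \<exists>v\<in>sp R (head Q r). ?c (head Q r) v = f)"
      if r: "r \<in> out_arcs Q x" and "sp R x \<noteq> {0}" for r
    proof (cases "sp R (head Q r) = {0}")
      case True
      have "?c (head Q r) 0 = f" if "f \<in> sp ?I (head Q r)" for f
        using Izero[OF that True] c0 r by simp
      then show ?thesis using True by simp
    next
      case False
      then show ?thesis using less[of "head Q r"] that by auto
    qed
    show ?case
    proof (intro impI conjI ballI)
      fix v assume x: "x \<in> verts Q" and v: "v \<in> sp R x" and 0: "?c x v = (\<lambda>i p. 0)"
      show "v = 0"
      proof (cases "sp R x = {0}")
        case True
        then show ?thesis using v by simp
      next
        case False
        have "mp R r v = 0" if r: "r \<in> out_arcs Q x" for r
        proof -
          have "mp R r v \<in> sp R (head Q r)"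
            using lfd_rep_mp[OF R, of r] r v by auto
          moreover have "?c (head Q r) (mp R r v) = (\<lambda>i p. 0)"
            by (intro ext) (simp add: Cons[OF r] 0)
          ultimately show ?thesis using IH[OF r False] by blast
        qed
        then have "v \<in> arc_kernel Q R (out_arcs Q x) x" using v by (simp add: arc_kernel_def)
        moreover have "lam i v = 0" if "i < n" "b i = x" for i
        proof -
          have "?c x v i [] = 0" by (simp add: 0)
          then show ?thesis using that x by (simp add: coeval_rep_def Nil_in_paths_iff)
        qed
        ultimately show ?thesis by (intro sep[OF x]) 
      qed
    next
      fix f assume x: "x \<in> verts Q" and f: "f \<in> sp ?I x"
      show "\<exists>v\<in>sp R x. ?c x v = f"
      proof (cases "sp R x = {0}")
        case True
        have "?c x 0 = f" using Izero[OF f True] c0[OF x] by simp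
        then show ?thesis using True by simp
      next
        case False
        have "\<exists>m. m \<in> sp R (head Q r) \<and> ?c (head Q r) m = (\<lambda>i p. f i (r # p))" if "r \<in> out_arcs Q x" for r
          using IH[OF that False] inj_sum_Cons[OF f that] by (simp add: Bex_def)
        then obtain m where m: "\<And>r. r \<in> out_arcs Q x \<Longrightarrow> m r \<in> sp R (head Q r)"
          "\<And>r. r \<in> out_arcs Q x \<Longrightarrow> ?c (head Q r) (m r) = (\<lambda>i p. f i (r # p))" by metis
        obtain v0 where v0: "v0 \<in> sp R x" "\<And>r. r \<in> out_arcs Q x \<Longrightarrow> mp R r v0 = m r"
          using prod_surjectiveD[OF surj[OF x], of m] m(1) by metis
        \<comment> \<open>\<open>v0\<close> has the right images along the arrows. Adding an element
          of their common kernel keeps these images and corrects the coefficients at the trivial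
          paths.\<close>
        obtain k where k: "k \<in> arc_kernel Q R (out_arcs Q x) x"
          "\<And>i. i < n \<Longrightarrow> b i = x \<Longrightarrow> lam i k = f i [] - lam i v0"
          using hit[OF x, of "\<lambda>i. f i [] - lam i v0"] by metis
        have kx: "k \<in> sp R x" and k0: "\<And>r. r \<in> out_arcs Q x \<Longrightarrow> mp R r k = 0"
          using k(1) by (auto simp: arc_kernel_def)
        have vm: "mp R r (v0 + k) = m r" if "r \<in> out_arcs Q x" for r
          using linear_betweenD(2)[OF lfd_repD(4)[OF R, of r], of v0 k] that v0 kx k0[OF that] by simp
        have "?c x (v0 + k) i p = f i p" for i p
        proof (cases "i < n \<and> p \<in> paths Q x (b i)")
          case False
          then show ?thesis using f by (auto simp: coeval_rep_def sp_inj_sum)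
        next
          case True
          show ?thesis
          proof (cases p)
            case Nil
            then have "b i = x" using True by (simp add: Nil_in_paths_iff)
            moreover from this have "lam i (v0 + k) = f i []"
              using linear_betweenD(2)[OF lam, of i v0 k] True v0 kx k(2)[of i] by simp
            ultimately show ?thesis using True Nil by (simp add: coeval_rep_def)
          next
            case (Cons r q)
            then have r: "r \<in> out_arcs Q x" using True by (simp add: Cons_in_paths_iff)
            have "?c x (v0 + k) i (r # q) = ?c (head Q r) (m r) i q"
              using \<open>\<And>y v i p r. r \<in> out_arcs Q y \<Longrightarrow> ?c (head Q r) (mp R r v) i p = ?c y v i (r # p)\<close>[OF r, of "v0 + k" i q]
                vm[OF r] by simp
            then show ?thesis using Cons m(2)[OF r] by simp
          qed
        qed
        then have "?c x (v0 + k) = f" by (intro ext)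
        moreover have "v0 + k \<in> sp R x" using lfd_rep_add[OF R x v0(1) kx] .
        ultimately show ?thesis by blast
      qed
    qed
  qed
  then have ker: "\<forall>v\<in>sp R x. ?c x v = (\<lambda>i p. 0) \<longrightarrow> v = 0" and sur: "\<forall>f\<in>sp ?I x. \<exists>v\<in>sp R x. ?c x v = f"
    using x by auto
  have "inj_on (?c x) (sp R x)"
    using ker by (intro linear_between_inj_on[OF rep_homD(1)[OF hom x] lfd_repD(2)[OF R x]])
      (simp add: zero_fun_def)
  moreover have "?c x ` sp R x = sp ?I x" using sur mem[OF x] by fastforce
  ultimately show ?thesis by (simp add: bij_betw_def)
qed

text \<open>Dual to \<open>proj_sum_iso\<close>: each common kernel supplies its coordinate
  functionals, none where the outgoing arrows are jointly injective.\<close>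

lemma inj_sum_iso:
  fixes R :: "('k::field, 'a, 'b, 'v::ab_group_add) qrep"
  assumes R: "lfd_rep Q R"
    and surj: "\<And>x. x \<in> verts Q \<Longrightarrow> prod_surjective Q R (out_arcs Q x) x"
    and fin: "finite {x \<in> verts Q. \<not> prod_injective Q R (out_arcs Q x) x}"
    and wf: "wf (succ_rel Q (\<lambda>x. sp R x \<noteq> {0}))"
  obtains n :: nat and b :: "nat \<Rightarrow> 'a" and lam :: "nat \<Rightarrow> 'v \<Rightarrow> 'k"
  where "\<And>i. i < n \<Longrightarrow> b i \<in> verts Q"
    "\<And>i. i < n \<Longrightarrow> linear_between (scl R) (*) (sp R (b i)) UNIV (lam i)"
    "\<And>x. x \<in> verts Q \<Longrightarrow> bij_betw (coeval_rep R n b lam x) (sp R x) (sp (inj_sum n b) x)"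
proof -
  interpret vector_space "scl R" using R by (rule lfd_repD)
  let ?K = "\<lambda>x. arc_kernel Q R (out_arcs Q x) x"
  have Ksub: "?K x \<subseteq> sp R x" for x by (auto simp: arc_kernel_def)
  define dual where "dual x D L \<longleftrightarrow> finite D \<and> (\<forall>d\<in>D. linear_between (scl R) (*) (sp R x) UNIV (L d)) \<and>
      (\<forall>v\<in>?K x. (\<forall>d\<in>D. L d v = 0) \<longrightarrow> v = 0) \<and> (\<forall>t. \<exists>v\<in>?K x. \<forall>d\<in>D. L d v = t d)"
    for x and D :: "'v set" and L
  have "\<exists>D L. dual x D L" if x: "x \<in> verts Q" for x
  proof -
    obtain S where S: "finite S" "span S = sp R x" using lfd_repD(3)[OF R x] by blast
    show ?thesis
    proof (rule dual_basis_functionals[OF arc_kernel_subspace[OF R x] Ksub S])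
      fix D :: "'v set" and L assume "finite D" "\<And>d. d \<in> D \<Longrightarrow> linear_between (scl R) (*) (sp R x) UNIV (L d)"
        "\<And>v. v \<in> ?K x \<Longrightarrow> (\<And>d. d \<in> D \<Longrightarrow> L d v = 0) \<Longrightarrow> v = 0"
        "\<And>t. \<exists>v\<in>?K x. \<forall>d\<in>D. L d v = t d"
      then show ?thesis by (intro exI[of _ D] exI[of _ L]) (simp add: dual_def)
    qed
  qed
  then obtain D L where dual: "\<And>x. x \<in> verts Q \<Longrightarrow> dual x (D x) (L x)" by metis
  have D: "finite (D x)" "\<And>d. d \<in> D x \<Longrightarrow> linear_between (scl R) (*) (sp R x) UNIV (L x d)"
    "\<And>v. v \<in> ?K x \<Longrightarrow> \<forall>d\<in>D x. L x d v = 0 \<Longrightarrow> v = 0"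
    "\<And>t. \<exists>v\<in>?K x. \<forall>d\<in>D x. L x d v = t d"
    if "x \<in> verts Q" for x
    using dual[OF that] unfolding dual_def by simp_all
  have nz: "\<exists>v\<in>?K x. v \<noteq> 0" if x: "x \<in> verts Q" and d: "d \<in> D x" for x d
  proof -
    obtain v where v: "v \<in> ?K x" "\<forall>d\<in>D x. L x d v = 1" using D(4)[OF x, of "\<lambda>_. 1"] by blast
    have "L x d 0 = 0" using linear_between_zero[OF D(2)[OF x d] lfd_rep_zero[OF R x]] .
    then have "v \<noteq> 0" using v(2) d by auto
    then show ?thesis using v(1) by blast
  qed
  have good: "D x = {}" if "x \<in> verts Q" "prod_injective Q R (out_arcs Q x) x" for x
    using that nz by (fastforce simp: prod_injective_def arc_kernel_def)
  define Z where "Z = Sigma {x \<in> verts Q. \<not> prod_injective Q R (out_arcs Q x) x} D"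
  have "finite Z" unfolding Z_def using fin D(1) by (intro finite_SigmaI) auto
  then obtain e where e: "bij_betw e {0..<card Z} Z" using ex_bij_betw_nat_finite by blast
  let ?n = "card Z" and ?b = "\<lambda>i. fst (e i)" and ?xi = "\<lambda>i. snd (e i)"
  let ?lam = "\<lambda>i. L (?b i) (?xi i)"
  have eZ: "?b i \<in> verts Q" "?xi i \<in> D (?b i)" if "i < ?n" for i
    using bij_betwE[OF e] that by (cases "e i"; force simp: Z_def)+
  have onto: "\<exists>i<?n. ?b i = x \<and> ?xi i = d" if x: "x \<in> verts Q" and d: "d \<in> D x" for x d
  proof -
    have "(x, d) \<in> Z" using good[OF x] x d by (auto simp: Z_def)
    then have "(x, d) \<in> e ` {0..<?n}" using e by (simp add: bij_betw_def)
    then obtain i where "i < ?n" "e i = (x, d)" by auto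
    then show ?thesis by (intro exI[of _ i]) simp
  qed
  show ?thesis
  proof (rule that[of ?n ?b ?lam])
    show lin: "linear_between (scl R) (*) (sp R (?b i)) UNIV (?lam i)" if "i < ?n" for i
      using D(2)[OF eZ[OF that]] .
    show "?b i \<in> verts Q" if "i < ?n" for i using eZ(1)[OF that] .
    fix x assume x: "x \<in> verts Q"
    show "bij_betw (coeval_rep R ?n ?b ?lam x) (sp R x) (sp (inj_sum ?n ?b) x)"
    proof (rule inj_sum_bijective[OF R surj wf lin _ _ _ x])
      show "sp R (?b i) \<noteq> {0}" if "i < ?n" for i
        using nz[OF eZ[OF that]] by (auto simp: arc_kernel_def)
    next
      fix y v assume y: "y \<in> verts Q" and v: "v \<in> ?K y" and 0: "\<And>i. i < ?n \<Longrightarrow> ?b i = y \<Longrightarrow> ?lam i v = 0"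
      have "L y d v = 0" if "d \<in> D y" for d using onto[OF y that] 0 by blast
      then show "v = 0" using D(3)[OF y v] by blast
    next
      fix y and t :: "nat \<Rightarrow> 'k" assume y: "y \<in> verts Q"
      \<comment> \<open>The prescribed value of a functional is looked up through its number, which
        is unique because \<open>e\<close> is injective.\<close>
      define s where "s d = t (SOME i. i < ?n \<and> ?b i = y \<and> ?xi i = d)" for d
      obtain k where k: "k \<in> ?K y" "\<forall>d\<in>D y. L y d k = s d" using D(4)[OF y] by blast
      have "?lam i k = t i" if i: "i < ?n" "?b i = y" for i
      proof -
        have "(SOME j. j < ?n \<and> ?b j = y \<and> ?xi j = ?xi i) = i"
        proof (rule some_equality)
          fix j assume "j < ?n \<and> ?b j = y \<and> ?xi j = ?xi i"
          then show "j = i"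
            using i inj_onD[OF bij_betw_imp_inj_on[OF e], of j i] by (simp add: prod_eq_iff)
        qed (use i in simp)
        then show ?thesis using k(2) eZ(2)[OF i(1)] i(2) by (simp add: s_def)
      qed
      then show "\<exists>k\<in>?K y. \<forall>i<?n. ?b i = y \<longrightarrow> ?lam i k = t i" using k(1) by blast
    qed
  qed
qed

text \<open>A map into \<open>R\<close> is determined by its composites with the functionals
  \<open>lam i\<close>. To extend \<open>f\<close> along \<open>g\<close>, these composites are
  transported to the image of \<open>g\<close> and extended from there to the spaces of
  \<open>Y\<close>.\<close>

lemma injective_minusI:
  fixes R :: "('k::field, 'a, 'b, 'v::ab_group_add) qrep"
  assumes R: "lfd_rep Q R"
    and surj: "\<And>x. x \<in> verts Q \<Longrightarrow> prod_surjective Q R (out_arcs Q x) x"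
    and fin: "finite {x \<in> verts Q. \<not> prod_injective Q R (out_arcs Q x) x}"
    and wf: "wf (succ_rel Q (\<lambda>x. sp R x \<noteq> {0}))"
  shows "injective_minus Q R"
proof -
  obtain n b lam where b: "\<And>i. i < n \<Longrightarrow> b i \<in> verts Q"
    and lam: "\<And>i. i < n \<Longrightarrow> linear_between (scl R) (*) (sp R (b i)) UNIV (lam i)"
    and bij: "\<And>x. x \<in> verts Q \<Longrightarrow> bij_betw (coeval_rep R n b lam x) (sp R x) (sp (inj_sum n b) x)"
    by (rule inj_sum_iso[OF assms]) auto
  let ?I = "inj_sum n b :: ('k, _, _, _) qrep" and ?c = "coeval_rep R n b lam"
  let ?Z = "inj_sum 0 b :: ('k, _, _, _) qrep"
  have hom: "rep_hom Q R ?I ?c" using R lam by (rule coeval_rep_hom)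
  have Z: "sp ?Z x = {0}" for x by (auto simp: sp_inj_sum zero_fun_def fun_eq_iff)
  have I0: "0 \<in> sp ?I x" for x by (simp add: sp_inj_sum)
  have "short_exact Q R ?I ?Z ?c (\<lambda>x v. 0)"
    unfolding short_exact_def rep_mono_def rep_epi_def
  proof (intro conjI ballI)
    have Z00: "mp ?Z a 0 = 0" "scl ?Z c 0 = 0" for a c
      by (auto simp: mp_inj_sum scl_inj_sum fun_eq_iff)
    show "rep_hom Q ?I ?Z (\<lambda>x v. 0)"
      unfolding rep_hom_def linear_between_def Z using Z00 by auto
    show "rep_hom Q R ?I ?c" by (fact hom)
    fix x assume x: "x \<in> verts Q"
    show "inj_on (?c x) (sp R x)" using bij[OF x] by (simp add: bij_betw_def)
    show "(\<lambda>v. 0) ` sp ?I x = sp ?Z x" using I0[of x] by (auto simp: Z)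
    show "?c x ` sp R x = {v \<in> sp ?I x. (0 :: nat \<Rightarrow> 'b list \<Rightarrow> 'k) = 0}"
      using bij[OF x] by (simp add: bij_betw_def)
  qed
  then have minus: "rep_minus Q R"
    unfolding rep_minus_def using R b
    by (intro conjI exI[of _ n] exI[of _ "0::nat"] exI[of _ b] exI[of _ ?c] exI[of _ "\<lambda>x v. 0"]) auto
  show ?thesis
    unfolding injective_minus_def
  proof (intro conjI minus allI impI)
    fix X Y :: "('k, 'a, 'b) std_rep" and g f
    assume X: "rep_minus Q X" and Y: "rep_minus Q Y" and g: "rep_mono Q X Y g" and f: "rep_hom Q X R f"
    have X': "lfd_rep Q X" and Y': "lfd_rep Q Y" using X Y by (auto simp: rep_minus_def)
    have g': "rep_hom Q X Y g" and ginj: "\<And>x. x \<in> verts Q \<Longrightarrow> inj_on (g x) (sp X x)"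
      using g by (auto simp: rep_mono_def)
    have "\<exists>nu. linear_between (scl Y) (*) (sp Y (b i)) UNIV nu \<and>
        (\<forall>v\<in>sp X (b i). nu (g (b i) v) = lam i (f (b i) v))" if i: "i < n" for i
    proof -
      interpret X: vector_space "scl X" using X' by (rule lfd_repD)
      interpret Y: vector_space "scl Y" using Y' by (rule lfd_repD)
      let ?V = "sp X (b i)" and ?g = "g (b i)"
      note lin = rep_homD(1)[OF g' b[OF i]] and sub = lfd_repD(2)[OF X' b[OF i]]
      have "linear_between (scl X) (scl Y) ?V (?g ` ?V) ?g"
        using lin by (auto simp: linear_between_def)
      then have "linear_between (scl Y) (scl X) (?g ` ?V) ?V (inv_into ?V ?g)"
        using ginj[OF b[OF i]] lfd_rep_add[OF X' b[OF i]] lfd_rep_scale[OF X' b[OF i]]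
        by (intro linear_between_inv_into) (auto simp: bij_betw_def)
      from linear_between_comp[OF linear_between_comp[OF this rep_homD(1)[OF f b[OF i]]] lam[OF i]]
      have mu: "linear_between (scl Y) (*) (?g ` ?V) UNIV (\<lambda>v. lam i (f (b i) (inv_into ?V ?g v)))"
        .
      have "?g ` ?V \<subseteq> sp Y (b i)" using linear_betweenD(1)[OF lin] by blast
      moreover obtain S where S: "finite S" "Y.span S = sp Y (b i)" using lfd_repD(3)[OF Y' b[OF i]] by blast
      ultimately obtain nu where "linear_between (scl Y) (*) (sp Y (b i)) UNIV nu"
        "\<And>u. u \<in> ?g ` ?V \<Longrightarrow> nu u = lam i (f (b i) (inv_into ?V ?g u))"
        using Y.extend_functional[OF linear_between_image_subspace[OF _ _ lin sub] _ S mu]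
          X.vector_space_axioms Y.vector_space_axioms by metis
      then show ?thesis using ginj[OF b[OF i]] by (intro exI[of _ nu]) simp
    qed
    then obtain nu where nu: "\<And>i. i < n \<Longrightarrow> linear_between (scl Y) (*) (sp Y (b i)) UNIV (nu i)"
      "\<And>i v. i < n \<Longrightarrow> v \<in> sp X (b i) \<Longrightarrow> nu i (g (b i) v) = lam i (f (b i) v)"
      by metis
    let ?h = "\<lambda>x v. inv_into (sp R x) (?c x) (coeval_rep Y n b nu x v)"
    have inv: "rep_hom Q ?I R (\<lambda>x. inv_into (sp R x) (?c x))"
      using bij lfd_rep_add[OF R] lfd_rep_scale[OF R] lfd_rep_mp[OF R]
      by (intro rep_hom_inv_into[OF wf_digraph_axioms hom]) auto
    have "rep_hom Q Y R ?h"
      using rep_hom_comp[OF wf_digraph_axioms coeval_rep_hom[OF Y' nu(1)] inv] .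
    moreover have "?h x (g x v) = f x v" if x: "x \<in> verts Q" and v: "v \<in> sp X x" for x v
    proof -
      have "coeval_rep Y n b nu x (g x v) i p = ?c x (f x v) i p" for i p
      proof (cases "i < n \<and> p \<in> paths Q x (b i)")
        case True
        then have "fold (mp X) p v \<in> sp X (b i)"
          using linear_betweenD(1)[OF fold_linear_between[OF X'] v] by blast
        then have "nu i (fold (mp Y) p (g x v)) = lam i (fold (mp R) p (f x v))"
          using True nu(2)[of i "fold (mp X) p v"] rep_hom_fold[OF X' g' _ v, of p "b i"]
            rep_hom_fold[OF X' f _ v, of p "b i"] by simp
        then show ?thesis by (simp add: coeval_rep_def)
      qed (auto simp: coeval_rep_def)
      then have "coeval_rep Y n b nu x (g x v) = ?c x (f x v)" by (intro ext)
      moreover have "f x v \<in> sp R x" using linear_betweenD(1)[OF rep_homD(1)[OF f x] v] .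
      ultimately show ?thesis using bij[OF x] by (simp add: bij_betw_def)
    qed
    ultimately show "\<exists>h. rep_hom Q Y R h \<and> (\<forall>x\<in>verts Q. \<forall>v\<in>sp X x. h x (g x v) = f x v)"
      by blast
  qed
qed

end

section \<open>Local structure of finitely presented and co-presented representations\<close>

lemma sum_apply2: "(\<Sum>a\<in>A. f a) i p = (\<Sum>a\<in>A. f a i p)"
  for f :: "'x \<Rightarrow> 'i \<Rightarrow> 'p \<Rightarrow> 'm::comm_monoid_add"
  by (induction A rule: infinite_finite_induct) auto

lemma sum_surjectiveD:
  assumes "sum_surjective Q M S x" "v \<in> sp M x"
  obtains w where "\<And>a. a \<in> S \<Longrightarrow> w a \<in> sp M (tail Q a)" "v = arc_sum M S w"
  using assms unfolding sum_surjective_def by metis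

lemma prod_injectiveD:
  "prod_injective Q M S x \<Longrightarrow> v \<in> sp M x \<Longrightarrow> (\<And>r. r \<in> S \<Longrightarrow> mp M r v = 0) \<Longrightarrow> v = 0"
  unfolding prod_injective_def by simp

lemma exact_at:
  assumes "f ` V = {v \<in> W. g v = 0}"
  shows "u \<in> V \<Longrightarrow> f u \<in> W" "u \<in> V \<Longrightarrow> g (f u) = 0" "v \<in> W \<Longrightarrow> g v = 0 \<Longrightarrow> \<exists>u\<in>V. f u = v"
proof -
  show "u \<in> V \<Longrightarrow> f u \<in> W" "u \<in> V \<Longrightarrow> g (f u) = 0" using assms by auto
  assume "v \<in> W" "g v = 0"
  then have "v \<in> f ` V" by (simp add: assms)
  then show "\<exists>u\<in>V. f u = v" by auto
qed

context wf_digraph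
begin

lemma rep_hom_sum:
  assumes hom: "rep_hom G M N f" and x: "x \<in> verts G"
    and lin: "\<And>a. a \<in> in_arcs G x \<Longrightarrow> mp M a (w a) \<in> sp M x"
    and w: "\<And>a. a \<in> in_arcs G x \<Longrightarrow> w a \<in> sp M (tail G a)"
    and closed: "0 \<in> sp M x" "\<And>u v. u \<in> sp M x \<Longrightarrow> v \<in> sp M x \<Longrightarrow> u + v \<in> sp M x"
  shows "f x (arc_sum M (in_arcs G x) w) = (\<Sum>a\<in>in_arcs G x. mp N a (f (tail G a) (w a)))"
proof -
  note l = rep_homD(1)[OF hom x]
  have "arc_sum M S w \<in> sp M x \<and>
      f x (arc_sum M S w) = (\<Sum>a\<in>S. mp N a (f (tail G a) (w a)))"
    if "S \<subseteq> in_arcs G x" for S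
    using that
  proof (induction S rule: infinite_finite_induct)
    case (insert a S)
    then have a: "a \<in> in_arcs G x" by simp
    then have "f x (mp M a (w a)) = mp N a (f (tail G a) (w a))"
      using rep_homD(2)[OF hom, of a "w a"] w[OF a] by simp
    then show ?case
      using insert lin[OF a] closed(2) linear_betweenD(2)[OF l lin[OF a]] by simp
  qed (use closed(1) linear_between_zero[OF l closed(1)] in simp_all)
  then show ?thesis by simp
qed

end

section \<open>Arrow maps of the sums of \<open>P\<^sub>a\<close> and \<open>I\<^sub>a\<close>, and
  the snake lemma\<close>

context slf_quiver
begin

text \<open>A path determines its last arrow, so the contributions of different arrows do not
  overlap and \<open>w a\<close> can be read off at the paths \<open>p @ [a]\<close>.\<close>

lemma proj_sum_sum_injective:
  "sum_injective Q (proj_sum n b :: ('k::field, _, _, _) qrep) (in_arcs Q x)"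
  unfolding sum_injective_def
proof (intro allI impI ballI)
  let ?P = "proj_sum n b :: ('k, _, _, _) qrep"
  fix w a assume w: "\<forall>a\<in>in_arcs Q x. w a \<in> sp ?P (tail Q a)"
    and 0: "arc_sum ?P (in_arcs Q x) w = 0" and a: "a \<in> in_arcs Q x"
  have "w a i p = 0" for i p
  proof (cases "i < n")
    case True
    have "0 = (\<Sum>r\<in>in_arcs Q x. mp ?P r (w r)) i (p @ [a])" by (simp add: 0)
    also have "\<dots> = (\<Sum>r\<in>in_arcs Q x. if r = a then w a i p else 0)"
      unfolding sum_apply2 by (intro sum.cong) (auto simp: mp_proj_sum True)
    also have "\<dots> = w a i p" using a finite_in_arcs by simp
    finally show ?thesis by simp
  next
    case False
    have "w a \<in> sp ?P (tail Q a)" using w a by blast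
    then show ?thesis using False by (auto simp: sp_proj_sum)
  qed
  then show "w a = 0" by (simp add: fun_eq_iff)
qed

text \<open>Away from the \<open>b i\<close> no basis path is trivial, so each has a last
  arrow.\<close>

lemma proj_sum_sum_surjective:
  assumes "x \<notin> b ` {..<n}"
  shows "sum_surjective Q (proj_sum n b :: ('k::field, _, _, _) qrep) (in_arcs Q x) x"
  unfolding sum_surjective_def
proof
  let ?P = "proj_sum n b :: ('k, _, _, _) qrep"
  fix v assume v: "v \<in> sp ?P x"
  let ?w = "\<lambda>a i p. v i (p @ [a])"
  have "v i p = (arc_sum ?P (in_arcs Q x) ?w) i p" for i p
  proof (cases p rule: rev_cases)
    case Nil
    have "\<not> (i < n \<and> [] \<in> paths Q (b i) x)" using assms by (auto simp: Nil_in_paths_iff)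
    then have "v i p = 0" using v Nil by (auto simp: sp_proj_sum)
    then show ?thesis by (simp add: sum_apply2 mp_proj_sum Nil)
  next
    case (snoc q a)
    have "(\<Sum>r\<in>in_arcs Q x. mp ?P r (?w r)) i p = (\<Sum>r\<in>in_arcs Q x. if r = a then if i < n then v i p else 0 else 0)"
      unfolding sum_apply2 by (intro sum.cong) (auto simp: mp_proj_sum snoc)
    also have "\<dots> = (if a \<in> in_arcs Q x \<and> i < n then v i p else 0)"
      using finite_in_arcs by simp
    also have "\<dots> = v i p"
    proof -
      have "v i p \<noteq> 0 \<longrightarrow> i < n \<and> p \<in> paths Q (b i) x" using v unfolding sp_proj_sum by blast
      then show ?thesis by (auto simp: snoc snoc_in_paths_iff)
    qed
    finally show ?thesis by simp
  qed
  then have "v = arc_sum ?P (in_arcs Q x) ?w" by (intro ext)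
  then show "\<exists>w. (\<forall>a\<in>in_arcs Q x. w a \<in> sp ?P (tail Q a)) \<and> v = arc_sum ?P (in_arcs Q x) w"
    using proj_sum_snoc[OF v] by (intro exI[of _ ?w] conjI ballI)
qed

lemma inj_sum_prod_injective:
  assumes "x \<notin> b ` {..<n}"
  shows "prod_injective Q (inj_sum n b :: ('k::field, _, _, _) qrep) (out_arcs Q x) x"
  unfolding prod_injective_def
proof (intro ballI impI)
  let ?I = "inj_sum n b :: ('k, _, _, _) qrep"
  fix v assume v: "v \<in> sp ?I x" and 0: "\<forall>r\<in>out_arcs Q x. mp ?I r v = 0"
  have "v i p = 0" for i p
  proof (cases "i < n \<and> p \<in> paths Q x (b i)")
    case True
    show ?thesis
    proof (cases p)
      case Nil
      then show ?thesis using True assms by (auto simp: Nil_in_paths_iff)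
    next
      case (Cons r q)
      then have "mp ?I r v i q = 0" using True 0 by (simp add: Cons_in_paths_iff)
      then show ?thesis using True Cons by (simp add: mp_inj_sum)
    qed
  next
    case False
    then show ?thesis using v by (auto simp: sp_inj_sum)
  qed
  then show "v = 0" by (simp add: fun_eq_iff)
qed

text \<open>Coefficients at paths with different first arrows can be prescribed independently, so
  this holds at every vertex; trivial paths get coefficient 0.\<close>

lemma inj_sum_prod_surjective:
  shows "prod_surjective Q (inj_sum n b :: ('k::field, _, _, _) qrep) (out_arcs Q x) x"
  unfolding prod_surjective_def
proof (intro allI impI)
  let ?I = "inj_sum n b :: ('k, _, _, _) qrep"
  fix w assume w: "\<forall>r\<in>out_arcs Q x. w r \<in> sp ?I (head Q r)"
  define v where "v i p = (if p \<noteq> [] \<and> hd p \<in> out_arcs Q x then w (hd p) i (tl p) else 0)" for i p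
  have "v \<in> sp ?I x"
    unfolding sp_inj_sum
  proof (intro allI impI)
    fix i p assume "v i p \<noteq> 0"
    then show "i < n \<and> p \<in> paths Q x (b i)"
      using w by (cases p) (auto simp: v_def sp_inj_sum Cons_in_paths_iff split: if_splits)
  qed
  moreover have "mp ?I r v = w r" if "r \<in> out_arcs Q x" for r
    using that w by (fastforce simp: fun_eq_iff mp_inj_sum v_def sp_inj_sum)
  ultimately show "\<exists>v\<in>sp ?I x. \<forall>r\<in>out_arcs Q x. mp ?I r v = w r" by blast
qed

text \<open>Off the tops of both sums, surjectivity of the incoming map passes from the middle term
  of the presentation to its quotient \<open>L\<close>, and injectivity for \<open>L\<close> follows
  from surjectivity for the kernel term and injectivity for the middle term. For the last claim, a
  nonzero vector of \<open>L\<close> lifts to a nonzero combination of paths starting at some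
  \<open>b i\<close>.\<close>

lemma rep_plus_local:
  fixes L :: "('k::field, 'a, 'b, 'v::ab_group_add) qrep"
  assumes "rep_plus Q L"
  obtains F where "finite F" "F \<subseteq> verts Q"
    "\<And>x. x \<in> verts Q - F \<Longrightarrow> sum_injective Q L (in_arcs Q x) \<and> sum_surjective Q L (in_arcs Q x) x"
    "\<And>x. x \<in> verts Q \<Longrightarrow> sp L x \<noteq> {0} \<Longrightarrow> \<exists>g\<in>F. paths Q g x \<noteq> {}"
proof -
  obtain m n s b f g where ab: "\<forall>i<m. s i \<in> verts Q" "\<forall>i<n. b i \<in> verts Q"
    and ex: "short_exact Q (proj_sum m s) (proj_sum n b) L f g"
    using assms by (auto simp: rep_plus_def)
  let ?P' = "proj_sum m s :: ('k, _, _, _) qrep" and ?P = "proj_sum n b :: ('k, _, _, _) qrep"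
  have f: "rep_hom Q ?P' ?P f" and g: "rep_hom Q ?P L g"
    and onto: "\<And>x. x \<in> verts Q \<Longrightarrow> g x ` sp ?P x = sp L x"
    and exact: "\<And>x. x \<in> verts Q \<Longrightarrow> f x ` sp ?P' x = {v \<in> sp ?P x. g x v = 0}"
    using ex by (auto simp: short_exact_def rep_mono_def rep_epi_def)
  interpret P: vector_space "scl ?P" by (rule proj_sum_space(1))
  have P0: "0 \<in> sp (proj_sum k c :: ('k, _, _, _) qrep) x" for k c x by (simp add: sp_proj_sum)
  have mpx: "mp (proj_sum k c :: ('k, _, _, _) qrep) a v \<in> sp (proj_sum k c) x"
    if "a \<in> in_arcs Q x" "v \<in> sp (proj_sum k c) (tail Q a)" for k c a v x
    using proj_sum_closed(3)[of a v k c] that by auto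
  have gsum: "g x (arc_sum ?P (in_arcs Q x) w) = (\<Sum>a\<in>in_arcs Q x. mp L a (g (tail Q a) (w a)))"
    if "x \<in> verts Q" "\<And>a. a \<in> in_arcs Q x \<Longrightarrow> w a \<in> sp ?P (tail Q a)" for x w
  proof (rule rep_hom_sum[OF g that(1)])
    fix a assume a: "a \<in> in_arcs Q x"
    show "w a \<in> sp ?P (tail Q a)" by (rule that(2)[OF a])
    then show "mp ?P a (w a) \<in> sp ?P x" by (rule mpx[OF a])
  qed (rule P0, rule proj_sum_closed(1))
  have fsum: "f x (arc_sum ?P' (in_arcs Q x) w) = (\<Sum>a\<in>in_arcs Q x. mp ?P a (f (tail Q a) (w a)))"
    if "x \<in> verts Q" "\<And>a. a \<in> in_arcs Q x \<Longrightarrow> w a \<in> sp ?P' (tail Q a)" for x w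
  proof (rule rep_hom_sum[OF f that(1)])
    fix a assume a: "a \<in> in_arcs Q x"
    show "w a \<in> sp ?P' (tail Q a)" by (rule that(2)[OF a])
    then show "mp ?P' a (w a) \<in> sp ?P' x" by (rule mpx[OF a])
  qed (rule P0, rule proj_sum_closed(1))
  have lift: "\<exists>u. \<forall>a\<in>in_arcs Q x. u a \<in> sp ?P (tail Q a) \<and> g (tail Q a) (u a) = l a"
    if "\<forall>a\<in>in_arcs Q x. l a \<in> sp L (tail Q a)" for x l
  proof -
    have "\<forall>a\<in>in_arcs Q x. \<exists>u. u \<in> sp ?P (tail Q a) \<and> g (tail Q a) u = l a"
    proof
      fix a assume a: "a \<in> in_arcs Q x"
      then have "l a \<in> g (tail Q a) ` sp ?P (tail Q a)" using that onto[of "tail Q a"] by auto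
      then obtain u where u: "l a = g (tail Q a) u" "u \<in> sp ?P (tail Q a)" by (rule imageE)
      show "\<exists>u. u \<in> sp ?P (tail Q a) \<and> g (tail Q a) u = l a"
        by (intro exI[of _ u] conjI u(2) u(1)[symmetric])
    qed
    then show ?thesis by (rule bchoice)
  qed
  let ?F = "s ` {..<m} \<union> b ` {..<n}"
  show ?thesis
  proof (rule that[of ?F])
    show "finite ?F" "?F \<subseteq> verts Q" using ab by auto
  next
    fix x assume x: "x \<in> verts Q - ?F"
    then have xv: "x \<in> verts Q" by simp
    have "sum_surjective Q L (in_arcs Q x) x"
      unfolding sum_surjective_def
    proof
      fix l assume "l \<in> sp L x"
      then obtain p where p: "p \<in> sp ?P x" "l = g x p" using onto[OF xv] by auto
      obtain w where w: "\<forall>a\<in>in_arcs Q x. w a \<in> sp ?P (tail Q a)" "p = arc_sum ?P (in_arcs Q x) w"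
        using sum_surjectiveD[OF proj_sum_sum_surjective[of x b n] p(1)] x by blast
      have "l = (\<Sum>a\<in>in_arcs Q x. mp L a (g (tail Q a) (w a)))"
        using gsum[OF xv, of w] w p(2) by simp
      moreover have "\<forall>a\<in>in_arcs Q x. g (tail Q a) (w a) \<in> sp L (tail Q a)"
      proof
        fix a assume a: "a \<in> in_arcs Q x"
        then show "g (tail Q a) (w a) \<in> sp L (tail Q a)"
          using linear_betweenD(1)[OF rep_homD(1)[OF g, of "tail Q a"]] w(1) by auto
      qed
      ultimately show "\<exists>w. (\<forall>a\<in>in_arcs Q x. w a \<in> sp L (tail Q a)) \<and> l = arc_sum L (in_arcs Q x) w"
        by (intro exI[of _ "\<lambda>a. g (tail Q a) (w a)"] conjI)
    qed
    moreover have "sum_injective Q L (in_arcs Q x)"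
      unfolding sum_injective_def
    proof (intro allI impI ballI)
      fix l a assume l: "\<forall>a\<in>in_arcs Q x. l a \<in> sp L (tail Q a)"
        and 0: "arc_sum L (in_arcs Q x) l = 0" and a: "a \<in> in_arcs Q x"
      obtain u where u: "\<forall>a\<in>in_arcs Q x. u a \<in> sp ?P (tail Q a) \<and> g (tail Q a) (u a) = l a"
        using lift[OF l] by blast
      \<comment> \<open>The vanishing sum is lifted to the middle term. The lift lies in the image
        of the kernel term, where it again comes from the tails; subtracting this, injectivity in
        the middle term places each \<open>u a\<close> in the kernel of \<open>g\<close>.\<close>
      let ?s = "\<Sum>a\<in>in_arcs Q x. mp ?P a (u a)"
      have "g x ?s = 0" using gsum[OF xv, of u] u 0 by simp
      moreover have "?s \<in> sp ?P x"
        using u by (intro P.subspace_sum[OF proj_sum_space(2)] mpx) auto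
      ultimately have "\<exists>p'\<in>sp ?P' x. f x p' = ?s" by (intro exact_at(3)[OF exact[OF xv]])
      then obtain p' where p': "p' \<in> sp ?P' x" "f x p' = ?s" by (rule bexE)
      obtain w where w: "\<forall>a\<in>in_arcs Q x. w a \<in> sp ?P' (tail Q a)" "p' = arc_sum ?P' (in_arcs Q x) w"
        using sum_surjectiveD[OF proj_sum_sum_surjective[of x s m] p'(1)] x by blast
      have fw: "f (tail Q r) (w r) \<in> sp ?P (tail Q r)" "g (tail Q r) (f (tail Q r) (w r)) = 0"
        if "r \<in> in_arcs Q x" for r
        using exact_at(1,2)[OF exact[of "tail Q r"], of "w r"] w(1) that by simp_all
      have "(\<Sum>a\<in>in_arcs Q x. mp ?P a (f (tail Q a) (w a))) = ?s"
        using fsum[OF xv, of w] w p'(2) by simp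
      moreover have "mp ?P r (u - v) = mp ?P r u - mp ?P r v" for r u v
        by (auto simp: fun_eq_iff mp_proj_sum)
      ultimately have "(\<Sum>a\<in>in_arcs Q x. mp ?P a (u a - f (tail Q a) (w a))) = 0"
        by (simp add: sum_subtractf)
      moreover have "u r - f (tail Q r) (w r) \<in> sp ?P (tail Q r)" if "r \<in> in_arcs Q x" for r
        using fw(1)[OF that] u that by (intro P.subspace_diff[OF proj_sum_space(2)]) auto
      ultimately have "u a - f (tail Q a) (w a) = 0"
        using a by (intro sum_injectiveD[OF proj_sum_sum_injective, of x "\<lambda>a. u a - f (tail Q a) (w a)" n b a])
      then have "u a = f (tail Q a) (w a)" by (simp add: fun_eq_iff)
      then show "l a = 0" using bspec[OF u a] fw(2)[OF a] by simp
    qed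
    ultimately show "sum_injective Q L (in_arcs Q x) \<and> sum_surjective Q L (in_arcs Q x) x" by blast
  next
    fix x assume x: "x \<in> verts Q" and nz: "sp L x \<noteq> {0}"
    have "\<exists>v\<in>sp ?P x. v \<noteq> 0"
    proof (rule ccontr)
      assume "\<not> (\<exists>v\<in>sp ?P x. v \<noteq> 0)"
      then have "sp ?P x = {0}" using P0 by blast
      then have "sp L x = {0}"
        using onto[OF x] linear_between_zero[OF rep_homD(1)[OF g x] P0] by simp
      then show False using nz by simp
    qed
    then obtain v i p where "v \<in> sp ?P x" "v i p \<noteq> 0" by (auto simp: fun_eq_iff)
    then show "\<exists>g\<in>?F. paths Q g x \<noteq> {}" by (fastforce simp: sp_proj_sum)
  qed
qed

text \<open>Dually, injectivity passes from the middle term to \<open>N\<close>, and surjectivity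
  for \<open>N\<close> follows from surjectivity for the middle term and injectivity for the last
  one.\<close>

lemma rep_minus_local:
  fixes N :: "('k::field, 'a, 'b, 'v::ab_group_add) qrep"
  assumes "rep_minus Q N"
  obtains F where "finite F" "F \<subseteq> verts Q"
    "\<And>x. x \<in> verts Q - F \<Longrightarrow> prod_injective Q N (out_arcs Q x) x \<and> prod_surjective Q N (out_arcs Q x) x"
    "\<And>x. x \<in> verts Q \<Longrightarrow> sp N x \<noteq> {0} \<Longrightarrow> \<exists>g\<in>F. paths Q x g \<noteq> {}"
proof -
  obtain m n s b f g where ab: "\<forall>i<m. s i \<in> verts Q" "\<forall>i<n. b i \<in> verts Q"
    and ex: "short_exact Q N (inj_sum m s) (inj_sum n b) f g" and N: "lfd_rep Q N"
    using assms by (auto simp: rep_minus_def)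
  let ?I = "inj_sum m s :: ('k, _, _, _) qrep" and ?I' = "inj_sum n b :: ('k, _, _, _) qrep"
  have f: "rep_hom Q N ?I f" and g: "rep_hom Q ?I ?I' g"
    and finj: "\<And>x. x \<in> verts Q \<Longrightarrow> inj_on (f x) (sp N x)"
    and exact: "\<And>x. x \<in> verts Q \<Longrightarrow> f x ` sp N x = {v \<in> sp ?I x. g x v = 0}"
    using ex by (auto simp: short_exact_def rep_mono_def rep_epi_def)
  have f0: "f x 0 = 0" if "x \<in> verts Q" for x
    using linear_between_zero[OF rep_homD(1)[OF f that] lfd_rep_zero[OF N that]] .
  have fz: "v = 0" if "x \<in> verts Q" "v \<in> sp N x" "f x v = 0" for x v
    using inj_onD[OF finj[OF that(1)], of v 0] that lfd_rep_zero[OF N that(1)] f0 by simp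
  have N_mp: "mp N r v \<in> sp N (head Q r)" if "r \<in> out_arcs Q x" "v \<in> sp N x" for r v x
    using lfd_rep_mp[OF N, of r] that by auto
  have fmp: "f (head Q r) (mp N r v) = mp ?I r (f x v)" if "r \<in> out_arcs Q x" "v \<in> sp N x" for r v x
    using rep_homD(2)[OF f, of r v] that by auto
  let ?F = "s ` {..<m} \<union> b ` {..<n}"
  show ?thesis
  proof (rule that[of ?F])
    show "finite ?F" "?F \<subseteq> verts Q" using ab by auto
  next
    fix x assume x: "x \<in> verts Q - ?F"
    then have xv: "x \<in> verts Q" by simp
    have "prod_injective Q N (out_arcs Q x) x"
      unfolding prod_injective_def
    proof (intro ballI impI)
      fix v assume v: "v \<in> sp N x" and 0: "\<forall>r\<in>out_arcs Q x. mp N r v = 0"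
      have "f x v \<in> sp ?I x" using exact_at(1)[OF exact[OF xv] v] .
      moreover have "mp ?I r (f x v) = 0" if "r \<in> out_arcs Q x" for r
        using fmp[OF that v] 0 that f0 by simp
      ultimately have "f x v = 0"
        using prod_injectiveD[OF inj_sum_prod_injective[of x s m]] x by blast
      then show "v = 0" by (rule fz[OF xv v])
    qed
    moreover have "prod_surjective Q N (out_arcs Q x) x"
      unfolding prod_surjective_def
    proof (intro allI impI)
      fix w assume w: "\<forall>r\<in>out_arcs Q x. w r \<in> sp N (head Q r)"
      have fw: "f (head Q r) (w r) \<in> sp ?I (head Q r)" "g (head Q r) (f (head Q r) (w r)) = 0"
        if "r \<in> out_arcs Q x" for r
        using exact_at(1,2)[OF exact[of "head Q r"], of "w r"] w that by simp_all
      obtain v where v: "v \<in> sp ?I x" "\<And>r. r \<in> out_arcs Q x \<Longrightarrow> mp ?I r v = f (head Q r) (w r)"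
        by (rule prod_surjectiveD[OF inj_sum_prod_surjective[of m s x, where 'k = 'k], of "\<lambda>r. f (head Q r) (w r)"])
          (use fw in auto)
      \<comment> \<open>It remains to see that \<open>v\<close> comes from \<open>N\<close>: its
        image in the last term is killed by all outgoing arrows, hence zero off the
        \<open>b i\<close>.\<close>
      have "g x v \<in> sp ?I' x" using linear_betweenD(1)[OF rep_homD(1)[OF g xv] v(1)] .
      moreover have "mp ?I' r (g x v) = 0" if "r \<in> out_arcs Q x" for r
        using rep_homD(2)[OF g, of r v] v that fw(2)[OF that] by auto
      ultimately have "g x v = 0"
        using prod_injectiveD[OF inj_sum_prod_injective[of x b n]] x by blast
      then obtain u where u: "u \<in> sp N x" "f x u = v" using exact_at(3)[OF exact[OF xv] v(1)] by metis
      have "mp N r u = w r" if r: "r \<in> out_arcs Q x" for r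
      proof -
        have "f (head Q r) (mp N r u) = f (head Q r) (w r)"
          using fmp[OF r u(1)] u(2) v(2)[OF r] by simp
        then show ?thesis
          using inj_onD[OF finj, of "head Q r" "mp N r u" "w r"] N_mp[OF r u(1)] w r by auto
      qed
      then show "\<exists>v\<in>sp N x. \<forall>r\<in>out_arcs Q x. mp N r v = w r" using u(1) by blast
    qed
    ultimately show "prod_injective Q N (out_arcs Q x) x \<and> prod_surjective Q N (out_arcs Q x) x" by blast
  next
    fix x assume x: "x \<in> verts Q" and nz: "sp N x \<noteq> {0}"
    obtain u where u: "u \<in> sp N x" "u \<noteq> 0" using lfd_rep_nonzero[OF N x nz] .
    then have "f x u \<in> sp ?I x" "f x u \<noteq> 0" using exact_at(1)[OF exact[OF x]] fz[OF x] by metis+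
    then obtain v i p where "v \<in> sp ?I x" "v i p \<noteq> 0" by (auto simp: fun_eq_iff)
    then show "\<exists>g\<in>?F. paths Q x g \<noteq> {}" by (fastforce simp: sp_inj_sum)
  qed
qed

end

section \<open>Splitting a representation into a projective, an injective and a finite part\<close>

lemma restrict_rep_simps [simp]:
  "scl (restrict_rep M (Q \<restriction> S)) = scl M"
  "sp (restrict_rep M (Q \<restriction> S)) x = (if x \<in> S then sp M x else {0})"
  "mp (restrict_rep M (Q \<restriction> S)) a v =
    (if a \<in> arcs Q \<and> tail Q a \<in> S \<and> head Q a \<in> S then mp M a v else 0)"
  by (simp_all add: restrict_rep_def)

lemma induce_induce_subgraph: "S \<subseteq> T \<Longrightarrow> (Q \<restriction> T) \<restriction> S = Q \<restriction> S"
  by (auto simp: induce_subgraph_def)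

context wf_digraph
begin

lemma induced_subgraph_mono: "S \<subseteq> T \<Longrightarrow> T \<subseteq> verts G \<Longrightarrow> induced_subgraph (G \<restriction> S) (G \<restriction> T)"
  using wf_digraph.induced_induce[OF wellformed_induce_subgraph, of S T]
  by (simp add: induce_induce_subgraph)

lemma lfd_restrict_rep:
  assumes M: "lfd_rep G M" shows "lfd_rep G (restrict_rep M (G \<restriction> S))"
proof -
  interpret vector_space "scl M" using M by (rule lfd_repD)
  show ?thesis
    unfolding lfd_rep_def
  proof (intro conjI ballI)
    show "vector_space (scl (restrict_rep M (G \<restriction> S)))" by (simp add: vector_space_axioms)
    fix x assume x: "x \<in> verts G"
    show "module.subspace (scl (restrict_rep M (G \<restriction> S))) (sp (restrict_rep M (G \<restriction> S)) x)"
      using lfd_repD(2)[OF M x] by (simp add: subspace_single_0)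
    show "\<exists>B. finite B \<and> module.span (scl (restrict_rep M (G \<restriction> S))) B = sp (restrict_rep M (G \<restriction> S)) x"
      using lfd_repD(3)[OF M x] span_empty by (cases "x \<in> S") auto
  next
    fix a assume a: "a \<in> arcs G"
    note lin = lfd_repD(4)[OF M a]
    show "linear_between (scl (restrict_rep M (G \<restriction> S))) (scl (restrict_rep M (G \<restriction> S)))
      (sp (restrict_rep M (G \<restriction> S)) (tail G a)) (sp (restrict_rep M (G \<restriction> S)) (head G a))
      (mp (restrict_rep M (G \<restriction> S)) a)"
    proof (cases "tail G a \<in> S \<and> head G a \<in> S")
      case True
      then show ?thesis using lin a by (simp add: linear_between_def)
    next
      case False
      then show ?thesis using lfd_rep_zero[OF M] a by (auto simp: linear_between_def)
    qed
  qed
qed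

end

text \<open>
  \<open>TL\<close> and \<open>TN\<close> are the supports of \<open>L\<close> and \<open>N\<close>, \<open>A\<close> and \<open>B\<close> the vertex sets of \<open>\<Sigma>\<^sub>P\<close> and \<open>\<Sigma>\<^sub>I\<close>. Only these
  sets occur, not \<open>L\<close> and \<open>N\<close>, so that the conditions are inherited by smaller \<open>A\<close> and \<open>B\<close>.
  The set \<open>W\<close> below is \<open>\<Omega>\<close>.
\<close>

locale split_rep = slf_quiver Q
  for Q :: "('a, 'b) pre_digraph" +
  fixes M :: "('k::field, 'a, 'b, 'v::ab_group_add) qrep"
    and TL TN A B :: "'a set"
  assumes lfd: "lfd_rep Q M"
    and TL_verts: "TL \<subseteq> verts Q" and TN_verts: "TN \<subseteq> verts Q"
    and supp_iff: "\<And>x. x \<in> verts Q \<Longrightarrow> sp M x \<noteq> {0} \<longleftrightarrow> x \<in> TL \<union> TN"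
    and wf_TL: "wf (pred_rel Q (\<lambda>x. x \<in> TL))"
    and wf_TN: "wf (succ_rel Q (\<lambda>x. x \<in> TN))"
    and A_TL: "A \<subseteq> TL" and B_TN: "B \<subseteq> TN"
    and A_TN: "A \<inter> TN = {}" and B_TL: "B \<inter> TL = {}"
    and fin_A: "finite (TL - A)" and fin_B: "finite (TN - B)"
    and A_closed: "\<And>a. a \<in> arcs Q \<Longrightarrow> tail Q a \<in> A \<Longrightarrow> head Q a \<in> A"
    and B_closed: "\<And>a. a \<in> arcs Q \<Longrightarrow> head Q a \<in> B \<Longrightarrow> tail Q a \<in> B"
    and A_zero: "\<And>a v. a \<in> arcs Q \<Longrightarrow> head Q a \<in> A \<Longrightarrow> tail Q a \<notin> TL \<Longrightarrow>
      v \<in> sp M (tail Q a) \<Longrightarrow> mp M a v = 0"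
    and B_zero: "\<And>a v. a \<in> arcs Q \<Longrightarrow> tail Q a \<in> B \<Longrightarrow> head Q a \<notin> TN \<Longrightarrow>
      v \<in> sp M (tail Q a) \<Longrightarrow> mp M a v = 0"
    and A_inj: "\<And>y. y \<in> A \<Longrightarrow> sum_injective Q M {a \<in> in_arcs Q y. tail Q a \<in> TL}"
    and A_surj: "\<And>y. y \<in> A \<Longrightarrow> sum_surjective Q M {a \<in> in_arcs Q y. tail Q a \<in> TL} y"
    and B_inj: "\<And>x. x \<in> B \<Longrightarrow> prod_injective Q M {r \<in> out_arcs Q x. head Q r \<in> TN} x"
    and B_surj: "\<And>x. x \<in> B \<Longrightarrow> prod_surjective Q M {r \<in> out_arcs Q x. head Q r \<in> TN} x"
    and rest: "TL \<union> TN - (A \<union> B) \<noteq> {}"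
begin

abbreviation "inA y \<equiv> {a \<in> in_arcs Q y. tail Q a \<in> TL}"
abbreviation "outB x \<equiv> {r \<in> out_arcs Q x. head Q r \<in> TN}"
abbreviation "W \<equiv> TL \<union> TN - (A \<union> B)"
abbreviation "MW \<equiv> restrict_rep M (Q \<restriction> W)"

lemma mp0: "a \<in> arcs Q \<Longrightarrow> mp M a 0 = 0"
  by (rule mp_0[OF lfd])

section \<open>The shape of the three subquivers: properties (1) to (3)\<close>

lemma supp_eq: "supp Q M = Q \<restriction> (TL \<union> TN)"
proof -
  have "{x \<in> verts Q. sp M x \<noteq> {0}} = TL \<union> TN" using supp_iff TL_verts TN_verts by blast
  then show ?thesis by (simp add: supp_def)
qed

text \<open>Injectivity is inherited from \<open>M\<close>, the arrows from \<open>A\<close> being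
  among those from \<open>TL\<close>. Surjectivity can fail only at the head of an arrow from
  \<open>TL - A\<close>, and by local finiteness there are finitely many such heads.\<close>

lemma projective_restrict_A: "projective_plus Q (restrict_rep M (Q \<restriction> A))"
proof (rule projective_plusI)
  let ?R = "restrict_rep M (Q \<restriction> A)"
  show R: "lfd_rep Q ?R" using lfd by (rule lfd_restrict_rep)
  have sub: "inA y \<subseteq> in_arcs Q y" for y by blast
  \<comment> \<open>Families in the restricted representation vanish at tails outside
    \<open>A\<close>, so all incoming arrows and the arrows from \<open>TL\<close> give the same
    sum.\<close>
  have sum_R: "arc_sum ?R (in_arcs Q y) w = arc_sum M (inA y) w"
    if y: "y \<in> A" and w: "\<And>a. a \<in> in_arcs Q y \<Longrightarrow> w a \<in> sp ?R (tail Q a)" for y w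
  proof -
    have "arc_sum M (inA y) w = arc_sum ?R (inA y) w"
    proof (rule sum.cong[OF refl])
      fix a assume "a \<in> inA y"
      then show "mp M a (w a) = mp ?R a (w a)"
        using w[of a] y mp0[of a] by (cases "tail Q a \<in> A") auto
    qed
    also have "\<dots> = arc_sum ?R (in_arcs Q y) w"
      using A_TL by (intro sum.mono_neutral_left finite_in_arcs sub) auto
    finally show ?thesis by simp
  qed
  show "sum_injective Q ?R (in_arcs Q x)" if "x \<in> verts Q" for x
    unfolding sum_injective_def
  proof (intro allI impI ballI)
    fix w a assume w: "\<forall>a\<in>in_arcs Q x. w a \<in> sp ?R (tail Q a)"
      and 0: "arc_sum ?R (in_arcs Q x) w = 0" and a: "a \<in> in_arcs Q x"
    show "w a = 0"
    proof (cases "tail Q a \<in> A")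
      case False
      then show ?thesis using bspec[OF w a] by simp
    next
      case True
      then have x: "x \<in> A" using A_closed a by auto
      have wM: "w r \<in> sp M (tail Q r)" if "r \<in> inA x" for r
        using bspec[OF w, of r] that lfd_rep_zero[OF lfd, of "tail Q r"] by (auto split: if_splits)
      show ?thesis
      proof (rule sum_injectiveD[OF A_inj[OF x] wM])
        show "arc_sum M (inA x) w = 0" using sum_R[OF x, of w] w 0 by simp
        show "a \<in> inA x" using a True A_TL by blast
      qed
    qed
  qed
  have "{x \<in> verts Q. \<not> sum_surjective Q ?R (in_arcs Q x) x} \<subseteq> (\<Union>z\<in>TL - A. head Q ` out_arcs Q z)"
  proof (rule subsetI, rule ccontr)
    fix x assume x: "x \<in> {x \<in> verts Q. \<not> sum_surjective Q ?R (in_arcs Q x) x}"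
      and nx: "x \<notin> (\<Union>z\<in>TL - A. head Q ` out_arcs Q z)"
    have tails: "tail Q a \<in> A" if "a \<in> inA x" for a
      using nx that by (fastforce simp: image_iff)
    have "sum_surjective Q ?R (in_arcs Q x) x"
      unfolding sum_surjective_def
    proof
      fix v assume v: "v \<in> sp ?R x"
      show "\<exists>w. (\<forall>a\<in>in_arcs Q x. w a \<in> sp ?R (tail Q a)) \<and> v = arc_sum ?R (in_arcs Q x) w"
      proof (cases "x \<in> A")
        case False
        then show ?thesis
          using v lfd_rep_zero[OF R] mp_0[OF R]
          by (intro exI[of _ "\<lambda>_. 0"]) auto
      next
        case True
        then have "v \<in> sp M x" using v by simp
        then obtain w where w: "\<And>a. a \<in> inA x \<Longrightarrow> w a \<in> sp M (tail Q a)" "v = arc_sum M (inA x) w"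
          by (rule sum_surjectiveD[OF A_surj[OF True]]) (rule that; simp)
        let ?w = "\<lambda>a. if tail Q a \<in> A then w a else 0"
        have m: "?w a \<in> sp ?R (tail Q a)" if "a \<in> in_arcs Q x" for a
          using that w(1)[of a] A_TL by auto
        have "v = arc_sum M (inA x) ?w"
          unfolding w(2) by (rule sum.cong) (use tails in auto)
        also have "\<dots> = arc_sum ?R (in_arcs Q x) ?w" using sum_R[OF True m] by simp
        finally show ?thesis using m by (intro exI[of _ ?w] conjI ballI)
      qed
    qed
    then show False using x by simp
  qed
  then show "finite {x \<in> verts Q. \<not> sum_surjective Q ?R (in_arcs Q x) x}"
    by (rule finite_subset) (intro finite_UN_I finite_imageI finite_out_arcs fin_A)
  show "wf (pred_rel Q (\<lambda>x. sp ?R x \<noteq> {0}))"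
    using A_TL by (intro wf_subset[OF wf_TL]) (auto split: if_splits)
qed

text \<open>Values prescribed in the restriction are zero at heads outside \<open>B\<close>, so they
  may be prescribed in \<open>M\<close> at all heads in \<open>TN\<close>. Injectivity can fail only
  at tails of arrows into the finite set \<open>TN - B\<close>.\<close>

lemma injective_restrict_B: "injective_minus Q (restrict_rep M (Q \<restriction> B))"
proof (rule injective_minusI)
  let ?R = "restrict_rep M (Q \<restriction> B)"
  show R: "lfd_rep Q ?R" using lfd by (rule lfd_restrict_rep)
  show "prod_surjective Q ?R (out_arcs Q x) x" if x: "x \<in> verts Q" for x
    unfolding prod_surjective_def
  proof (intro allI impI)
    fix w assume w: "\<forall>r\<in>out_arcs Q x. w r \<in> sp ?R (head Q r)"
    have w0: "w r = 0" if "r \<in> out_arcs Q x" "head Q r \<notin> B" for r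
      using bspec[OF w that(1)] that(2) by simp
    show "\<exists>v\<in>sp ?R x. \<forall>r\<in>out_arcs Q x. mp ?R r v = w r"
    proof (cases "x \<in> B")
      case False
      then have "w r = 0" if "r \<in> out_arcs Q x" for r
        using w0[OF that] B_closed[of r] that by auto
      then show ?thesis
        using lfd_rep_zero[OF R x] mp0 by (intro bexI[of _ 0]) auto
    next
      case True
      have wM: "w r \<in> sp M (head Q r)" if "r \<in> outB x" for r
        using bspec[OF w, of r] that lfd_rep_zero[OF lfd, of "head Q r"] by (auto split: if_splits)
      obtain v where v: "v \<in> sp M x" "\<And>r. r \<in> outB x \<Longrightarrow> mp M r v = w r"
        by (rule prod_surjectiveD[OF B_surj[OF True] wM], assumption) (rule that; simp)
      have "mp ?R r v = w r" if r: "r \<in> out_arcs Q x" for r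
        using w0[OF r] v(2)[of r] r True B_TN by auto
      then show ?thesis using v(1) True by (intro bexI[of _ v]) simp_all
    qed
  qed
  have "{x \<in> verts Q. \<not> prod_injective Q ?R (out_arcs Q x) x} \<subseteq> (\<Union>z\<in>TN - B. tail Q ` in_arcs Q z)"
  proof (rule subsetI, rule ccontr)
    fix x assume x: "x \<in> {x \<in> verts Q. \<not> prod_injective Q ?R (out_arcs Q x) x}"
      and nx: "x \<notin> (\<Union>z\<in>TN - B. tail Q ` in_arcs Q z)"
    have heads: "head Q r \<in> B" if "r \<in> outB x" for r
      using nx that by (fastforce simp: image_iff)
    have "prod_injective Q ?R (out_arcs Q x) x"
      unfolding prod_injective_def
    proof (intro ballI impI)
      fix v assume v: "v \<in> sp ?R x" and 0: "\<forall>r\<in>out_arcs Q x. mp ?R r v = 0"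
      show "v = 0"
      proof (cases "x \<in> B")
        case False
        then show ?thesis using v by simp
      next
        case True
        show ?thesis
        proof (rule prod_injectiveD[OF B_inj[OF True]])
          show "v \<in> sp M x" using v True by simp
          show "mp M r v = 0" if "r \<in> outB x" for r
            using bspec[OF 0, of r] that heads[OF that] True by auto
        qed
      qed
    qed
    then show False using x by simp
  qed
  then show "finite {x \<in> verts Q. \<not> prod_injective Q ?R (out_arcs Q x) x}"
    by (rule finite_subset) (intro finite_UN_I finite_imageI finite_in_arcs fin_B)
  show "wf (succ_rel Q (\<lambda>x. sp ?R x \<noteq> {0}))"
    using B_TN by (intro wf_subset[OF wf_TN]) (auto split: if_splits)
qed

text \<open>The nonzero space at a vertex of \<open>A\<close> is spanned by the images of arrows
  from \<open>TL\<close>; at a source of \<open>A\<close> such an arrow starts in the finite set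
  \<open>TL - A\<close>. Backward paths in \<open>TL\<close> end, so every vertex of
  \<open>A\<close> lies after a source.\<close>

lemma top_finite_A: "top_finite (Q \<restriction> A)"
proof -
  interpret H: wf_digraph "Q \<restriction> A" by (rule wellformed_induce_subgraph)
  have "sources (Q \<restriction> A) \<subseteq> (\<Union>z\<in>TL - A. head Q ` out_arcs Q z)"
  proof
    fix x assume x: "x \<in> sources (Q \<restriction> A)"
    then have xA: "x \<in> A" and e: "in_arcs (Q \<restriction> A) x = {}" by (auto simp: sources_def)
    have xv: "x \<in> verts Q" using xA A_TL TL_verts by blast
    then obtain v where v: "v \<in> sp M x" "v \<noteq> 0"
      using lfd_rep_nonzero[OF lfd xv] supp_iff[OF xv] xA A_TL by blast
    obtain w where "v = arc_sum M (inA x) w"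
      by (rule sum_surjectiveD[OF A_surj[OF xA] v(1)])
    then have "inA x \<noteq> {}" using v(2) by (metis sum.empty)
    then obtain a where a: "a \<in> arcs Q" "head Q a = x" "tail Q a \<in> TL" by auto
    have "a \<notin> in_arcs (Q \<restriction> A) x" using e by simp
    then have "tail Q a \<notin> A" using a xA by simp
    then show "x \<in> (\<Union>z\<in>TL - A. head Q ` out_arcs Q z)"
      using a by (intro UN_I[of "tail Q a"] image_eqI[of _ _ a]) auto
  qed
  then have "finite (sources (Q \<restriction> A))"
    by (rule finite_subset) (intro finite_UN_I finite_imageI finite_out_arcs fin_A)
  moreover have "y \<in> A \<longrightarrow> (\<exists>x\<in>sources (Q \<restriction> A). paths (Q \<restriction> A) x y \<noteq> {})" for y
    using wf_TL
  proof (induction y rule: wf_induct_rule)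
    case (less y)
    show ?case
    proof
      assume y: "y \<in> A"
      show "\<exists>x\<in>sources (Q \<restriction> A). paths (Q \<restriction> A) x y \<noteq> {}"
      proof (cases "in_arcs (Q \<restriction> A) y = {}")
        case True
        then have "y \<in> sources (Q \<restriction> A)" using y by (simp add: sources_def)
        moreover have "[] \<in> paths (Q \<restriction> A) y y" using y by (simp add: H.Nil_in_paths_iff)
        ultimately show ?thesis by blast
      next
        case False
        then obtain a where a: "a \<in> in_arcs (Q \<restriction> A) y" by blast
        then have t: "a \<in> arcs Q" "tail Q a \<in> A" "head Q a = y" by auto
        then obtain x p where x: "x \<in> sources (Q \<restriction> A)" "p \<in> paths (Q \<restriction> A) x (tail Q a)"
          using less[of "tail Q a"] A_TL y by blast
        then have "p @ [a] \<in> paths (Q \<restriction> A) x y" using a by (auto simp: H.snoc_in_paths_iff)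
        then show ?thesis using x(1) by blast
      qed
    qed
  qed
  ultimately show ?thesis by (simp add: top_finite_def)
qed

lemma socle_finite_B: "socle_finite (Q \<restriction> B)"
proof -
  interpret H: wf_digraph "Q \<restriction> B" by (rule wellformed_induce_subgraph)
  have "sinks (Q \<restriction> B) \<subseteq> (\<Union>z\<in>TN - B. tail Q ` in_arcs Q z)"
  proof
    fix x assume x: "x \<in> sinks (Q \<restriction> B)"
    then have xB: "x \<in> B" and e: "out_arcs (Q \<restriction> B) x = {}" by (auto simp: sinks_def)
    have xv: "x \<in> verts Q" using xB B_TN TN_verts by blast
    then obtain v where v: "v \<in> sp M x" "v \<noteq> 0"
      using lfd_rep_nonzero[OF lfd xv] supp_iff[OF xv] xB B_TN by blast
    have "outB x \<noteq> {}" using prod_injectiveD[OF B_inj[OF xB] v(1)] v(2) by blast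
    then obtain a where a: "a \<in> arcs Q" "tail Q a = x" "head Q a \<in> TN" by auto
    have "a \<notin> out_arcs (Q \<restriction> B) x" using e by simp
    then have "head Q a \<notin> B" using a xB by simp
    then show "x \<in> (\<Union>z\<in>TN - B. tail Q ` in_arcs Q z)"
      using a by (intro UN_I[of "head Q a"] image_eqI[of _ _ a]) auto
  qed
  then have "finite (sinks (Q \<restriction> B))"
    by (rule finite_subset) (intro finite_UN_I finite_imageI finite_in_arcs fin_B)
  moreover have "x \<in> B \<longrightarrow> (\<exists>y\<in>sinks (Q \<restriction> B). paths (Q \<restriction> B) x y \<noteq> {})" for x
    using wf_TN
  proof (induction x rule: wf_induct_rule)
    case (less x)
    show ?case
    proof
      assume x: "x \<in> B"
      show "\<exists>y\<in>sinks (Q \<restriction> B). paths (Q \<restriction> B) x y \<noteq> {}"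
      proof (cases "out_arcs (Q \<restriction> B) x = {}")
        case True
        then have "x \<in> sinks (Q \<restriction> B)" using x by (simp add: sinks_def)
        moreover have "[] \<in> paths (Q \<restriction> B) x x" using x by (simp add: H.Nil_in_paths_iff)
        ultimately show ?thesis by blast
      next
        case False
        then obtain a where a: "a \<in> out_arcs (Q \<restriction> B) x" by blast
        then have t: "a \<in> arcs Q" "head Q a \<in> B" "tail Q a = x" by auto
        then obtain y p where y: "y \<in> sinks (Q \<restriction> B)" "p \<in> paths (Q \<restriction> B) (head Q a) y"
          using less[of "head Q a"] B_TN x by blast
        then have "a # p \<in> paths (Q \<restriction> B) x y" using a by (auto simp: H.Cons_in_paths_iff)
        then show ?thesis using y(1) by blast
      qed
    qed
  qed
  ultimately show ?thesis by (simp add: socle_finite_def)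
qed

lemma successor_closed_A: "successor_closed_in (Q \<restriction> A) (supp Q M)"
  unfolding successor_closed_in_def supp_eq
proof (intro conjI allI impI)
  show "induced_subgraph (Q \<restriction> A) (Q \<restriction> (TL \<union> TN))"
    using A_TL TL_verts TN_verts by (intro induced_subgraph_mono) auto
  fix x y p assume p: "p \<in> paths (Q \<restriction> (TL \<union> TN)) x y" and x: "x \<in> verts (Q \<restriction> A)"
  interpret H: wf_digraph "Q \<restriction> (TL \<union> TN)" by (rule wellformed_induce_subgraph)
  have "y \<in> A" using H.closed_under_paths[OF p, of A] x A_closed by auto
  then show "y \<in> verts (Q \<restriction> A)" by simp
qed

lemma predecessor_closed_B: "predecessor_closed_in (Q \<restriction> B) (quiver_diff (supp Q M) (Q \<restriction> A))"
proof -
  have d: "quiver_diff (supp Q M) (Q \<restriction> A) = Q \<restriction> (TL \<union> TN - A)"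
    by (simp add: quiver_diff_def supp_eq induce_induce_subgraph)
  show ?thesis
    unfolding predecessor_closed_in_def d
  proof (intro conjI allI impI)
    show "induced_subgraph (Q \<restriction> B) (Q \<restriction> (TL \<union> TN - A))"
      using A_TL B_TL B_TN TL_verts TN_verts by (intro induced_subgraph_mono) auto
    fix x y p assume p: "p \<in> paths (Q \<restriction> (TL \<union> TN - A)) x y" and y: "y \<in> verts (Q \<restriction> B)"
    interpret H: wf_digraph "Q \<restriction> (TL \<union> TN - A)" by (rule wellformed_induce_subgraph)
    have "x \<in> B" using H.closed_under_paths_back[OF p, of B] y B_closed by auto
    then show "x \<in> verts (Q \<restriction> B)" by simp
  qed
qed

lemma fin_digraph_W: "fin_digraph (Q \<restriction> W)"
proof -
  interpret H: wf_digraph "Q \<restriction> W" by (rule wellformed_induce_subgraph)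
  have fin: "finite W" using fin_A fin_B by (rule_tac finite_subset[of _ "(TL - A) \<union> (TN - B)"]) auto
  have "arcs (Q \<restriction> W) \<subseteq> (\<Union>x\<in>W. in_arcs Q x)" by auto
  then have "finite (arcs (Q \<restriction> W))"
    by (rule finite_subset) (intro finite_UN_I fin finite_in_arcs)
  then show ?thesis using fin by unfold_locales auto
qed

end

section \<open>Direct sum decompositions and their restriction to \<open>W\<close>\<close>

lemma subrepD:
  assumes "subrep Q L M"
  shows "lfd_rep Q L" "scl L = scl M" "x \<in> verts Q \<Longrightarrow> v \<in> sp L x \<Longrightarrow> v \<in> sp M x"
    "a \<in> arcs Q \<Longrightarrow> v \<in> sp L (tail Q a) \<Longrightarrow> mp L a v = mp M a v"
  using assms unfolding subrep_def by blast+

lemma subrepI: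
  assumes "lfd_rep Q L" "scl L = scl M" "\<And>x v. x \<in> verts Q \<Longrightarrow> v \<in> sp L x \<Longrightarrow> v \<in> sp M x"
    "\<And>a v. a \<in> arcs Q \<Longrightarrow> v \<in> sp L (tail Q a) \<Longrightarrow> mp L a v = mp M a v"
  shows "subrep Q L M"
  using assms unfolding subrep_def by blast

lemma internal_dsumD:
  assumes "internal_dsum Q M M1 M2"
  shows "subrep Q M1 M" "subrep Q M2 M"
    "x \<in> verts Q \<Longrightarrow> v \<in> sp M1 x \<Longrightarrow> v \<in> sp M2 x \<Longrightarrow> v = 0"
    "x \<in> verts Q \<Longrightarrow> v \<in> sp M x \<Longrightarrow> \<exists>u w. u \<in> sp M1 x \<and> w \<in> sp M2 x \<and> v = u + w"
proof -
  show "subrep Q M1 M" "subrep Q M2 M" using assms unfolding internal_dsum_def by blast+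
  assume x: "x \<in> verts Q"
  then have int: "sp M1 x \<inter> sp M2 x = {0}" and add: "sp M x = {u + v | u v. u \<in> sp M1 x \<and> v \<in> sp M2 x}"
    using assms unfolding internal_dsum_def by simp_all
  show "v \<in> sp M1 x \<Longrightarrow> v \<in> sp M2 x \<Longrightarrow> v = 0" using int by blast
  show "v \<in> sp M x \<Longrightarrow> \<exists>u w. u \<in> sp M1 x \<and> w \<in> sp M2 x \<and> v = u + w" unfolding add by blast
qed

lemma internal_dsumI:
  assumes M: "lfd_rep Q M" and sub: "subrep Q M1 M" "subrep Q M2 M"
    and int: "\<And>x v. x \<in> verts Q \<Longrightarrow> v \<in> sp M1 x \<Longrightarrow> v \<in> sp M2 x \<Longrightarrow> v = 0"
    and add: "\<And>x v. x \<in> verts Q \<Longrightarrow> v \<in> sp M x \<Longrightarrow> \<exists>u w. u \<in> sp M1 x \<and> w \<in> sp M2 x \<and> v = u + w"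
  shows "internal_dsum Q M M1 M2"
  unfolding internal_dsum_def
proof (intro conjI ballI sub)
  fix x assume x: "x \<in> verts Q"
  show "sp M1 x \<inter> sp M2 x = {0}"
    using int[OF x] lfd_rep_zero[OF subrepD(1)[OF sub(1)] x] lfd_rep_zero[OF subrepD(1)[OF sub(2)] x] by auto
  show "sp M x = {u + v | u v. u \<in> sp M1 x \<and> v \<in> sp M2 x}"
  proof (intro set_eqI iffI)
    fix v assume "v \<in> sp M x"
    then show "v \<in> {u + v | u v. u \<in> sp M1 x \<and> v \<in> sp M2 x}" using add[OF x] by blast
  next
    fix v assume "v \<in> {u + v | u v. u \<in> sp M1 x \<and> v \<in> sp M2 x}"
    then obtain u w where "v = u + w" "u \<in> sp M1 x" "w \<in> sp M2 x" by blast
    then show "v \<in> sp M x"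
      using lfd_rep_add[OF M x] subrepD(3)[OF sub(1) x] subrepD(3)[OF sub(2) x] by simp
  qed
qed

lemma internal_dsum_commute:
  assumes "lfd_rep Q M" "internal_dsum Q M M1 M2" shows "internal_dsum Q M M2 M1"
proof (rule internal_dsumI[OF assms(1)])
  fix x v assume "x \<in> verts Q" "v \<in> sp M x"
  then obtain u w where "u \<in> sp M1 x" "w \<in> sp M2 x" "v = u + w"
    using internal_dsumD(4)[OF assms(2)] by metis
  then show "\<exists>u w. u \<in> sp M2 x \<and> w \<in> sp M1 x \<and> v = u + w"
    by (intro exI[of _ w] exI[of _ u]) (simp add: add.commute)
qed (use internal_dsumD[OF assms(2)] in auto)

context split_rep
begin

lemma W_verts: "W \<subseteq> verts Q"
  using TL_verts TN_verts by blast

lemma sp_zero: "x \<in> verts Q \<Longrightarrow> x \<notin> TL \<union> TN \<Longrightarrow> sp M x = {0}"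
  using supp_iff by blast

text \<open>A property spreads from \<open>W\<close> over the support, along arrows from
  \<open>TL\<close> on \<open>A\<close> and against arrows into \<open>TN\<close> on
  \<open>B\<close>. Going back from \<open>A\<close> inside \<open>TL\<close> one stays in
  \<open>A\<close> or enters \<open>W\<close>, since \<open>B\<close> misses \<open>TL\<close>;
  likewise forward from \<open>B\<close> inside \<open>TN\<close>, since \<open>A\<close> misses
  \<open>TN\<close>.\<close>

lemma vert_induct [consumes 1, case_names W outside A B]:
  assumes x: "x \<in> verts Q"
    and W: "\<And>x. x \<in> W \<Longrightarrow> P x"
    and out: "\<And>x. x \<in> verts Q \<Longrightarrow> x \<notin> TL \<union> TN \<Longrightarrow> P x"
    and A: "\<And>y. y \<in> A \<Longrightarrow> (\<And>a. a \<in> inA y \<Longrightarrow> P (tail Q a)) \<Longrightarrow> P y"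
    and B: "\<And>x. x \<in> B \<Longrightarrow> (\<And>r. r \<in> outB x \<Longrightarrow> P (head Q r)) \<Longrightarrow> P x"
  shows "P x"
proof -
  have PA: "y \<in> A \<longrightarrow> P y" for y
    using wf_TL
  proof (induction y rule: wf_induct_rule)
    case (less y)
    show ?case
    proof
      assume y: "y \<in> A"
      show "P y"
      proof (rule A[OF y])
        fix a assume a: "a \<in> inA y"
        then have t: "a \<in> arcs Q" "head Q a = y" "tail Q a \<in> TL" by auto
        show "P (tail Q a)"
        proof (cases "tail Q a \<in> A")
          case True
          then show ?thesis using less[of "tail Q a"] t y A_TL by blast
        next
          case False
          then show ?thesis using W t(3) B_TL by blast
        qed
      qed
    qed
  qed
  have PB: "y \<in> B \<longrightarrow> P y" for y
    using wf_TN
  proof (induction y rule: wf_induct_rule)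
    case (less y)
    show ?case
    proof
      assume y: "y \<in> B"
      show "P y"
      proof (rule B[OF y])
        fix a assume a: "a \<in> outB y"
        then have t: "a \<in> arcs Q" "tail Q a = y" "head Q a \<in> TN" by auto
        show "P (head Q a)"
        proof (cases "head Q a \<in> B")
          case True
          then show ?thesis using less[of "head Q a"] t y B_TN by blast
        next
          case False
          then show ?thesis using W t(3) A_TN by blast
        qed
      qed
    qed
  qed
  consider "x \<in> A" | "x \<in> B" | "x \<in> W" | "x \<notin> TL \<union> TN" by blast
  then show ?thesis using PA PB W out[OF x] by cases simp_all
qed

text \<open>\<open>M\<close> is generated by \<open>W\<close> on \<open>A\<close> and cogenerated by
  \<open>W\<close> on \<open>B\<close>. If \<open>M1\<close> vanishes at the tails, then at the head
  every vector of \<open>M\<close> is a sum of images from \<open>M2\<close>, so \<open>M1\<close>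
  vanishes there too. On \<open>B\<close> a vector of \<open>M1\<close> is killed by all arrows that
  jointly separate vectors.\<close>

lemma summand_zero:
  assumes dsum: "internal_dsum Q M M1 M2" and W: "\<And>x. x \<in> W \<Longrightarrow> sp M1 x = {0}"
  shows "zero_rep Q M1"
  unfolding zero_rep_def
proof
  note s1 = subrepD[OF internal_dsumD(1)[OF dsum]] and s2 = subrepD[OF internal_dsumD(2)[OF dsum]]
  note M1 = s1(1) and M2 = s2(1) and mp1 = s1(4) and mp2 = s2(4)
  fix x assume "x \<in> verts Q"
  then show "sp M1 x = {0}"
  proof (induction x rule: vert_induct)
    case (W x)
    then show ?case using assms(2) by blast
  next
    case (outside x)
    then show ?case using sp_zero[of x] s1(3)[of x] lfd_rep_zero[OF M1, of x] by auto
  next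
    case (A y)
    note yA = \<open>y \<in> A\<close>
    then have y: "y \<in> verts Q" using yA A_TL TL_verts by blast
    have "v = 0" if v: "v \<in> sp M1 y" for v
    proof -
      have vM: "v \<in> sp M y" using s1(3)[OF y v] .
      obtain w where w: "\<And>a. a \<in> inA y \<Longrightarrow> w a \<in> sp M (tail Q a)" "v = arc_sum M (inA y) w"
        by (rule sum_surjectiveD[OF A_surj[OF yA] vM]) (rule that; simp)
      have w2: "w a \<in> sp M2 (tail Q a)" if a: "a \<in> inA y" for a
      proof -
        have t: "tail Q a \<in> verts Q" using a by auto
        obtain u u' where "u \<in> sp M1 (tail Q a)" "u' \<in> sp M2 (tail Q a)" "w a = u + u'"
          using internal_dsumD(4)[OF dsum t w(1)[OF a]] by metis
        then show ?thesis using A.IH[OF a] by simp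
      qed
      have "mp M a (w a) \<in> sp M2 y" if a: "a \<in> inA y" for a
        using linear_betweenD(1)[OF lfd_repD(4)[OF M2, of a] w2[OF a]] mp2[OF _ w2[OF a]] a by auto
      then have "v \<in> sp M2 y" unfolding w(2) by (intro lfd_rep_sum_closed[OF M2 y])
      then show ?thesis using internal_dsumD(3)[OF dsum y v] by simp
    qed
    then show ?case using lfd_rep_zero[OF M1 y] by auto
  next
    case (B x)
    note xB = \<open>x \<in> B\<close>
    then have x: "x \<in> verts Q" using B_TN TN_verts by blast
    have "v = 0" if v: "v \<in> sp M1 x" for v
    proof (rule prod_injectiveD[OF B_inj[OF xB]])
      show "v \<in> sp M x" using s1(3)[OF x v] .
      fix r assume r: "r \<in> outB x"
      then have b: "r \<in> arcs Q" "tail Q r = x" by auto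
      have v': "v \<in> sp M1 (tail Q r)" using v b by simp
      have "mp M r v \<in> sp M1 (head Q r)"
        using lfd_rep_mp[OF M1 b(1) v'] mp1[OF b(1) v'] by simp
      then show "mp M r v = 0" using B.IH[OF r] by simp
    qed
    then show ?case using lfd_rep_zero[OF M1 x] by auto
  qed
qed

lemma restrict_summand:
  assumes "internal_dsum Q M M1 M2"
  shows "internal_dsum Q (restrict_rep M (Q \<restriction> S)) (restrict_rep M1 (Q \<restriction> S)) (restrict_rep M2 (Q \<restriction> S))"
proof (rule internal_dsumI)
  let ?r = "\<lambda>M. restrict_rep M (Q \<restriction> S)"
  note s1 = subrepD[OF internal_dsumD(1)[OF assms]] and s2 = subrepD[OF internal_dsumD(2)[OF assms]]
  show "lfd_rep Q (?r M)" using lfd by (rule lfd_restrict_rep)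
  show "subrep Q (?r M1) (?r M)"
    using s1(2-4) by (intro subrepI lfd_restrict_rep s1(1)) (auto split: if_splits)
  show "subrep Q (?r M2) (?r M)"
    using s2(2-4) by (intro subrepI lfd_restrict_rep s2(1)) (auto split: if_splits)
  fix x v assume x: "x \<in> verts Q"
  show "v \<in> sp (?r M1) x \<Longrightarrow> v \<in> sp (?r M2) x \<Longrightarrow> v = 0"
    using internal_dsumD(3)[OF assms x] by (simp split: if_splits)
  show "v \<in> sp (?r M) x \<Longrightarrow> \<exists>u w. u \<in> sp (?r M1) x \<and> w \<in> sp (?r M2) x \<and> v = u + w"
    using internal_dsumD(4)[OF assms x] by (cases "x \<in> S") simp_all
qed

text \<open>One summand restricts to zero on \<open>W\<close>, hence vanishes by
  \<open>summand_zero\<close>, and the zero representation is projective.\<close>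

lemma upto_proj_inj_if_indecomposable_W:
  assumes ind: "indecomposable Q MW"
  shows "indecomposable_upto_proj_inj Q M"
  unfolding indecomposable_upto_proj_inj_def
proof (intro allI impI)
  fix M1 M2 assume d: "internal_dsum Q M M1 M2"
  have lfds: "lfd_rep Q M1" "lfd_rep Q M2" using internal_dsumD(1,2)[OF d] by (blast intro: subrepD(1))+
  have z: "zero_rep Q R" if "internal_dsum Q M R R'" "zero_rep Q (restrict_rep R (Q \<restriction> W))" for R R'
  proof (rule summand_zero[OF that(1)])
    fix x assume x: "x \<in> W"
    then have "sp (restrict_rep R (Q \<restriction> W)) x = {0}" using that(2) W_verts unfolding zero_rep_def by blast
    then show "sp R x = {0}" using x by (simp only: restrict_rep_simps if_True)
  qed
  have "zero_rep Q (restrict_rep M1 (Q \<restriction> W)) \<or> zero_rep Q (restrict_rep M2 (Q \<restriction> W))"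
    using ind restrict_summand[OF d, of W] unfolding indecomposable_def by blast
  then have "zero_rep Q M1 \<or> zero_rep Q M2"
    using z[OF d] z[OF internal_dsum_commute[OF lfd d]] by blast
  then show "projective_plus Q M1 \<or> injective_minus Q M1 \<or> projective_plus Q M2 \<or> injective_minus Q M2"
    using zero_rep_projective lfds by blast
qed

text \<open>
  The unique extension to all vertices of a subrepresentation \<open>X\<close> of \<open>M\<^sub>\<Omega>\<close>: generated by \<open>X\<close> on \<open>A\<close> and
  cogenerated by \<open>X\<close> on \<open>B\<close>. The inductive definition suffices for \<open>B\<close> since paths in \<open>TN\<close> end.
\<close>

inductive ext :: "('k, 'a, 'b, 'v) qrep \<Rightarrow> 'a \<Rightarrow> 'v \<Rightarrow> bool" for X where
  on_W: "x \<in> W \<Longrightarrow> v \<in> sp X x \<Longrightarrow> ext X x v"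
| outside: "x \<notin> TL \<union> TN \<Longrightarrow> ext X x 0"
| on_A: "y \<in> A \<Longrightarrow> \<forall>a. a \<in> inA y \<longrightarrow> ext X (tail Q a) (w a) \<Longrightarrow> ext X y (arc_sum M (inA y) w)"
| on_B: "x \<in> B \<Longrightarrow> v \<in> sp M x \<Longrightarrow> \<forall>r. r \<in> outB x \<longrightarrow> ext X (head Q r) (mp M r v) \<Longrightarrow> ext X x v"

section \<open>Extending a decomposition of \<open>MW\<close> to \<open>M\<close>\<close>

lemma ext_W_iff:
  assumes x: "x \<in> W" shows "ext X x v \<longleftrightarrow> v \<in> sp X x"
proof
  assume "ext X x v"
  then show "v \<in> sp X x" by cases (use x in auto)
qed (rule ext.on_W[OF x])

lemma ext_outside:
  assumes "x \<notin> TL \<union> TN" and e: "ext X x v" shows "v = 0"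
  using e by cases (use assms(1) A_TL B_TN in auto)

lemma ext_A:
  assumes y: "y \<in> A" and e: "ext X y v"
  obtains w where "\<And>a. a \<in> inA y \<Longrightarrow> ext X (tail Q a) (w a)" "v = arc_sum M (inA y) w"
  using e
proof cases
  case (on_A w)
  then show ?thesis using that[of w] by blast
qed (use y A_TL A_TN B_TN in auto)

lemma ext_B:
  assumes x: "x \<in> B" and e: "ext X x v"
  shows "v \<in> sp M x" "\<And>r. r \<in> outB x \<Longrightarrow> ext X (head Q r) (mp M r v)"
proof -
  have "v \<in> sp M x \<and> (\<forall>r. r \<in> outB x \<longrightarrow> ext X (head Q r) (mp M r v))"
    using e
  proof cases
    case on_B
    then show ?thesis by blast
  qed (use x A_TL B_TL B_TN in auto)
  then show "v \<in> sp M x" "\<And>r. r \<in> outB x \<Longrightarrow> ext X (head Q r) (mp M r v)" by blast+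
qed

definition ext_rep :: "('k, 'a, 'b, 'v) qrep \<Rightarrow> ('k, 'a, 'b, 'v) qrep" where
  "ext_rep X = \<lparr> scl = scl M, sp = (\<lambda>x. {v. ext X x v}), mp = mp M \<rparr>"

lemma ext_rep_simps [simp]:
  "scl (ext_rep X) = scl M" "v \<in> sp (ext_rep X) x \<longleftrightarrow> ext X x v" "mp (ext_rep X) = mp M"
  by (simp_all add: ext_rep_def)

lemma A_verts: "y \<in> A \<Longrightarrow> y \<in> verts Q" and B_verts: "x \<in> B \<Longrightarrow> x \<in> verts Q"
  using A_TL B_TN TL_verts TN_verts by blast+

text \<open>On \<open>A\<close> the extension is the image of a direct sum of subspaces obtained
  earlier, on \<open>B\<close> an intersection of preimages of such subspaces.\<close>

lemma ext_subspace:
  assumes X: "subrep Q X MW" and x: "x \<in> verts Q"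
  shows "{v. ext X x v} \<subseteq> sp M x \<and> module.subspace (scl M) {v. ext X x v}"
proof -
  interpret vector_space "scl M" using lfd by (rule lfd_repD)
  note sX = subrepD[OF X]
  show ?thesis
    using x
  proof (induction x rule: vert_induct)
    case (W x)
    then have x: "x \<in> verts Q" using W_verts by blast
    have "{v. ext X x v} = sp X x" by (simp add: ext_W_iff[OF W])
    moreover have "sp X x \<subseteq> sp M x" using sX(3)[OF x] W by auto
    moreover have "subspace (sp X x)" using lfd_repD(2)[OF sX(1) x] sX(2) by simp
    ultimately show ?case by simp
  next
    case (outside x)
    then have "{v. ext X x v} = {0}" using ext_outside[of x X] ext.outside[of x X] by blast
    then show ?case using lfd_rep_zero[OF lfd] outside by (simp add: subspace_single_0)
  next
    case (A y)
    note yA = \<open>y \<in> A\<close>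
    note y = A_verts[OF yA]
    have sub: "subspace {v. ext X (tail Q a) v}" and mem: "\<And>v. ext X (tail Q a) v \<Longrightarrow> v \<in> sp M (tail Q a)"
      if "a \<in> inA y" for a using A.IH[OF that] by blast+
    have lin: "linear_between (scl M) (scl M) (sp M (tail Q a)) (sp M y) (mp M a)"
      if "a \<in> inA y" for a using lfd_repD(4)[OF lfd, of a] that by auto
    have "{v. ext X y v} = arc_sums Q (ext_rep X) (inA y)"
    proof (intro set_eqI iffI)
      fix v assume "v \<in> {v. ext X y v}"
      then have v: "ext X y v" by simp
      show "v \<in> arc_sums Q (ext_rep X) (inA y)"
        by (rule ext_A[OF yA v]) (auto simp: arc_sums_def)
    next
      fix v assume "v \<in> arc_sums Q (ext_rep X) (inA y)"
      then obtain w where "\<forall>a\<in>inA y. w a \<in> sp (ext_rep X) (tail Q a)" and v: "v = arc_sum (ext_rep X) (inA y) w"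
        unfolding arc_sums_def by blast
      then have "\<forall>a. a \<in> inA y \<longrightarrow> ext X (tail Q a) (w a)" by simp
      from ext.on_A[OF yA this] show "v \<in> {v. ext X y v}" by (simp add: v)
    qed
    moreover have "linear_between (scl M) (scl M) {v. ext X (tail Q a) v} (sp M y) (mp M a)"
      if "a \<in> inA y" for a
      using lin[OF that] mem[OF that] by (simp add: linear_between_def)
    ultimately show ?case
      using subspace_arc_sums[of "ext_rep X" "inA y" Q "sp M y"] sub lfd_repD(2)[OF lfd y] vector_space_axioms
      by (simp add: ext_rep_def)
  next
    case (B x)
    note xB = \<open>x \<in> B\<close>
    note x = B_verts[OF xB]
    have sub: "subspace {v. ext X (head Q r) v}" if "r \<in> outB x" for r
      using B.IH[OF that] by blast
    have lin: "linear_between (scl M) (scl M) (sp M x) (sp M (head Q r)) (mp M r)"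
      if "r \<in> outB x" for r using lfd_repD(4)[OF lfd, of r] that by auto
    note e = ext_B[OF xB, of X]
    have "subspace {v. ext X x v}"
    proof (rule subspaceI)
      show "0 \<in> {v. ext X x v}"
        using subspace_0[OF sub] lfd_rep_zero[OF lfd x] mp0 by (auto intro!: ext.on_B[OF xB])
    next
      fix u v assume "u \<in> {v. ext X x v}" "v \<in> {v. ext X x v}"
      then have u: "ext X x u" and v: "ext X x v" by auto
      have "ext X (head Q r) (mp M r (u + v))" if r: "r \<in> outB x" for r
        using subspace_add[OF sub[OF r]] e(2)[OF u r] e(2)[OF v r]
          linear_betweenD(2)[OF lin[OF r] e(1)[OF u] e(1)[OF v]] by simp
      then show "u + v \<in> {v. ext X x v}"
        using lfd_rep_add[OF lfd x e(1)[OF u] e(1)[OF v]] by (simp add: ext.on_B[OF xB])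
    next
      fix c u assume "u \<in> {v. ext X x v}"
      then have u: "ext X x u" by simp
      have "ext X (head Q r) (mp M r (scl M c u))" if r: "r \<in> outB x" for r
        using subspace_scale[OF sub[OF r]] e(2)[OF u r]
          linear_betweenD(3)[OF lin[OF r] e(1)[OF u]] by simp
      then show "scl M c u \<in> {v. ext X x v}"
        using lfd_rep_scale[OF lfd x e(1)[OF u]] by (simp add: ext.on_B[OF xB])
    qed
    then show ?case using e(1) by blast
  qed
qed

text \<open>If \<open>mp M a v\<close> is nonzero, both ends lie in the support, and closedness of
  \<open>A\<close> and \<open>B\<close> leaves three cases: the head in \<open>A\<close>, where all
  images of arrows from \<open>TL\<close> were included and \<open>A_zero\<close> excludes other
  arrows; the tail in \<open>B\<close>, where membership is defined by the images; both ends in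
  \<open>W\<close>, where \<open>X\<close> is stable.\<close>

lemma ext_mp:
  assumes X: "subrep Q X MW" and a: "a \<in> arcs Q" and v: "ext X (tail Q a) v"
  shows "ext X (head Q a) (mp M a v)"
proof -
  interpret vector_space "scl M" using lfd by (rule lfd_repD)
  let ?x = "tail Q a" and ?y = "head Q a"
  have ext0: "ext X z 0" if "z \<in> verts Q" for z
    using subspace_0[OF conjunct2[OF ext_subspace[OF X that]]] by simp
  have vM: "v \<in> sp M ?x" using ext_subspace[OF X, of ?x] v a by auto
  have y: "?y \<in> verts Q" using a by simp
  show ?thesis
  proof (cases "mp M a v = 0")
    case True
    then show ?thesis using ext0[OF y] by simp
  next
    case nz: False
    then have x_supp: "?x \<in> TL \<union> TN"
      using ext_outside[OF _ v] mp0[OF a] by blast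
    have y_supp: "?y \<in> TL \<union> TN"
      using sp_zero[OF y] lfd_rep_mp[OF lfd a vM] nz by blast
    consider (A) "?y \<in> A" | (B) "?x \<in> B" "?y \<notin> A" | (W) "?x \<in> W" "?y \<in> W"
      using x_supp y_supp A_closed[OF a] B_closed[OF a] by blast
    then show ?thesis
    proof cases
      case A
      then have "a \<in> inA ?y" using A_zero[OF a A _ vM] nz a by auto
      \<comment> \<open>The family concentrated on \<open>a\<close> exhibits \<open>mp M a v\<close>
        as one of the generated elements.\<close>
      let ?w = "\<lambda>r. if r = a then v else 0"
      have "ext X ?y (\<Sum>r\<in>inA ?y. mp M r (?w r))"
        using v ext0 by (intro ext.on_A[OF A, of _ ?w] allI impI) auto
      moreover have "(\<Sum>r\<in>inA ?y. mp M r (?w r)) = (\<Sum>r\<in>inA ?y. if r = a then mp M a v else 0)"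
        using mp0 by (intro sum.cong) auto
      moreover have "finite (inA ?y)" using finite_in_arcs[of ?y] by (rule rev_finite_subset) blast
      from sum.delta[OF this, of a "\<lambda>_. mp M a v"]
      have "(\<Sum>r\<in>inA ?y. if r = a then mp M a v else 0) = mp M a v"
        by (simp only: \<open>a \<in> inA ?y\<close> if_True)
      ultimately show ?thesis by simp
    next
      case B
      then have "a \<in> outB ?x" using B_zero[OF a B(1) _ vM] nz a by auto
      then show ?thesis using ext_B(2)[OF B(1) v] by blast
    next
      case W
      have vX: "v \<in> sp X ?x" using v ext_W_iff[OF W(1)] by blast
      have "mp X a v = mp M a v" using subrepD(4)[OF X a vX] W a by simp
      moreover have "mp X a v \<in> sp X ?y"
        using linear_betweenD(1)[OF lfd_repD(4)[OF subrepD(1)[OF X] a] vX] .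
      ultimately show ?thesis using ext_W_iff[OF W(2)] by simp
    qed
  qed
qed

lemma subrep_ext_rep:
  assumes X: "subrep Q X MW" shows "subrep Q (ext_rep X) M"
proof (rule subrepI)
  interpret vector_space "scl M" using lfd by (rule lfd_repD)
  note sub = ext_subspace[OF X]
  show "lfd_rep Q (ext_rep X)"
    unfolding lfd_rep_def
  proof (intro conjI ballI)
    show "vector_space (scl (ext_rep X))" by (simp add: vector_space_axioms)
    fix x assume x: "x \<in> verts Q"
    have e: "sp (ext_rep X) x = {v. ext X x v}" by (simp add: ext_rep_def)
    show "module.subspace (scl (ext_rep X)) (sp (ext_rep X) x)" using sub[OF x] by (simp add: e)
    obtain S where S: "finite S" "span S = sp M x" using lfd_repD(3)[OF lfd x] by blast
    show "\<exists>B. finite B \<and> module.span (scl (ext_rep X)) B = sp (ext_rep X) x"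
      using finitely_spanned_subspace[OF _ _ S, of "{v. ext X x v}"] sub[OF x] by (simp add: e)
  next
    fix a assume a: "a \<in> arcs Q"
    have "v \<in> sp M (tail Q a)" if "ext X (tail Q a) v" for v using sub[of "tail Q a"] a that by auto
    then show "linear_between (scl (ext_rep X)) (scl (ext_rep X)) (sp (ext_rep X) (tail Q a))
        (sp (ext_rep X) (head Q a)) (mp (ext_rep X) a)"
      using ext_mp[OF X a] linear_betweenD(2,3)[OF lfd_repD(4)[OF lfd a]] by (simp add: linear_between_def)
  qed
qed (use ext_subspace[OF X] in auto)

text \<open>Bijectivity carries the decomposition from vertex to vertex. On \<open>A\<close> the
  components at the tails add up to components at the head, unique by injectivity; on
  \<open>B\<close> a component is found by prescribing its images along the outgoing arrows.\<close>

lemma internal_dsum_ext_rep: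
  assumes d: "internal_dsum Q MW X Y"
  shows "internal_dsum Q M (ext_rep X) (ext_rep Y)"
proof (rule internal_dsumI[OF lfd])
  note X = internal_dsumD(1)[OF d] and Y = internal_dsumD(2)[OF d]
  show "subrep Q (ext_rep X) M" "subrep Q (ext_rep Y) M" using X Y by (auto intro: subrep_ext_rep)
  have mem: "v \<in> sp M x" if "ext X x v \<or> ext Y x v" "x \<in> verts Q" for x v
    using ext_subspace[OF X that(2)] ext_subspace[OF Y that(2)] that(1) by blast
  fix x assume x: "x \<in> verts Q"
  then have "(\<forall>v. ext X x v \<longrightarrow> ext Y x v \<longrightarrow> v = 0) \<and> (\<forall>v\<in>sp M x. \<exists>u w. ext X x u \<and> ext Y x w \<and> v = u + w)"
  proof (induction x rule: vert_induct)
    case (W x)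
    then have x: "x \<in> verts Q" using W_verts by blast
    show ?case
      using internal_dsumD(3,4)[OF d x] W ext_W_iff[OF W] by simp
  next
    case (outside x)
    then show ?case
      using ext_outside[of x] ext.outside[of x] sp_zero[of x]
      by (intro conjI allI ballI impI exI[of _ 0]) simp_all
  next
    case (A y)
    note yA = \<open>y \<in> A\<close>
    note y = A_verts[OF yA]
    have t: "tail Q a \<in> verts Q" if "a \<in> inA y" for a using that by auto
    have lin: "linear_between (scl M) (scl M) (sp M (tail Q a)) (sp M y) (mp M a)"
      if "a \<in> inA y" for a using lfd_repD(4)[OF lfd, of a] that by auto
    show ?case
    proof (intro conjI allI impI ballI)
      fix v assume vX: "ext X y v" and vY: "ext Y y v"
      show "v = 0"
      proof (rule ext_A[OF yA vX], rule ext_A[OF yA vY])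
        fix w z assume w: "\<And>a. a \<in> inA y \<Longrightarrow> ext X (tail Q a) (w a)" "v = arc_sum M (inA y) w"
          and z: "\<And>a. a \<in> inA y \<Longrightarrow> ext Y (tail Q a) (z a)" "v = arc_sum M (inA y) z"
        have wM: "w a \<in> sp M (tail Q a)" and zM: "z a \<in> sp M (tail Q a)" if "a \<in> inA y" for a
          using mem[OF _ t[OF that]] w(1)[OF that] z(1)[OF that] by blast+
        interpret vector_space "scl M" using lfd by (rule lfd_repD)
        have "mp M a (w a - z a) = mp M a (w a) - mp M a (z a)" if "a \<in> inA y" for a
          using linear_between_diff[OF lin[OF that] lfd_repD(2)[OF lfd t[OF that]] wM[OF that] zM[OF that]] .
        then have "(\<Sum>a\<in>inA y. mp M a (w a - z a)) = (\<Sum>a\<in>inA y. mp M a (w a) - mp M a (z a))"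
          by (intro sum.cong refl) simp
        also have "\<dots> = 0" using w(2) z(2) by (simp add: sum_subtractf)
        finally have 0: "(\<Sum>a\<in>inA y. mp M a (w a - z a)) = 0" .
        \<comment> \<open>Both families represent \<open>v\<close>, so injectivity makes them equal,
          and the common value lies in both extensions at the tail.\<close>
        have "w a = 0" if a: "a \<in> inA y" for a
        proof -
          have "w a - z a = 0"
            by (rule sum_injectiveD[OF A_inj[OF yA] _ 0 a]) (rule lfd_rep_diff[OF lfd t wM zM])
          then have "ext Y (tail Q a) (w a)" using z(1)[OF a] by simp
          then show ?thesis using A.IH[OF a] w(1)[OF a] by blast
        qed
        then show ?thesis unfolding w(2) using mp0 by (intro sum.neutral) auto
      qed
    next
      fix v assume v: "v \<in> sp M y"
      show "\<exists>u w. ext X y u \<and> ext Y y w \<and> v = u + w"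
      proof (rule sum_surjectiveD[OF A_surj[OF yA] v])
        fix m assume m: "\<And>a. a \<in> inA y \<Longrightarrow> m a \<in> sp M (tail Q a)" "v = arc_sum M (inA y) m"
        have "\<forall>a\<in>inA y. \<exists>p. ext X (tail Q a) (fst p) \<and> ext Y (tail Q a) (snd p) \<and> m a = fst p + snd p"
          using A.IH m(1) by fastforce
        from bchoice[OF this] obtain p where p: "\<And>a. a \<in> inA y \<Longrightarrow>
          ext X (tail Q a) (fst (p a)) \<and> ext Y (tail Q a) (snd (p a)) \<and> m a = fst (p a) + snd (p a)"
          by blast
        have "mp M a (m a) = mp M a (fst (p a)) + mp M a (snd (p a))" if a: "a \<in> inA y" for a
          using linear_betweenD(2)[OF lin[OF a]] p[OF a] mem[OF _ t[OF a]] by simp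
        then have "v = (\<Sum>a\<in>inA y. mp M a (fst (p a))) + (\<Sum>a\<in>inA y. mp M a (snd (p a)))"
          unfolding m(2) sum.distrib[symmetric] by (intro sum.cong refl)
        moreover have "ext X y (\<Sum>a\<in>inA y. mp M a (fst (p a)))"
          using p by (intro ext.on_A[OF yA, of _ "\<lambda>a. fst (p a)"]) blast
        moreover have "ext Y y (\<Sum>a\<in>inA y. mp M a (snd (p a)))"
          using p by (intro ext.on_A[OF yA, of _ "\<lambda>a. snd (p a)"]) blast
        ultimately show ?thesis by blast
      qed
    qed
  next
    case (B x)
    note xB = \<open>x \<in> B\<close>
    note x = B_verts[OF xB]
    have h: "head Q r \<in> verts Q" if "r \<in> outB x" for r using that by auto
    have lin: "linear_between (scl M) (scl M) (sp M x) (sp M (head Q r)) (mp M r)"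
      if "r \<in> outB x" for r using lfd_repD(4)[OF lfd, of r] that by auto
    show ?case
    proof (intro conjI allI impI ballI)
      fix v assume vX: "ext X x v" and vY: "ext Y x v"
      have "mp M r v = 0" if r: "r \<in> outB x" for r
        using B.IH[OF r] ext_B(2)[OF xB vX r] ext_B(2)[OF xB vY r] by blast
      then show "v = 0"
        by (rule prod_injectiveD[OF B_inj[OF xB] ext_B(1)[OF xB vX]])
    next
      fix v assume v: "v \<in> sp M x"
      have "\<forall>r\<in>outB x. \<exists>p. ext X (head Q r) (fst p) \<and> ext Y (head Q r) (snd p) \<and> mp M r v = fst p + snd p"
        using B.IH linear_betweenD(1)[OF lin v] by fastforce
      from bchoice[OF this] obtain p where p: "\<And>r. r \<in> outB x \<Longrightarrow>
        ext X (head Q r) (fst (p r)) \<and> ext Y (head Q r) (snd (p r)) \<and> mp M r v = fst (p r) + snd (p r)"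
        by blast
      have pM: "fst (p r) \<in> sp M (head Q r)" if "r \<in> outB x" for r
        using mem[OF _ h[OF that]] p[OF that] by blast
      \<comment> \<open>\<open>u\<close> is chosen so that its images are the
        \<open>X\<close>-components of the images of \<open>v\<close>; the images of
        \<open>v - u\<close> are then the \<open>Y\<close>-components.\<close>
      show "\<exists>u w. ext X x u \<and> ext Y x w \<and> v = u + w"
      proof (rule prod_surjectiveD[OF B_surj[OF xB], of "\<lambda>r. fst (p r)"])
        fix u assume u: "u \<in> sp M x" "\<And>r. r \<in> outB x \<Longrightarrow> mp M r u = fst (p r)"
        interpret vector_space "scl M" using lfd by (rule lfd_repD)
        have "mp M r (v - u) = snd (p r)" if r: "r \<in> outB x" for r
          using linear_between_diff[OF lin[OF r] lfd_repD(2)[OF lfd x] v u(1)] p[OF r] u(2)[OF r] by simp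
        then have "ext Y x (v - u)"
          using p lfd_rep_diff[OF lfd x v u(1)] by (intro ext.on_B[OF xB] allI impI) simp_all
        moreover have "ext X x u"
          using p u by (intro ext.on_B[OF xB] allI impI) simp_all
        ultimately show ?thesis by (intro exI[of _ u] exI[of _ "v - u"]) simp
      qed (rule pM)
    qed
  qed
  then show "v \<in> sp (ext_rep X) x \<Longrightarrow> v \<in> sp (ext_rep Y) x \<Longrightarrow> v = 0"
    "v \<in> sp M x \<Longrightarrow> \<exists>u w. u \<in> sp (ext_rep X) x \<and> w \<in> sp (ext_rep Y) x \<and> v = u + w" for v
    by simp_all
qed

text \<open>A decomposition of \<open>MW\<close> extends to one of \<open>M\<close>, and each
  extension agrees with its summand on \<open>W\<close>; so where the extension is zero, the summand
  is. \<open>MW\<close> is nonzero because \<open>W\<close> is a non-empty part of the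
  support.\<close>

lemma indecomposable_restrict_W:
  assumes ind: "indecomposable Q M"
  shows "indecomposable Q MW"
  unfolding indecomposable_def
proof (intro conjI allI impI)
  obtain x where x: "x \<in> W" using rest by blast
  then have xv: "x \<in> verts Q" using W_verts by blast
  then have "sp M x \<noteq> {0}" using supp_iff x by blast
  moreover have "sp MW x = sp M x"
    unfolding restrict_rep_simps(2) by (rule if_P[OF x])
  ultimately have "sp MW x \<noteq> {0}" by simp
  then show "\<not> zero_rep Q MW" using xv unfolding zero_rep_def by blast
next
  fix X Y assume d: "internal_dsum Q MW X Y"
  have z: "zero_rep Q Z" if Z: "subrep Q Z MW" and 0: "zero_rep Q (ext_rep Z)" for Z
    unfolding zero_rep_def
  proof
    fix x assume x: "x \<in> verts Q"
    show "sp Z x = {0}"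
    proof (cases "x \<in> W")
      case True
      have "sp (ext_rep Z) x = {0}" using 0 x by (simp only: zero_rep_def)
      moreover have "sp (ext_rep Z) x = sp Z x" by (intro set_eqI) (simp add: ext_W_iff[OF True])
      ultimately show ?thesis by simp
    next
      case False
      then have "v = 0" if "v \<in> sp Z x" for v using subrepD(3)[OF Z x that] by (simp split: if_splits)
      then show ?thesis using lfd_rep_zero[OF subrepD(1)[OF Z] x] by blast
    qed
  qed
  have "zero_rep Q (ext_rep X) \<or> zero_rep Q (ext_rep Y)"
    using ind internal_dsum_ext_rep[OF d] unfolding indecomposable_def by blast
  then show "zero_rep Q X \<or> zero_rep Q Y"
    using z[OF internal_dsumD(1)[OF d]] z[OF internal_dsumD(2)[OF d]] by blast
qed

lemma properties: "properties_1_to_4 Q M (Q \<restriction> A) (Q \<restriction> B)"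
proof -
  have W: "supp Q M \<restriction> (verts (supp Q M) - (verts (Q \<restriction> A) \<union> verts (Q \<restriction> B))) = Q \<restriction> W"
    unfolding supp_eq by (simp add: induce_induce_subgraph)
  have "verts (Q \<restriction> W) \<noteq> {}" using rest by simp
  then show ?thesis
    unfolding properties_1_to_4_def Let_def W
    using top_finite_A successor_closed_A projective_restrict_A socle_finite_B predecessor_closed_B
      injective_restrict_B fin_digraph_W indecomposable_restrict_W upto_proj_inj_if_indecomposable_W
    by blast
qed

end

section \<open>Finite extensions\<close>

lemma (in split_rep) split_rep_cofinite:
  assumes "A' \<subseteq> A" "B' \<subseteq> B" "finite (A - A')" "finite (B - B')"
    and "\<And>a. a \<in> arcs Q \<Longrightarrow> tail Q a \<in> A' \<Longrightarrow> head Q a \<in> A'"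
    and "\<And>a. a \<in> arcs Q \<Longrightarrow> head Q a \<in> B' \<Longrightarrow> tail Q a \<in> B'"
  shows "split_rep Q M TL TN A' B'"
proof -
  have "TL - A' \<subseteq> (TL - A) \<union> (A - A')" "TN - B' \<subseteq> (TN - B) \<union> (B - B')" by blast+
  then have fin: "finite (TL - A')" "finite (TN - B')"
    using assms(3,4) fin_A fin_B by (meson finite_UnI finite_subset)+
  have A: "x \<in> A' \<Longrightarrow> x \<in> A" and B: "x \<in> B' \<Longrightarrow> x \<in> B" for x using assms(1,2) by blast+
  have sets: "A' \<subseteq> TL" "B' \<subseteq> TN" "A' \<inter> TN = {}" "B' \<inter> TL = {}" "TL \<union> TN - (A' \<union> B') \<noteq> {}"
    using assms(1,2) A_TL B_TN A_TN B_TL rest by blast+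
  show ?thesis
  proof
    show "mp M a v = 0" if "a \<in> arcs Q" "head Q a \<in> A'" "tail Q a \<notin> TL" "v \<in> sp M (tail Q a)" for a v
      using A_zero[OF that(1) A[OF that(2)] that(3,4)] .
    show "mp M a v = 0" if "a \<in> arcs Q" "tail Q a \<in> B'" "head Q a \<notin> TN" "v \<in> sp M (tail Q a)" for a v
      using B_zero[OF that(1) B[OF that(2)] that(3,4)] .
  qed (fact lfd TL_verts TN_verts supp_iff wf_TL wf_TN sets fin assms(5,6) A_inj[OF A] A_surj[OF A]
    B_inj[OF B] B_surj[OF B])+
qed

section \<open>Construction of \<open>A\<close> and \<open>B\<close> from a finite extension\<close>

context slf_quiver
begin

lemma short_exact_vertex:
  assumes ex: "short_exact Q L M N f g" and L: "lfd_rep Q L" and N: "lfd_rep Q N" and M: "lfd_rep Q M"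
    and x: "x \<in> verts Q"
  shows "l \<in> sp L x \<Longrightarrow> f x l \<in> sp M x"
    and "l \<in> sp L x \<Longrightarrow> f x l = 0 \<Longrightarrow> l = 0"
    and "f x 0 = 0" "g x 0 = 0"
    and "v \<in> sp M x \<Longrightarrow> g x v \<in> sp N x"
    and "n \<in> sp N x \<Longrightarrow> \<exists>v\<in>sp M x. g x v = n"
    and "v \<in> sp M x \<Longrightarrow> g x v = 0 \<Longrightarrow> \<exists>l\<in>sp L x. f x l = v"
proof -
  have f: "rep_hom Q L M f" and g: "rep_hom Q M N g" and inj: "inj_on (f x) (sp L x)"
    and onto: "g x ` sp M x = sp N x" and exact: "f x ` sp L x = {v \<in> sp M x. g x v = 0}"
    using ex x unfolding short_exact_def rep_mono_def rep_epi_def by blast+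
  show f0: "f x 0 = 0" using linear_between_zero[OF rep_homD(1)[OF f x] lfd_rep_zero[OF L x]] .
  show "g x 0 = 0" using linear_between_zero[OF rep_homD(1)[OF g x] lfd_rep_zero[OF M x]] .
  show "l \<in> sp L x \<Longrightarrow> f x l \<in> sp M x" using linear_betweenD(1)[OF rep_homD(1)[OF f x]] .
  show "v \<in> sp M x \<Longrightarrow> g x v \<in> sp N x" using linear_betweenD(1)[OF rep_homD(1)[OF g x]] .
  show "l \<in> sp L x \<Longrightarrow> f x l = 0 \<Longrightarrow> l = 0"
    using inj_onD[OF inj, of l 0] f0 lfd_rep_zero[OF L x] by simp
  show "n \<in> sp N x \<Longrightarrow> \<exists>v\<in>sp M x. g x v = n" unfolding onto[symmetric] by (auto simp: image_iff)
  show "v \<in> sp M x \<Longrightarrow> g x v = 0 \<Longrightarrow> \<exists>l\<in>sp L x. f x l = v" by (rule exact_at(3)[OF exact])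
qed

lemma exists_split_rep:
  fixes M :: "('k::field, 'a, 'b, 'v::ab_group_add) qrep"
  assumes bar: "rep_bar Q M" and nz: "\<not> zero_rep Q M"
  obtains TL TN A B where "split_rep Q M TL TN A B"
proof -
  obtain L N :: "('k, 'a, 'b) std_rep" and f g where
    Lp: "rep_plus Q L" and Nm: "rep_minus Q N" and M: "lfd_rep Q M" and ex: "short_exact Q L M N f g"
    and fin: "finite {a \<in> arcs Q. supports_rep Q a M \<and> \<not> supports_rep Q a (dsum L N)}"
    using bar unfolding rep_bar_def finite_extension_rep_def by blast
  have L: "lfd_rep Q L" and N: "lfd_rep Q N" using Lp Nm by (auto simp: rep_plus_def rep_minus_def)
  have f: "rep_hom Q L M f" and g: "rep_hom Q M N g"
    using ex by (auto simp: short_exact_def rep_mono_def rep_epi_def)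
  note V = short_exact_vertex[OF ex L N M]
  define E where "E = {a \<in> arcs Q. supports_rep Q a M \<and> \<not> supports_rep Q a (dsum L N)}"
  define TL where "TL = {x \<in> verts Q. sp L x \<noteq> {0}}"
  define TN where "TN = {x \<in> verts Q. sp N x \<noteq> {0}}"
  obtain FL where FL: "finite FL" "FL \<subseteq> verts Q"
    "\<And>x. x \<in> verts Q - FL \<Longrightarrow> sum_injective Q L (in_arcs Q x) \<and> sum_surjective Q L (in_arcs Q x) x"
    "\<And>x. x \<in> verts Q \<Longrightarrow> sp L x \<noteq> {0} \<Longrightarrow> \<exists>g\<in>FL. paths Q g x \<noteq> {}"
    using rep_plus_local[OF Lp] by metis
  obtain FN where FN: "finite FN" "FN \<subseteq> verts Q"
    "\<And>x. x \<in> verts Q - FN \<Longrightarrow> prod_injective Q N (out_arcs Q x) x \<and> prod_surjective Q N (out_arcs Q x) x"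
    "\<And>x. x \<in> verts Q \<Longrightarrow> sp N x \<noteq> {0} \<Longrightarrow> \<exists>g\<in>FN. paths Q x g \<noteq> {}"
    using rep_minus_local[OF Nm] by metis
  have TLr: "\<exists>g\<in>FL. paths Q g x \<noteq> {}" if "x \<in> TL" for x using FL(4) that by (simp add: TL_def)
  have TNr: "\<exists>g\<in>FN. paths Q x g \<noteq> {}" if "x \<in> TN" for x using FN(4) that by (simp add: TN_def)
  obtain x0 where x0: "x0 \<in> verts Q" "sp M x0 \<noteq> {0}" using nz by (auto simp: zero_rep_def)
  define I where "I = TL \<inter> TN"
  \<comment> \<open>A common vertex of the supports is reached from \<open>FL\<close> and reaches
    \<open>FN\<close>.\<close>
  have "I \<subseteq> between FL FN" using TLr TNr by (auto simp: I_def between_def)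
  then have finI: "finite I" using finite_between[OF FL(1) FN(1)] finite_subset by blast
  \<comment> \<open>With \<open>FL\<close> and \<open>FN\<close> in \<open>F\<close>, the arrow maps
    of \<open>L\<close> and \<open>N\<close> are bijective off \<open>F\<close>. The neighbours of
    \<open>I\<close> keep the arrows from \<open>TL\<close> into \<open>A\<close>, and those from
    \<open>B\<close> into \<open>TN\<close>, away from \<open>I\<close>. The ends of
    \<open>E\<close> make arrows into \<open>A\<close> and out of \<open>B\<close> unexceptional,
    and \<open>x0\<close> remains in \<open>W\<close>, which is thus non-empty.\<close>
  define F where "F = FL \<union> FN \<union> I \<union> (\<Union>x\<in>I. head Q ` out_arcs Q x) \<union> (\<Union>x\<in>I. tail Q ` in_arcs Q x)
      \<union> tail Q ` E \<union> head Q ` E \<union> {x0}"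
  have finF: "finite F"
    unfolding F_def using FL(1) FN(1) finI fin E_def
    by (intro finite_UnI finite_UN_I finite_imageI finite_in_arcs finite_out_arcs) auto
  define A where "A = {x \<in> TL. \<forall>z\<in>F. paths Q x z = {}}"
  define B where "B = {x \<in> TN. \<forall>z\<in>F. paths Q z x = {}}"
  have A: "x \<in> verts Q" "x \<in> TL" "x \<notin> F" "x \<notin> TN" if "x \<in> A" for x
  proof -
    show v: "x \<in> verts Q" and t: "x \<in> TL" using that by (auto simp: A_def TL_def)
    have "[] \<in> paths Q x x" using v by (simp add: Nil_in_paths_iff)
    then show nF: "x \<notin> F" using that by (auto simp: A_def)
    then show "x \<notin> TN" using t by (auto simp: F_def I_def)
  qed
  have B: "x \<in> verts Q" "x \<in> TN" "x \<notin> F" "x \<notin> TL" if "x \<in> B" for x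
  proof -
    show v: "x \<in> verts Q" and t: "x \<in> TN" using that by (auto simp: B_def TN_def)
    have "[] \<in> paths Q x x" using v by (simp add: Nil_in_paths_iff)
    then show nF: "x \<notin> F" using that by (auto simp: B_def)
    then show "x \<notin> TL" using t by (auto simp: F_def I_def)
  qed
  have L0: "sp L x = {0}" if "x \<in> verts Q" "x \<notin> TL" for x using that by (simp add: TL_def)
  have N0: "sp N x = {0}" if "x \<in> verts Q" "x \<notin> TN" for x using that by (simp add: TN_def)
  \<comment> \<open>Off the support of \<open>N\<close>, \<open>M\<close> is the image of
    \<open>L\<close>; off the support of \<open>L\<close>, \<open>g\<close> is injective on
    \<open>M\<close>. These two facts transfer the local structure to \<open>M\<close>.\<close>
  have from_L: "\<exists>l\<in>sp L x. f x l = v" if "x \<in> verts Q" "x \<notin> TN" "v \<in> sp M x" for x v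
    using V(7)[OF that(1,3)] V(5)[OF that(1,3)] N0[OF that(1,2)] by simp
  have g_inj: "v = 0" if "x \<in> verts Q" "x \<notin> TL" "v \<in> sp M x" "g x v = 0" for x v
    using V(7)[OF that(1,3,4)] L0[OF that(1,2)] V(3)[OF that(1)] by auto
  have supp: "sp M x \<noteq> {0} \<longleftrightarrow> x \<in> TL \<union> TN" if x: "x \<in> verts Q" for x
  proof
    assume "sp M x \<noteq> {0}"
    then obtain v where v: "v \<in> sp M x" "v \<noteq> 0" using lfd_rep_nonzero[OF M x] by blast
    show "x \<in> TL \<union> TN"
    proof (rule ccontr)
      assume n: "x \<notin> TL \<union> TN"
      then have "g x v = 0" using V(5)[OF x v(1)] N0[OF x] by simp
      then show False using g_inj[OF x _ v(1)] n v(2) by blast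
    qed
  next
    assume "x \<in> TL \<union> TN"
    then consider "x \<in> TL" | "x \<in> TN" by blast
    then show "sp M x \<noteq> {0}"
    proof cases
      case 1
      then have "sp L x \<noteq> {0}" unfolding TL_def by blast
      then obtain l where "l \<in> sp L x" "l \<noteq> 0" using lfd_rep_nonzero[OF L x] by blast
      then have "f x l \<in> sp M x" "f x l \<noteq> 0" using V(1,2)[OF x] by blast+
      then show ?thesis by auto
    next
      case 2
      then have "sp N x \<noteq> {0}" unfolding TN_def by blast
      then obtain n where n: "n \<in> sp N x" "n \<noteq> 0" using lfd_rep_nonzero[OF N x] by blast
      then obtain v where "v \<in> sp M x" "g x v = n" using V(6)[OF x] by blast
      then show ?thesis using n(2) V(4)[OF x] by auto
    qed
  qed
  have notE: "a \<notin> E" if "a \<in> arcs Q" "head Q a \<in> A \<or> tail Q a \<in> B" for a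
    using that A(3) B(3) by (auto simp: F_def)
  have TL_I: "x \<in> TL" if "x \<in> verts Q" "l \<in> sp L x" "l \<noteq> 0" for x l
    using that by (auto simp: TL_def)
  have TN_I: "x \<in> TN" if "x \<in> verts Q" "n \<in> sp N x" "n \<noteq> 0" for x n
    using that by (auto simp: TN_def)
  \<comment> \<open>Such an arrow acts as zero on \<open>L\<close> and on \<open>N\<close>, each
    being zero at one of its ends; outside \<open>E\<close> it then cannot support
    \<open>M\<close>.\<close>
  have vanish: "mp M a v = 0"
    if a: "a \<in> arcs Q" "a \<notin> E" and v: "v \<in> sp M (tail Q a)"
      and nTL: "tail Q a \<notin> TL \<or> head Q a \<notin> TL" and nTN: "tail Q a \<notin> TN \<or> head Q a \<notin> TN" for a v
  proof (rule ccontr)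
    assume "mp M a v \<noteq> 0"
    then have "supports_rep Q a M" using v by (auto simp: supports_rep_def)
    then have "supports_rep Q a (dsum L N)" using a by (auto simp: E_def)
    then consider l where "l \<in> sp L (tail Q a)" "mp L a l \<noteq> 0" | n where "n \<in> sp N (tail Q a)" "mp N a n \<noteq> 0"
      by (auto simp: supports_rep_def dsum_def zero_prod_def)
    then show False
    proof cases
      case 1
      have "l \<noteq> 0" using 1(2) mp_0[OF L a(1)] by metis
      then show False
        using nTL TL_I[OF _ 1(1)] TL_I[OF _ lfd_rep_mp[OF L a(1) 1(1)] 1(2)] a(1) by simp
    next
      case 2
      have "n \<noteq> 0" using 2(2) mp_0[OF N a(1)] by metis
      then show False
        using nTN TN_I[OF _ 2(1)] TN_I[OF _ lfd_rep_mp[OF N a(1) 2(1)] 2(2)] a(1) by simp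
    qed
  qed
  \<comment> \<open>At such a tail \<open>M\<close> is the image of \<open>L\<close>. This is why
    the heads of arrows starting in \<open>I\<close> were put into \<open>F\<close>.\<close>
  have A_tail: "tail Q a \<notin> TN" if "a \<in> arcs Q" "head Q a \<in> A" "tail Q a \<in> TL" for a
  proof
    assume "tail Q a \<in> TN"
    then have "tail Q a \<in> I" "a \<in> out_arcs Q (tail Q a)" using that by (auto simp: I_def)
    then have "head Q a \<in> F" unfolding F_def by blast
    then show False using A(3)[OF that(2)] by simp
  qed
  have B_head: "head Q a \<notin> TL" if "a \<in> arcs Q" "tail Q a \<in> B" "head Q a \<in> TN" for a
  proof
    assume "head Q a \<in> TL"
    then have "head Q a \<in> I" "a \<in> in_arcs Q (head Q a)" using that by (auto simp: I_def)
    then have "tail Q a \<in> F" unfolding F_def by blast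
    then show False using B(3)[OF that(2)] by simp
  qed
  have Linj: "sum_injective Q L (in_arcs Q y)" and Lsurj: "sum_surjective Q L (in_arcs Q y) y"
    if "y \<in> verts Q" "y \<notin> F" for y using FL(3)[of y] that by (auto simp: F_def)
  have Ninj: "prod_injective Q N (out_arcs Q x) x" and Nsurj: "prod_surjective Q N (out_arcs Q x) x"
    if "x \<in> verts Q" "x \<notin> F" for x using FN(3)[of x] that by (auto simp: F_def)
  let ?in = "\<lambda>y. {a \<in> in_arcs Q y. tail Q a \<in> TL}" and ?out = "\<lambda>x. {r \<in> out_arcs Q x. head Q r \<in> TN}"
  \<comment> \<open>\<open>L\<close> vanishes at tails outside \<open>TL\<close>, so under
    \<open>f\<close> the sum over all incoming arrows becomes one over the arrows from
    \<open>TL\<close>.\<close>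
  have fsum: "f y (arc_sum L (in_arcs Q y) l) = (\<Sum>a\<in>?in y. mp M a (f (tail Q a) (l a)))"
    if y: "y \<in> verts Q" and l: "\<And>a. a \<in> in_arcs Q y \<Longrightarrow> l a \<in> sp L (tail Q a)" for y l
  proof -
    have "f y (arc_sum L (in_arcs Q y) l) = (\<Sum>a\<in>in_arcs Q y. mp M a (f (tail Q a) (l a)))"
    proof (rule rep_hom_sum[OF f y])
      show "mp L a (l a) \<in> sp L y" if "a \<in> in_arcs Q y" for a
        using linear_betweenD(1)[OF lfd_repD(4)[OF L, of a] l] that by auto
    qed (use l lfd_rep_zero[OF L y] lfd_rep_add[OF L y] in auto)
    also have "\<dots> = (\<Sum>a\<in>?in y. mp M a (f (tail Q a) (l a)))"
    proof (rule sum.mono_neutral_right[OF finite_in_arcs])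
      show "\<forall>a\<in>in_arcs Q y - ?in y. mp M a (f (tail Q a) (l a)) = 0"
      proof
        fix a assume a: "a \<in> in_arcs Q y - ?in y"
        then have t: "tail Q a \<in> verts Q" "a \<in> arcs Q" by auto
        have "l a = 0" using l[of a] a L0[OF t(1)] by auto
        then show "mp M a (f (tail Q a) (l a)) = 0"
          using V(3)[OF t(1)] mp_0[OF M t(2)] by simp
      qed
    qed blast
    finally show ?thesis .
  qed
  have "split_rep Q M TL TN A B"
  proof
    show "lfd_rep Q M" by (rule M)
    show "TL \<subseteq> verts Q" "TN \<subseteq> verts Q" by (auto simp: TL_def TN_def)
    show "sp M x \<noteq> {0} \<longleftrightarrow> x \<in> TL \<union> TN" if "x \<in> verts Q" for x by (rule supp[OF that])
    show "wf (pred_rel Q (\<lambda>x. x \<in> TL))"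
      by (rule wf_arcs_from[OF FL(1) TLr])
    show "wf (succ_rel Q (\<lambda>x. x \<in> TN))"
      by (rule wf_arcs_to[OF FN(1) TNr])
    show "A \<subseteq> TL" "B \<subseteq> TN" by (auto simp: A_def B_def)
    show "A \<inter> TN = {}" "B \<inter> TL = {}" using A(4) B(4) by blast+
    \<comment> \<open>A vertex of \<open>TL\<close> outside \<open>A\<close> is reached from
      \<open>FL\<close> and reaches \<open>F\<close>.\<close>
    have "TL - A \<subseteq> between FL F" using TLr by (auto simp: A_def between_def)
    then show "finite (TL - A)" using finite_between[OF FL(1) finF] finite_subset by blast
    have "TN - B \<subseteq> between F FN" using TNr by (auto simp: B_def between_def)
    then show "finite (TN - B)" using finite_between[OF finF FN(1)] finite_subset by blast
    have "x0 \<in> F" by (simp add: F_def)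
    then have "x0 \<notin> A \<union> B" using A(3) B(3) by blast
    then show "TL \<union> TN - (A \<union> B) \<noteq> {}" using supp[OF x0(1)] x0(2) by blast
  next
    fix a assume a: "a \<in> arcs Q" and t: "tail Q a \<in> A"
    have h: "head Q a \<in> verts Q" using a by simp
    have no: "paths Q (head Q a) z = {}" if "z \<in> F" for z
      using append_in_paths[OF arc_in_paths[OF a]] t that by (fastforce simp: A_def)
    moreover have "[] \<in> paths Q (head Q a) (head Q a)" using h by (simp add: Nil_in_paths_iff)
    ultimately have hF: "head Q a \<notin> F" by blast
    obtain l where l: "l \<in> sp L (tail Q a)" "l \<noteq> 0"
      using lfd_rep_nonzero[OF L A(1)[OF t]] A(2)[OF t] unfolding TL_def by blast
    \<comment> \<open>The head is off \<open>F\<close>, so the incoming map of \<open>L\<close>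
      there is injective and the support of \<open>L\<close> continues along
      \<open>a\<close>.\<close>
    have "mp L a l \<noteq> 0" using a by (intro sum_injective_mp[OF L Linj[OF h hF] _ l]) simp
    moreover have "mp L a l \<in> sp L (head Q a)"
      using lfd_rep_mp[OF L a l(1)] .
    ultimately have "head Q a \<in> TL" using h by (auto simp: TL_def)
    then show "head Q a \<in> A" using no by (simp add: A_def)
  next
    fix a assume a: "a \<in> arcs Q" and h: "head Q a \<in> B"
    have t: "tail Q a \<in> verts Q" using a by simp
    have no: "paths Q z (tail Q a) = {}" if "z \<in> F" for z
      using append_in_paths[OF _ arc_in_paths[OF a]] h that by (fastforce simp: B_def)
    moreover have "[] \<in> paths Q (tail Q a) (tail Q a)" using t by (simp add: Nil_in_paths_iff)
    ultimately have tF: "tail Q a \<notin> F" by blast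
    obtain n where n: "n \<in> sp N (head Q a)" "n \<noteq> 0"
      using lfd_rep_nonzero[OF N B(1)[OF h]] B(2)[OF h] unfolding TN_def by blast
    \<comment> \<open>The tail is off \<open>F\<close>, so the family concentrated on
      \<open>a\<close> can be realised by a vector there, and the support of \<open>N\<close>
      continues backwards.\<close>
    have w: "(if r = a then n else 0) \<in> sp N (head Q r)" if "r \<in> out_arcs Q (tail Q a)" for r
      using that n lfd_rep_zero[OF N] by auto
    have "\<exists>v\<in>sp N (tail Q a). mp N a v = n"
    proof (rule prod_surjectiveD[OF Nsurj[OF t tF] w], assumption)
      fix v assume "v \<in> sp N (tail Q a)"
        "\<And>r. r \<in> out_arcs Q (tail Q a) \<Longrightarrow> mp N r v = (if r = a then n else 0)"
      then show ?thesis using a by (intro bexI[of _ v]) simp_all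
    qed
    then obtain v where v: "v \<in> sp N (tail Q a)" "mp N a v = n" by (rule bexE)
    have "sp N (tail Q a) \<noteq> {0}"
    proof
      assume "sp N (tail Q a) = {0}"
      then have "v = 0" using v(1) by simp
      then show False using v(2) n(2) mp_0[OF N a] by simp
    qed
    then show "tail Q a \<in> B" using no t by (simp add: B_def TN_def)
  next
    show "mp M a v = 0" if "a \<in> arcs Q" "head Q a \<in> A" "tail Q a \<notin> TL" "v \<in> sp M (tail Q a)" for a v
      by (rule vanish[OF that(1) _ that(4)]) (use that notE[of a] A(4)[of "head Q a"] in simp_all)
    show "mp M a v = 0" if "a \<in> arcs Q" "tail Q a \<in> B" "head Q a \<notin> TN" "v \<in> sp M (tail Q a)" for a v
      by (rule vanish[OF that(1) _ that(4)]) (use that notE[of a] B(4)[of "tail Q a"] in simp_all)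
  next
    fix y assume y: "y \<in> A"
    show "sum_injective Q M (?in y)"
      unfolding sum_injective_def
    proof (intro allI impI ballI)
      fix w a assume w: "\<forall>a\<in>?in y. w a \<in> sp M (tail Q a)"
        and 0: "arc_sum M (?in y) w = 0" and a: "a \<in> ?in y"
      have "\<forall>a\<in>?in y. \<exists>l. l \<in> sp L (tail Q a) \<and> f (tail Q a) l = w a"
      proof
        fix a assume a: "a \<in> ?in y"
        then have "tail Q a \<notin> TN" using A_tail[of a] y by auto
        then have "\<exists>l\<in>sp L (tail Q a). f (tail Q a) l = w a"
          using bspec[OF w a] a by (intro from_L) auto
        then show "\<exists>l. l \<in> sp L (tail Q a) \<and> f (tail Q a) l = w a" by blast
      qed
      from bchoice[OF this] obtain l where
        l: "\<And>a. a \<in> ?in y \<Longrightarrow> l a \<in> sp L (tail Q a) \<and> f (tail Q a) (l a) = w a" by blast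
      \<comment> \<open>Lifts were chosen for the arrows from \<open>TL\<close>; at all other tails
        \<open>L\<close> is zero.\<close>
      let ?l = "\<lambda>a. if tail Q a \<in> TL then l a else 0"
      have lL: "?l a \<in> sp L (tail Q a)" if "a \<in> in_arcs Q y" for a
        using l[of a] that lfd_rep_zero[OF L, of "tail Q a"] by auto
      have "f y (arc_sum L (in_arcs Q y) ?l) = (\<Sum>a\<in>?in y. mp M a (f (tail Q a) (?l a)))"
        by (rule fsum[OF A(1)[OF y] lL])
      also have "\<dots> = arc_sum M (?in y) w" using l by (intro sum.cong) auto
      finally have "f y (arc_sum L (in_arcs Q y) ?l) = 0" using 0 by simp
      moreover have "arc_sum L (in_arcs Q y) ?l \<in> sp L y"
      proof (rule lfd_rep_sum_closed[OF L A(1)[OF y]])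
        show "mp L a (?l a) \<in> sp L y" if "a \<in> in_arcs Q y" for a
          using linear_betweenD(1)[OF lfd_repD(4)[OF L, of a] lL] that by auto
      qed
      ultimately have s0: "arc_sum L (in_arcs Q y) ?l = 0" using V(2)[OF A(1)[OF y]] by blast
      have "?l a = 0"
        by (rule sum_injectiveD[OF Linj[OF A(1,3)[OF y]], of ?l a]) (use s0 lL a in auto)
      then have "l a = 0" using a by simp
      then have "w a = f (tail Q a) 0" using l[OF a] by simp
      then show "w a = 0" using V(3)[of "tail Q a"] a by simp
    qed
    show "sum_surjective Q M (?in y) y"
      unfolding sum_surjective_def
    proof
      fix v assume "v \<in> sp M y"
      then obtain l where l: "l \<in> sp L y" "f y l = v" using from_L[OF A(1,4)[OF y]] by blast
      show "\<exists>w. (\<forall>a\<in>?in y. w a \<in> sp M (tail Q a)) \<and> v = arc_sum M (?in y) w"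
      proof (rule sum_surjectiveD[OF Lsurj[OF A(1,3)[OF y]] l(1)])
        fix w assume w: "\<And>a. a \<in> in_arcs Q y \<Longrightarrow> w a \<in> sp L (tail Q a)" "l = arc_sum L (in_arcs Q y) w"
        have "v = (\<Sum>a\<in>?in y. mp M a (f (tail Q a) (w a)))"
          using fsum[OF A(1)[OF y] w(1)] w(2) l(2) by simp
        moreover have "f (tail Q a) (w a) \<in> sp M (tail Q a)" if "a \<in> ?in y" for a
          using V(1)[of "tail Q a"] w(1)[of a] that by auto
        ultimately show ?thesis by (intro exI[of _ "\<lambda>a. f (tail Q a) (w a)"] conjI ballI)
      qed
    qed
  next
    fix x assume x: "x \<in> B"
    have gmp: "g (head Q r) (mp M r v) = mp N r (g x v)" if "r \<in> out_arcs Q x" "v \<in> sp M x" for r v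
      using rep_homD(2)[OF g, of r v] that by auto
    have Mmp: "mp M r v \<in> sp M (head Q r)" if "r \<in> out_arcs Q x" "v \<in> sp M x" for r v
      using lfd_rep_mp[OF M, of r] that by auto
    show "prod_injective Q M (?out x) x"
      unfolding prod_injective_def
    proof (intro ballI impI)
      fix v assume v: "v \<in> sp M x" and 0: "\<forall>r\<in>?out x. mp M r v = 0"
      have "mp N r (g x v) = 0" if r: "r \<in> out_arcs Q x" for r
      proof (cases "head Q r \<in> TN")
        case True
        then have "mp M r v = 0" using 0 r by blast
        then show ?thesis using gmp[OF r v] V(4)[of "head Q r"] r by simp
      next
        case False
        have h: "head Q r \<in> verts Q" using r by auto
        show ?thesis using V(5)[OF h Mmp[OF r v]] gmp[OF r v] N0[OF h False] by simp
      qed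
      then have "g x v = 0"
        by (rule prod_injectiveD[OF Ninj[OF B(1,3)[OF x]] V(5)[OF B(1)[OF x] v]])
      then show "v = 0" by (rule g_inj[OF B(1,4)[OF x] v])
    qed
    show "prod_surjective Q M (?out x) x"
      unfolding prod_surjective_def
    proof (intro allI impI)
      fix w assume w: "\<forall>r\<in>?out x. w r \<in> sp M (head Q r)"
      \<comment> \<open>At heads outside \<open>TN\<close> the space of \<open>N\<close> is zero, so
        0 is the only possible value.\<close>
      let ?n = "\<lambda>r. if head Q r \<in> TN then g (head Q r) (w r) else 0"
      have n: "?n r \<in> sp N (head Q r)" if r: "r \<in> out_arcs Q x" for r
        using w r V(5)[of "head Q r" "w r"] lfd_rep_zero[OF N, of "head Q r"] by auto
      show "\<exists>v\<in>sp M x. \<forall>r\<in>?out x. mp M r v = w r"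
      proof (rule prod_surjectiveD[OF Nsurj[OF B(1,3)[OF x]], of ?n])
        fix u assume u: "u \<in> sp N x" "\<And>r. r \<in> out_arcs Q x \<Longrightarrow> mp N r u = ?n r"
        obtain v where v: "v \<in> sp M x" "g x v = u" using V(6)[OF B(1)[OF x] u(1)] by blast
        have "mp M r v = w r" if b: "r \<in> ?out x" for r
        proof -
          have r: "r \<in> out_arcs Q x" and bN: "head Q r \<in> TN" and h: "head Q r \<in> verts Q" using b by auto
          have wM: "w r \<in> sp M (head Q r)" using w b by blast
          note lin = rep_homD(1)[OF g h] and sub = lfd_repD(2)[OF M h]
          interpret vector_space "scl M" using M by (rule lfd_repD)
          have "g (head Q r) (mp M r v - w r) = 0"
            using linear_between_diff[OF lin sub Mmp[OF r v(1)] wM] gmp[OF r v(1)] v(2) u(2)[OF r] bN by simp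
          \<comment> \<open>So \<open>g\<close> is injective at the head, and agreement after
            applying \<open>g\<close> suffices.\<close>
          moreover have "head Q r \<notin> TL" using B_head[of r] r x bN by auto
          ultimately have "mp M r v - w r = 0"
            using g_inj[OF h] lfd_rep_diff[OF M h Mmp[OF r v(1)] wM] by blast
          then show ?thesis by simp
        qed
        then show ?thesis using v(1) by blast
      qed (rule n)
    qed
  qed
  then show ?thesis by (rule that)
qed

end

theorem proposition3p6:
  fixes Q :: "('a, 'b) pre_digraph"
    and M :: "('k::field, 'a, 'b, 'v::ab_group_add) qrep"
  assumes "strongly_locally_finite Q"
    and "rep_bar Q M"
    and "\<not> zero_rep Q M"
  shows "\<exists>SP SI. induced_subgraph SP (supp Q M) \<and> induced_subgraph SI (supp Q M) \<and>
           properties_1_to_4 Q M SP SI \<and>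
           (\<forall>SP' SI'.
              cofinite_in SP' SP \<and> successor_closed_in SP' SP \<and>
              cofinite_in SI' SI \<and> predecessor_closed_in SI' SI \<longrightarrow>
              properties_1_to_4 Q M SP' SI')"
proof -
  interpret slf_quiver Q using assms(1) by unfold_locales
  obtain TL TN A B where "split_rep Q M TL TN A B" using exists_split_rep[OF assms(2,3)] .
  then interpret split_rep Q M TL TN A B .
  \<comment> \<open>An induced subquiver is determined by its vertices, so \<open>SP'\<close> and
    \<open>SI'\<close> may be replaced by vertex sets.\<close>
  have induced_eq: "S' = Q \<restriction> verts S' \<and> verts S' \<subseteq> S" if "induced_subgraph S' (Q \<restriction> S)" for S S'
  proof -
    have sub: "verts S' \<subseteq> S" "tail S' = tail Q" "head S' = head Q"
      "arcs S' = {e \<in> arcs (Q \<restriction> S). tail Q e \<in> verts S' \<and> head Q e \<in> verts S'}"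
      using that by (auto simp: induced_subgraph_def subgraph_def compatible_def)
    then show ?thesis by (auto intro!: pre_digraph.equality simp: induce_subgraph_def)
  qed
  have "properties_1_to_4 Q M SP' SI'"
    if c: "cofinite_in SP' (Q \<restriction> A)" "successor_closed_in SP' (Q \<restriction> A)"
      "cofinite_in SI' (Q \<restriction> B)" "predecessor_closed_in SI' (Q \<restriction> B)" for SP' SI'
  proof -
    have i: "induced_subgraph SP' (Q \<restriction> A)" "induced_subgraph SI' (Q \<restriction> B)"
      "finite (A - verts SP')" "finite (B - verts SI')" using c(1,3) by (auto simp: cofinite_in_def)
    note P = induced_eq[OF i(1)] and I = induced_eq[OF i(2)]
    have "split_rep Q M TL TN (verts SP') (verts SI')"
    proof (rule split_rep_cofinite)
      show "verts SP' \<subseteq> A" "verts SI' \<subseteq> B" using P I by blast+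
      show "finite (A - verts SP')" "finite (B - verts SI')" by (rule i)+
    next
      fix a assume a: "a \<in> arcs Q" "tail Q a \<in> verts SP'"
      \<comment> \<open>\<open>A\<close> is successor-closed in \<open>Q\<close> itself, so
        closedness within \<open>A\<close> gives closedness in \<open>Q\<close>.\<close>
      then have "a \<in> arcs (Q \<restriction> A)" using A_closed[OF a(1)] P by auto
      then have "[a] \<in> paths (Q \<restriction> A) (tail Q a) (head Q a)"
        using wf_digraph.arc_in_paths[OF wellformed_induce_subgraph] by fastforce
      then show "head Q a \<in> verts SP'" using c(2) a(2) unfolding successor_closed_in_def by blast
    next
      fix a assume a: "a \<in> arcs Q" "head Q a \<in> verts SI'"
      \<comment> \<open>Closedness in all of \<open>Q\<close> matters here: removing the smaller
        \<open>SP'\<close> from the support leaves a larger quiver, in which \<open>SI'\<close> must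
        still be predecessor-closed.\<close>
      then have "a \<in> arcs (Q \<restriction> B)" using B_closed[OF a(1)] I by auto
      then have "[a] \<in> paths (Q \<restriction> B) (tail Q a) (head Q a)"
        using wf_digraph.arc_in_paths[OF wellformed_induce_subgraph] by fastforce
      then show "tail Q a \<in> verts SI'" using c(4) a(2) unfolding predecessor_closed_in_def by blast
    qed
    then have "properties_1_to_4 Q M (Q \<restriction> verts SP') (Q \<restriction> verts SI')" by (rule split_rep.properties)
    then show ?thesis using P I by metis
  qed
  moreover have "induced_subgraph (Q \<restriction> A) (supp Q M)" "induced_subgraph (Q \<restriction> B) (supp Q M)"
    unfolding supp_eq using A_TL B_TN TL_verts TN_verts by (intro induced_subgraph_mono; blast)+
  ultimately show ?thesis using properties by blast
qed

end
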